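(* Let $N\geq 3$ and let $\Omega\subset\mathbb{R}^{N}$ be a radially symmetric domain. (i) Let $\mathcal{A}\in L^{2}_{loc}(\Omega,\mathbb{R}^{N})$. If $\mathcal{A}(gx)=g\mathcal{A}(x)$ for all $g\in SO(N)$, $x\in\Omega$, then $\mathcal{A}(x)=\nu(|x|)x$ for some real-valued function $\nu$. In particular, $\mathcal{A}(x)=\nabla\varphi(x)$ for some $SO(N)$-invariant $\varphi\in W^{1,2}_{loc}(\Omega,\mathbb{R})$. (ii) If $\mathcal{B}=\operatorname{curl}\mathcal{A}$ (in the sense of distributions) for some $\mathcal{A}\in L_{loc}^{2}(\Omega,\mathbb{R}^{N})$ and $\mathcal{B}(gx)=g\mathcal{B}(x)g^{-1}$ for all $g\in SO(N)$, $x\in\Omega$, then $\mathcal{B}=0$.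
   Context: $SO(N)$ is the group of linear isometries of $\mathbb{R}^N$ with determinant $1$. A domain $\Omega$ is radially symmetric if $gx\in\Omega$ for all $x\in\Omega$ and $g\in SO(N)$. A function $\varphi$ is $SO(N)$-invariant if $\varphi(gx)=\varphi(x)$ for all $g\in SO(N)$, $x\in\Omega$. For a vector field $\mathcal{A}=(\mathcal{A}_1,\ldots,\mathcal{A}_N)$, $\operatorname{curl}\mathcal{A}$ is the $N\times N$ skew-symmetric matrix $\mathcal{B}$ with entries $\mathcal{B}_{jk}=\partial_j\mathcal{A}_k-\partial_k\mathcal{A}_j$, the derivatives being taken in the sense of distributions. The identity $\mathcal{B}(gx)=g\mathcal{B}(x)g^{-1}$ is accordingly an identity of matrix-valued distributions on $\Omega$ ($\mathcal{B}\circ g=g\mathcal{B}g^{-1}$). *)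

theory Defs
  imports "HOL-Analysis.Analysis"
begin

text \<open>Elements of $SO(N)$ are the matrices satisfying the library predicate
  \<^const>\<open>rotation_matrix\<close> (orthogonal, determinant 1), acting by \<^term>\<open>(*v)\<close>.\<close>

definition radially_symmetric :: "(real^'n) set \<Rightarrow> bool" where
  "radially_symmetric \<Omega> \<longleftrightarrow> (\<forall>g. rotation_matrix g \<longrightarrow> (\<forall>x\<in>\<Omega>. g *v x \<in> \<Omega>))"

definition SO_invariant :: "(real^'n) set \<Rightarrow> (real^'n \<Rightarrow> real) \<Rightarrow> bool" where
  "SO_invariant \<Omega> \<phi> \<longleftrightarrow> (\<forall>g. rotation_matrix g \<longrightarrow> (\<forall>x\<in>\<Omega>. \<phi> (g *v x) = \<phi> x))"


subsection \<open>Test functions\<close>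

definition partial_deriv :: "'n \<Rightarrow> (real^'n \<Rightarrow> real) \<Rightarrow> real^'n \<Rightarrow> real" where
  "partial_deriv j f x = frechet_derivative f (at x) (axis j 1)"

primrec iter_partial :: "'n list \<Rightarrow> (real^'n \<Rightarrow> real) \<Rightarrow> real^'n \<Rightarrow> real" where
  "iter_partial [] f = f"
| "iter_partial (j # js) f = partial_deriv j (iter_partial js f)"

text \<open>Every iterated partial derivative is differentiable, hence continuous; so this is
  $C^\infty$, and no junk value of \<^const>\<open>frechet_derivative\<close> is involved.\<close>

definition smooth :: "(real^'n \<Rightarrow> real) \<Rightarrow> bool" where
  "smooth f \<longleftrightarrow> (\<forall>js x. iter_partial js f differentiable (at x))"

text \<open>$C_c^\infty(\Omega)$; its elements are extended by zero to the whole space.\<close>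

definition test_functions :: "(real^'n) set \<Rightarrow> (real^'n \<Rightarrow> real) set" where
  "test_functions \<Omega> = {\<psi>. smooth \<psi> \<and> compact (closure {x. \<psi> x \<noteq> 0}) \<and> closure {x. \<psi> x \<noteq> 0} \<subseteq> \<Omega>}"


subsection \<open>Distributions\<close>

text \<open>A distribution on $\Omega$ with values in \<^typ>\<open>'b\<close> (scalars, vectors or matrices) is
  represented by a functional on scalar functions, of which only the values on the test functions
  of $\Omega$ matter; hence equality of distributions is \<open>dist_eq\<close>. Linearity and continuity
  are not imposed: they are automatic for the distributions obtained below from locally
  integrable functions.\<close>

type_synonym ('n, 'b) distribution = "(real^'n \<Rightarrow> real) \<Rightarrow> 'b"

definition dist_eq :: "(real^'n) set \<Rightarrow> ('n, 'b) distribution \<Rightarrow> ('n, 'b) distribution \<Rightarrow> bool" where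
  "dist_eq \<Omega> S T \<longleftrightarrow> (\<forall>\<psi>\<in>test_functions \<Omega>. S \<psi> = T \<psi>)"

definition regular_dist :: "(real^'n) set \<Rightarrow> (real^'n \<Rightarrow> 'b::euclidean_space) \<Rightarrow> ('n, 'b) distribution" where
  "regular_dist \<Omega> f \<psi> = (LINT x|lebesgue_on \<Omega>. \<psi> x *\<^sub>R f x)"

definition dist_partial :: "'n::finite \<Rightarrow> ('n, real) distribution \<Rightarrow> ('n, real) distribution" where
  "dist_partial j T \<psi> = - T (partial_deriv j \<psi>)"

text \<open>The composition $T \circ g$ with a rotation. No Jacobian factor appears because $\det g = 1$:
  for $T = f\,dx$ one has $\int f(gx)\psi(x)\,dx = \int f(y)\psi(g^{-1}y)\,dy$.\<close>

definition dist_comp :: "('n::finite, 'b) distribution \<Rightarrow> real^'n^'n \<Rightarrow> ('n, 'b) distribution" where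
  "dist_comp T g \<psi> = T (\<lambda>y. \<psi> (matrix_inv g *v y))"

definition dist_conj :: "real^'n^'n \<Rightarrow> ('n::finite, real^'n^'n) distribution \<Rightarrow> ('n, real^'n^'n) distribution" where
  "dist_conj g B \<psi> = g ** B \<psi> ** matrix_inv g"

definition dist_grad :: "(real^'n) set \<Rightarrow> (real^'n \<Rightarrow> real) \<Rightarrow> ('n, real^'n) distribution" where
  "dist_grad \<Omega> \<phi> \<psi> = (\<chi> j. dist_partial j (regular_dist \<Omega> \<phi>) \<psi>)"

definition dist_curl :: "(real^'n) set \<Rightarrow> (real^'n \<Rightarrow> real^'n) \<Rightarrow> ('n, real^'n^'n) distribution" where
  "dist_curl \<Omega> A \<psi> =
     (\<chi> j k. dist_partial j (regular_dist \<Omega> (\<lambda>x. A x $ k)) \<psi>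
           - dist_partial k (regular_dist \<Omega> (\<lambda>x. A x $ j)) \<psi>)"


subsection \<open>Function spaces\<close>

definition L2_loc :: "(real^'n) set \<Rightarrow> (real^'n \<Rightarrow> 'b::euclidean_space) set" where
  "L2_loc \<Omega> = {f. f \<in> borel_measurable (lebesgue_on \<Omega>) \<and>
     (\<forall>K. compact K \<and> K \<subseteq> \<Omega> \<longrightarrow> integrable (lebesgue_on K) (\<lambda>x. (norm (f x))\<^sup>2))}"

definition has_weak_gradient :: "(real^'n) set \<Rightarrow> (real^'n \<Rightarrow> real) \<Rightarrow> (real^'n \<Rightarrow> real^'n) \<Rightarrow> bool" where
  "has_weak_gradient \<Omega> \<phi> G \<longleftrightarrow> dist_eq \<Omega> (dist_grad \<Omega> \<phi>) (regular_dist \<Omega> G)"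

definition W12_loc :: "(real^'n) set \<Rightarrow> (real^'n \<Rightarrow> real) set" where
  "W12_loc \<Omega> = {\<phi> \<in> L2_loc \<Omega>. \<exists>G\<in>L2_loc \<Omega>. has_weak_gradient \<Omega> \<phi> G}"

end

theory Submission
  imports Defs "HOL-Computational_Algebra.Polynomial"
begin

text \<open>Why the theorem holds. Write $N$ for the dimension and $e_a$ for a coordinate vector. Rotations act
transitively on each sphere around the origin, so an equivariant field, of vectors or of matrices,
that is defined at every point is determined by its values on one axis. At the point $r e_a$ every
rotation fixing $e_a$ may be used, and the diagonal rotations that flip two coordinate signs are
already enough. They force a vector field to be radial (\<open>equivariant_field_radial\<close>). They force a
skew matrix field to vanish when $N \ge 4$ (\<open>equivariant_skew_zero\<close>); when $N = 3$ they leave one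
coefficient, and the field is a radial magnetic field whose size is determined by the scalar
$x \cdot b(x)$ (\<open>equivariant_skew_flux\<close>).

The hypotheses hold only almost everywhere, or only for distributions. The usual remedy is to average
over $SO(N)$ with Haar measure. Here it is replaced by convolution with a smooth radial mollifier,
which commutes with rotations: the mollified field is defined at every point and is equivariant at
every point. Convergence of mollifications in $L^1$ then yields the profile $\nu$ as an almost everywhere
limit of the profiles of the mollified fields (\<open>radial_profile_integrable\<close>, glued over a radial
exhaustion of the domain in \<open>radial_profile\<close>).

For the potential, put $\varphi(x) = \Phi(|x|)$ with $\Phi(r) = \int_c^r \nu(s) s \, ds$. The measure
$|x|_* dx$ has density proportional to $r^{N-1}$ (\<open>radial_integration\<close>), which turns integrability of the
field into integrability of the profile. Away from the origin the gradient formula holds for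
continuous profiles by the chain rule and for integrable ones by density
(\<open>radial_integration_by_parts\<close>). If the origin belongs to the domain, the Cauchy--Schwarz inequality gives
$\Phi(r)^2 r^{N-1} \le C$ (\<open>\<Phi>_near_origin\<close>); together with the integrability of $|x|^{-2}$
this makes $\varphi$ locally square integrable and lets a cut-off at the origin be removed (\<open>weak_gradient\<close>).

For the second part let $B_\epsilon(x)$ be $B$ applied to the mollifier centred at $x$. This is a continuous
function, equivariant at every point, and it is the curl of the mollified field. If $N \ge 4$ it
vanishes by linear algebra. If $N = 3$ the scalar $S(x) = x \cdot b_\epsilon(x)$ is constant on spheres, and
$\int \chi(|x|) S(x) \, dx = 0$ for every radial $\chi$: this pairing is the integral of the
mollified field against the curl of $\chi(|x|) x$, which is zero. It expresses that a curl has no flux through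
spheres. Being continuous and radial, $S$ vanishes, and with it $B_\epsilon$ (\<open>mollified_curl_zero\<close>). Letting
$\epsilon \to 0$ gives $B = 0$ (\<open>equivariant_curl_zero\<close>).\<close>

section \<open>Lebesgue measure under isometries and under the norm\<close>

text \<open>The image of Lebesgue measure under an orthogonal map $f$ is again translation invariant, and it gives
the unit ball the same measure because $f$ preserves norms. Two translation-invariant measures are
proportional: evaluating the double integral of $1_S(x) 1_B(y)$ after the substitutions $x \mapsto x + y$
and $y \mapsto y - x$ gives $\mu(S) \lambda(B) = \lambda(S) \mu(B)$.\<close>

lemma lborel_distr_orthogonal:
  fixes f :: "'a::euclidean_space \<Rightarrow> 'a"
  assumes f: "orthogonal_transformation f"
  shows "distr lborel borel f = lborel"
proof -
  let ?\<mu> = "distr lborel borel f" and ?B = "cball 0 1 :: 'a set"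
  have B[measurable, simp]: "?B \<in> sets borel" by (rule borel_closed) simp
  have lin: "linear f" using f by (rule orthogonal_transformation_linear)
  have [measurable]: "f \<in> borel_measurable borel"
    using lin by (intro borel_measurable_continuous_onI linear_continuous_on) (simp add: linear_conv_bounded_linear)
  have nf: "norm (f x) = norm x" for x using f by (rule orthogonal_transformation_norm)
  have vim: "f -` cball 0 r = cball 0 r" for r by (auto simp: nf)
  have \<mu>cb: "emeasure ?\<mu> (cball 0 r) = emeasure lborel (cball 0 r :: 'a set)" for r
    by (subst emeasure_distr) (auto simp: vim)
  interpret M: sigma_finite_measure ?\<mu>
  proof
    show "\<exists>A. countable A \<and> A \<subseteq> sets ?\<mu> \<and> \<Union> A = space ?\<mu> \<and> (\<forall>a\<in>A. emeasure ?\<mu> a \<noteq> \<infinity>)"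
    proof (intro exI conjI ballI)
      show "countable (range (\<lambda>n::nat. cball (0::'a) (real n)))" by simp
      show "\<Union> (range (\<lambda>n::nat. cball (0::'a) (real n))) = space ?\<mu>"
        by (auto simp: real_arch_simple)
      show "range (\<lambda>n::nat. cball (0::'a) (real n)) \<subseteq> sets ?\<mu>" by (auto intro: borel_closed)
      fix a assume "a \<in> range (\<lambda>n::nat. cball (0::'a) (real n))"
      then show "emeasure ?\<mu> a \<noteq> \<infinity>" by (auto simp: \<mu>cb emeasure_cball)
    qed
  qed
  interpret P: pair_sigma_finite lborel ?\<mu> ..
  have trl: "(\<integral>\<^sup>+x. h (c + x) \<partial>lborel) = (\<integral>\<^sup>+x. h x \<partial>lborel)" 
    if [measurable]: "h \<in> borel_measurable borel" for h and c :: 'a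
    by (subst (2) lborel_distr_plus[of c, symmetric], subst nn_integral_distr) auto
  \<comment> \<open>a translation by $c = f(d)$ on the image side is a translation by $d$ on the source side\<close>
  have trm: "(\<integral>\<^sup>+x. h (c + x) \<partial>?\<mu>) = (\<integral>\<^sup>+x. h x \<partial>?\<mu>)" 
    if [measurable]: "h \<in> borel_measurable borel" for h and c :: 'a
  proof -
    obtain d where d: "f d = c" using orthogonal_transformation_surj[OF f] by (metis surjD)
    have "(\<integral>\<^sup>+x. h (c + x) \<partial>?\<mu>) = (\<integral>\<^sup>+x. h (c + f x) \<partial>lborel)"
      by (subst nn_integral_distr) auto
    also have "\<dots> = (\<integral>\<^sup>+x. h (f (d + x)) \<partial>lborel)"
      by (simp add: linear_add[OF lin] d)
    also have "\<dots> = (\<integral>\<^sup>+x. h (f x) \<partial>lborel)" by (rule trl[of "\<lambda>x. h (f x)"]) simp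
    also have "\<dots> = (\<integral>\<^sup>+x. h x \<partial>?\<mu>)" by (subst nn_integral_distr) auto
    finally show ?thesis .
  qed
  show ?thesis
  proof (rule measure_eqI)
    fix S assume "S \<in> sets ?\<mu>"
    then have [measurable]: "S \<in> sets borel" by simp
    have "emeasure ?\<mu> S * emeasure lborel ?B = (\<integral>\<^sup>+x. (\<integral>\<^sup>+y. indicator S x * indicator ?B y \<partial>lborel) \<partial>?\<mu>)"
    proof -
      have "(\<integral>\<^sup>+y. indicator S x * indicator ?B y \<partial>lborel) = indicator S x * emeasure lborel ?B" for x
        by (subst nn_integral_cmult) auto
      then show ?thesis by (simp only: ) (subst nn_integral_multc, auto)
    qed
    also have "\<dots> = (\<integral>\<^sup>+y. (\<integral>\<^sup>+x. indicator S x * indicator ?B y \<partial>?\<mu>) \<partial>lborel)"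
      by (rule P.Fubini') (simp add: split_beta')
    also have "\<dots> = (\<integral>\<^sup>+y. (\<integral>\<^sup>+x. indicator S (y + x) * indicator ?B y \<partial>?\<mu>) \<partial>lborel)"
      by (rule nn_integral_cong, rule trm[symmetric]) simp
    also have "\<dots> = (\<integral>\<^sup>+x. (\<integral>\<^sup>+y. indicator S (y + x) * indicator ?B y \<partial>lborel) \<partial>?\<mu>)"
      by (rule P.Fubini'[symmetric]) (simp add: split_beta')
    also have "\<dots> = (\<integral>\<^sup>+x. (\<integral>\<^sup>+y. indicator S y * indicator ?B (y - x) \<partial>lborel) \<partial>?\<mu>)"
    proof (rule nn_integral_cong)
      fix x :: 'a
      show "(\<integral>\<^sup>+y. indicator S (y + x) * indicator ?B y \<partial>lborel) 
          = (\<integral>\<^sup>+y. indicator S y * indicator ?B (y - x) \<partial>lborel)"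
        using trl[of "\<lambda>y. indicator S (y + x) * indicator ?B y" "-x"] by simp
    qed
    also have "\<dots> = (\<integral>\<^sup>+y. (\<integral>\<^sup>+x. indicator S y * indicator ?B (y - x) \<partial>?\<mu>) \<partial>lborel)"
      by (rule P.Fubini') (simp add: split_beta')
    also have "\<dots> = (\<integral>\<^sup>+y. (\<integral>\<^sup>+x. indicator S y * indicator ?B x \<partial>?\<mu>) \<partial>lborel)"
    proof (rule nn_integral_cong)
      fix y :: 'a
      have "(\<integral>\<^sup>+x. indicator S y * indicator ?B (y - x) \<partial>?\<mu>) 
          = (\<integral>\<^sup>+x. indicator S y * indicator ?B (y - (y + x)) \<partial>?\<mu>)"
        by (rule trm[symmetric]) simp
      also have "\<dots> = (\<integral>\<^sup>+x. indicator S y * indicator ?B x \<partial>?\<mu>)"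
        by (intro nn_integral_cong) (simp add: indicator_def)
      finally show "(\<integral>\<^sup>+x. indicator S y * indicator ?B (y - x) \<partial>?\<mu>) 
          = (\<integral>\<^sup>+x. indicator S y * indicator ?B x \<partial>?\<mu>)" .
    qed
    also have "\<dots> = emeasure lborel S * emeasure lborel ?B"
    proof -
      have "(\<integral>\<^sup>+x. indicator S y * indicator ?B x \<partial>?\<mu>) = indicator S y * emeasure lborel ?B" for y
        by (subst nn_integral_cmult) (auto simp: \<mu>cb)
      then show ?thesis by (simp only: ) (subst nn_integral_multc, auto)
    qed
    finally have "emeasure lborel ?B * emeasure ?\<mu> S = emeasure lborel ?B * emeasure lborel S"
      by (simp add: mult.commute)
    moreover have "emeasure lborel ?B \<noteq> 0" "emeasure lborel ?B \<noteq> \<infinity>"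
      by (simp_all add: emeasure_cball unit_ball_vol_pos[THEN less_imp_neq, THEN not_sym])
    ultimately show "emeasure ?\<mu> S = emeasure lborel S"
      by (simp add: ennreal_mult_cancel_left)
  qed simp
qed

text \<open>Both measures give the half-line up to $a$ the volume of the ball of radius $a$; for the second measure this is
the fundamental theorem of calculus for $r \mapsto r^N$. Half-lines generate the Borel sets.\<close>

lemma norm_distr_lborel:
  "distr lborel borel (norm :: 'a::euclidean_space \<Rightarrow> real) =
    density lborel (\<lambda>r. ennreal (DIM('a) * unit_ball_vol DIM('a) * r ^ (DIM('a) - 1)) * indicator {0..} r)"
  (is "?L = density lborel ?w")
proof (rule measure_eqI_generator_eq)
  let ?E = "range (atMost :: real \<Rightarrow> real set)"
  have [measurable]: "?w \<in> borel_measurable borel" by measurable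
  show "Int_stable ?E" by (auto simp: Int_stable_def)
  show "?E \<subseteq> Pow UNIV" by simp
  show "sets ?L = sigma_sets UNIV ?E"
    by (subst sets_distr, subst borel_eq_atMost) simp
  show "sets (density lborel ?w) = sigma_sets UNIV ?E"
    by (subst sets_density, subst sets_lborel, subst borel_eq_atMost) simp
  show "range (\<lambda>n::nat. {..real n}) \<subseteq> ?E" by auto
  show "(\<Union>n::nat. {..real n}) = UNIV" by (auto simp: real_arch_simple)
  have L: "emeasure ?L {..a} = emeasure lborel (cball (0::'a) a)" for a
    by (subst emeasure_distr) (auto intro!: arg_cong[of _ _ "emeasure lborel"])
  show "emeasure ?L {..real n} \<noteq> \<infinity>" for n by (simp add: L emeasure_cball)
  fix X assume "X \<in> ?E"
  then obtain a where X: "X = {..a}" by auto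
  show "emeasure ?L X = emeasure (density lborel ?w) X"
  proof (cases "0 \<le> a")
    case True
    have "emeasure (density lborel ?w) X = 
        (\<integral>\<^sup>+r. ennreal (DIM('a) * unit_ball_vol DIM('a) * r ^ (DIM('a) - 1)) * indicator {0..a} r \<partial>lborel)"
      unfolding X by (subst emeasure_density) (auto intro!: nn_integral_cong split: split_indicator)
    also have "\<dots> = unit_ball_vol DIM('a) * a ^ DIM('a) - unit_ball_vol DIM('a) * 0 ^ DIM('a)"
      by (rule nn_integral_FTC_Icc[where F="\<lambda>r. unit_ball_vol DIM('a) * r ^ DIM('a)"])
        (auto intro!: derivative_eq_intros True)
    finally show ?thesis using True by (simp add: X L emeasure_cball)
  next
    case False
    then have "cball (0::'a) a = {}" by simp
    moreover have "emeasure (density lborel ?w) X = (\<integral>\<^sup>+r. ?w r * indicator X r \<partial>lborel)"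
      by (rule emeasure_density) (simp_all add: X)
    moreover have "\<dots> = (\<integral>\<^sup>+(r::real). 0 \<partial>lborel)"
      using False unfolding X by (intro nn_integral_cong) (simp split: split_indicator)
    ultimately show ?thesis by (simp add: X L)
  qed
qed

text \<open>The indicator of a set of finite measure is squeezed by a Urysohn function between a compact subset
and a bounded open superset of almost the same measure. Sums and dominated limits preserve
the approximation property.\<close>

lemma integrable_approx_continuous:
  fixes f :: "'a::euclidean_space \<Rightarrow> real"
  assumes "integrable lborel f" "e > 0"
  shows "\<exists>g r. continuous_on UNIV g \<and> (\<forall>x. r < norm x \<longrightarrow> g x = 0) \<and> integrable lborel g \<and> (\<integral>x. \<bar>f x - g x\<bar> \<partial>lborel) < e"
  using assms
proof (induction f arbitrary: e)
  case (base A c)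
  then have A[measurable]: "A \<in> sets borel" and Afin: "emeasure lborel A < \<infinity>" by simp_all
  define e' where "e' = e / (3 * (\<bar>c\<bar> + 1))"
  have e': "e' > 0" using base by (simp add: e'_def)
  have "A \<in> sets lebesgue" by simp
  then obtain C where C: "closed C" "C \<subseteq> A" and AC: "emeasure lebesgue (A - C) < ennreal e'"
    using sets_lebesgue_inner_closed[OF _ e'] by metis
  have [measurable]: "C \<in> sets borel" using C(1) by (rule borel_closed)
  have [measurable]: "C \<inter> cball 0 (real n) \<in> sets borel" for n by measurable
  have "(\<lambda>n. emeasure lborel (A - C \<inter> cball 0 (real n))) \<longlonglongrightarrow> emeasure lborel (\<Inter>n. A - C \<inter> cball 0 (real n))"
  proof (rule Lim_emeasure_decseq)
    show "decseq (\<lambda>n. A - C \<inter> cball 0 (real n))" by (auto simp: decseq_def)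
    show "emeasure lborel (A - C \<inter> cball 0 (real n)) \<noteq> \<infinity>" for n
      using Afin emeasure_mono[of "A - C \<inter> cball 0 (real n)" A lborel] by (auto simp: less_top top_unique)
  qed auto
  also have "(\<Inter>n. A - C \<inter> cball 0 (real n)) = A - C"
    by (auto simp: real_arch_simple)
  finally have lim: "(\<lambda>n. emeasure lborel (A - C \<inter> cball 0 (real n))) \<longlonglongrightarrow> emeasure lborel (A - C)" .
  have "emeasure lborel (A - C) < ennreal e'" using AC by simp
  from order_tendstoD(2)[OF lim this] obtain n :: nat
    where n: "emeasure lborel (A - C \<inter> cball 0 (real n)) < ennreal e'"
    by (auto simp: eventually_sequentially)
  define K where "K = C \<inter> cball 0 (real n)"
  have K: "compact K" "K \<subseteq> A" using C by (auto simp: K_def intro: closed_Int_compact)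
  have [measurable]: "K \<in> sets borel" by (simp add: K_def)
  have "K \<in> sets lebesgue" by simp
  then obtain T where T: "open T" "K \<subseteq> T" "emeasure lebesgue (T - K) < ennreal e'"
    using sets_lebesgue_outer_open[OF _ e'] by metis
  define U where "U = T \<inter> ball 0 (real n + 1)"
  have U: "open U" "K \<subseteq> U" using T by (auto simp: U_def K_def)
  have [measurable]: "U \<in> sets borel" using U(1) by (rule borel_open)
  have UK: "emeasure lborel (U - K) < ennreal e'"
  proof -
    have [measurable]: "T \<in> sets borel" using T(1) by (rule borel_open)
    have "emeasure lborel (U - K) \<le> emeasure lborel (T - K)" by (rule emeasure_mono) (auto simp: U_def)
    also have "\<dots> < ennreal e'" using T(3) by simp
    finally show ?thesis .
  qed
  obtain g :: "'a \<Rightarrow> real" where g: "continuous_on UNIV g" "\<And>x. g x \<in> closed_segment 0 1"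
      "\<And>x. x \<in> - U \<Longrightarrow> g x = 0" "\<And>x. x \<in> K \<Longrightarrow> g x = 1"
    using Urysohn[of "- U" K 0 "1::real"] U K by (auto simp: compact_imp_closed)
  have g01: "0 \<le> g x" "g x \<le> 1" for x using g(2)[of x] by (auto simp: closed_segment_eq_real_ivl)
  have [measurable]: "g \<in> borel_measurable borel" using g(1) by (rule borel_measurable_continuous_onI)
  have fins: "emeasure lborel (A - K) \<noteq> \<infinity>" "emeasure lborel (U - K) \<noteq> \<infinity>" "emeasure lborel U \<noteq> \<infinity>"
  proof -
    show "emeasure lborel (A - K) \<noteq> \<infinity>" using n by (auto simp: K_def)
    show "emeasure lborel (U - K) \<noteq> \<infinity>" using UK by auto
    have "emeasure lborel U \<le> emeasure lborel (ball (0::'a) (real n + 1))" by (rule emeasure_mono) (auto simp: U_def)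
    then show "emeasure lborel U \<noteq> \<infinity>" by (auto simp: emeasure_ball top_unique)
  qed
  have gint: "integrable lborel g"
  proof (rule Bochner_Integration.integrable_bound)
    show "integrable lborel (indicator U :: 'a \<Rightarrow> real)" using fins by (simp add: less_top)
    show "AE x in lborel. norm (g x) \<le> norm (indicator U x :: real)"
      using g01 g(3) by (intro AE_I2) (auto split: split_indicator)
  qed simp
  have "(\<integral>x. \<bar>indicator A x *\<^sub>R c - c * g x\<bar> \<partial>lborel) \<le> (\<integral>x. \<bar>c\<bar> * (indicator (A - K) x + indicator (U - K) x) \<partial>lborel)"
  proof (rule integral_mono)
    show "integrable lborel (\<lambda>x. \<bar>indicator A x *\<^sub>R c - c * g x\<bar>)"
      using gint Afin by (intro integrable_abs Bochner_Integration.integrable_diff) auto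
    show "integrable lborel (\<lambda>x. \<bar>c\<bar> * (indicator (A - K) x + indicator (U - K) x))"
      using fins by (auto simp: less_top)
    fix x :: 'a
    have "\<bar>indicator A x *\<^sub>R c - c * g x\<bar> = \<bar>c\<bar> * \<bar>indicator A x - g x\<bar>"
      by (simp add: abs_mult[symmetric] algebra_simps)
    also have "\<dots> \<le> \<bar>c\<bar> * (indicator (A - K) x + indicator (U - K) x)"
    proof (rule mult_left_mono)
      show "\<bar>indicator A x - g x\<bar> \<le> indicator (A - K) x + indicator (U - K) x"
        using g01[of x] g(3,4)[of x] K(2) U(2) by (auto split: split_indicator)
    qed simp
    finally show "\<bar>indicator A x *\<^sub>R c - c * g x\<bar> \<le> \<bar>c\<bar> * (indicator (A - K) x + indicator (U - K) x)" .
  qed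
  also have "\<dots> = \<bar>c\<bar> * (measure lborel (A - K) + measure lborel (U - K))"
    using fins by (subst Bochner_Integration.integral_mult_right) (auto simp: less_top Bochner_Integration.integral_add)
  also have "\<dots> \<le> \<bar>c\<bar> * (e' + e')"
  proof (intro mult_left_mono add_mono)
    show "measure lborel (A - K) \<le> e'" using n e' by (simp add: K_def measure_def enn2real_leI less_imp_le)
    show "measure lborel (U - K) \<le> e'" using UK e' by (simp add: measure_def enn2real_leI less_imp_le)
  qed simp
  also have "\<dots> < e"
  proof -
    have "\<bar>c\<bar> * e' \<le> (\<bar>c\<bar> + 1) * e'" using e' by (intro mult_right_mono) auto
    also have "\<dots> = e / 3" by (simp add: e'_def divide_simps)
    finally show ?thesis using base(3) by (simp add: algebra_simps)
  qed
  finally have *: "(\<integral>x. \<bar>indicator A x *\<^sub>R c - c * g x\<bar> \<partial>lborel) < e" .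
  show ?case
  proof (intro exI[of _ "\<lambda>x. c * g x"] exI[of _ "real n + 1"] conjI allI impI)
    show "continuous_on UNIV (\<lambda>x. c * g x)" using g(1) by (intro continuous_intros)
    fix x :: 'a assume "real n + 1 < norm x" then show "c * g x = 0" using g(3)[of x] by (auto simp: U_def)
  qed (use gint * in auto)
next
  case (add f1 f2)
  obtain g1 r1 where g1: "continuous_on UNIV g1" "\<forall>x. r1 < norm x \<longrightarrow> g1 x = 0" "integrable lborel g1" 
      "(\<integral>x. \<bar>f1 x - g1 x\<bar> \<partial>lborel) < e/2" using add(3)[of "e/2"] add(5) by auto
  obtain g2 r2 where g2: "continuous_on UNIV g2" "\<forall>x. r2 < norm x \<longrightarrow> g2 x = 0" "integrable lborel g2" 
      "(\<integral>x. \<bar>f2 x - g2 x\<bar> \<partial>lborel) < e/2" using add(4)[of "e/2"] add(5) by auto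
  have "(\<integral>x. \<bar>f1 x + f2 x - (g1 x + g2 x)\<bar> \<partial>lborel) \<le> (\<integral>x. \<bar>f1 x - g1 x\<bar> + \<bar>f2 x - g2 x\<bar> \<partial>lborel)"
    using add(1,2) g1(3) g2(3) by (intro integral_mono) auto
  also have "\<dots> < e" using add(1,2) g1(3,4) g2(3,4) by (subst Bochner_Integration.integral_add) auto
  finally have *: "(\<integral>x. \<bar>f1 x + f2 x - (g1 x + g2 x)\<bar> \<partial>lborel) < e" .
  show ?case
    by (rule exI[of _ "\<lambda>x. g1 x + g2 x"], rule exI[of _ "max r1 r2"]) 
      (use g1 g2 * in \<open>auto intro!: continuous_intros\<close>)
next
  case (lim f s)
  have "(\<lambda>i. \<integral>x. \<bar>s i x - f x\<bar> \<partial>lborel) \<longlonglongrightarrow> (\<integral>(x::'a). 0 \<partial>lborel)"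
  proof (rule integral_dominated_convergence[where w="\<lambda>x. 3 * \<bar>f x\<bar>"])
    have [measurable]: "f \<in> borel_measurable lborel" "\<And>i. s i \<in> borel_measurable lborel" using lim by auto
    show "(\<lambda>x. \<bar>s i x - f x\<bar>) \<in> borel_measurable lborel" for i by measurable
    show "AE x in lborel. (\<lambda>i. \<bar>s i x - f x\<bar>) \<longlonglongrightarrow> 0"
    proof (rule AE_I2)
      fix x :: 'a
      have "(\<lambda>i. \<bar>s i x - f x\<bar>) \<longlonglongrightarrow> \<bar>f x - f x\<bar>" using lim(2)[of x] by (intro tendsto_intros) simp
      then show "(\<lambda>i. \<bar>s i x - f x\<bar>) \<longlonglongrightarrow> 0" by simp
    qed
    show "AE x in lborel. norm \<bar>s i x - f x\<bar> \<le> 3 * \<bar>f x\<bar>" for i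
    proof (rule AE_I2)
      fix x :: 'a show "norm \<bar>s i x - f x\<bar> \<le> 3 * \<bar>f x\<bar>" using lim(3)[of x i] by simp
    qed
  qed (use lim in auto)
  then have "(\<lambda>i. \<integral>x. \<bar>s i x - f x\<bar> \<partial>lborel) \<longlonglongrightarrow> 0" by simp
  from order_tendstoD(2)[OF this, of "e/2"] lim(6) obtain i where i: "(\<integral>x. \<bar>s i x - f x\<bar> \<partial>lborel) < e/2"
    by (auto simp: eventually_sequentially)
  obtain g r where g: "continuous_on UNIV g" "\<forall>x. r < norm x \<longrightarrow> g x = 0" "integrable lborel g" 
      "(\<integral>x. \<bar>s i x - g x\<bar> \<partial>lborel) < e/2" using lim(5)[of "e/2" i] lim(6) by auto
  have "(\<integral>x. \<bar>f x - g x\<bar> \<partial>lborel) \<le> (\<integral>x. \<bar>s i x - f x\<bar> + \<bar>s i x - g x\<bar> \<partial>lborel)"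
    using lim(1)[of i] lim(4) g(3) by (intro integral_mono) auto
  also have "\<dots> < e" using lim(1)[of i] lim(4) g(3,4) i by (subst Bochner_Integration.integral_add) auto
  finally show ?case using g by auto
qed

lemma integral_shift:
  fixes f :: "'a::euclidean_space \<Rightarrow> real"
  assumes [measurable]: "f \<in> borel_measurable borel"
  shows "(\<integral>x. f (c + x) \<partial>lborel) = (\<integral>x. f x \<partial>lborel)"
  by (subst (2) lborel_distr_plus[of c, symmetric], subst integral_distr) auto

lemma integrable_shift:
  fixes f :: "'a::euclidean_space \<Rightarrow> real"
  assumes "integrable lborel f"
  shows "integrable lborel (\<lambda>x. f (c + x))"
proof -
  have "integrable (distr lborel borel ((+) c)) f" using assms by (simp add: lborel_distr_plus)
  then show ?thesis by (rule integrable_distr[rotated]) simp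
qed

lemma measurable_orthogonal: "orthogonal_transformation f \<Longrightarrow> f \<in> borel_measurable borel" 
  for f :: "'a::euclidean_space \<Rightarrow> 'a"
  by (intro borel_measurable_continuous_onI linear_continuous_on)
     (simp add: linear_conv_bounded_linear[symmetric] orthogonal_transformation_linear)

lemma integral_orthogonal:
  fixes h :: "'a::euclidean_space \<Rightarrow> real" and f :: "'a \<Rightarrow> 'a"
  assumes f: "orthogonal_transformation f" and [measurable]: "h \<in> borel_measurable borel"
  shows "(\<integral>x. h (f x) \<partial>lborel) = (\<integral>x. h x \<partial>lborel)"
proof -
  note [measurable] = measurable_orthogonal[OF f]
  show ?thesis by (subst (2) lborel_distr_orthogonal[OF f, symmetric], subst integral_distr) auto
qed

lemma orthogonal_transformation_uminus: "orthogonal_transformation (uminus :: 'a::euclidean_space \<Rightarrow> 'a)"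
  by (simp add: orthogonal_transformation_def linear_iff)

lemma integral_reflect:
  fixes f :: "'a::euclidean_space \<Rightarrow> real"
  assumes [measurable]: "f \<in> borel_measurable borel"
  shows "(\<integral>x. f (c - x) \<partial>lborel) = (\<integral>x. f x \<partial>lborel)"
  using integral_orthogonal[OF orthogonal_transformation_uminus, of "\<lambda>x. f (c + x)"] integral_shift[of f c] by simp

lemma integrable_reflect:
  fixes f :: "'a::euclidean_space \<Rightarrow> real"
  assumes "integrable lborel f"
  shows "integrable lborel (\<lambda>x. f (c - x))"
proof -
  have "integrable (distr lborel borel uminus) (\<lambda>x. f (c + x))" 
    using integrable_shift[OF assms] by (simp add: lborel_distr_orthogonal[OF orthogonal_transformation_uminus])
  from integrable_distr[OF _ this] show ?thesis by simp
qed

lemma borel_measurable_vec_nth [measurable (raw)]: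
  fixes f :: "'a \<Rightarrow> real^'n"
  assumes "f \<in> borel_measurable M"
  shows "(\<lambda>x. f x $ i) \<in> borel_measurable M"
  by (rule measurable_compose[OF assms]) simp

lemma borel_measurable_vec_lambda:
  fixes f :: "'n::finite \<Rightarrow> 'a \<Rightarrow> real"
  assumes "\<And>i. f i \<in> borel_measurable M"
  shows "(\<lambda>x. \<chi> i. f i x) \<in> borel_measurable M"
  by (rule borel_measurable_euclidean_space[THEN iffD2]) (use assms in \<open>auto simp: Basis_vec_def inner_axis\<close>)

lemma borel_compact: "compact K \<Longrightarrow> K \<in> sets borel" for K :: "'a::euclidean_space set"
  by (rule borel_closed[OF compact_imp_closed])

lemma emeasure_compact_finite: "compact K \<Longrightarrow> emeasure lborel (K :: 'a::euclidean_space set) < \<infinity>"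
  by (rule emeasure_bounded_finite) (rule compact_imp_bounded)

lemma integrable_indicator_compact: "compact K \<Longrightarrow> integrable lborel (indicator K :: 'a::euclidean_space \<Rightarrow> real)"
  using emeasure_compact_finite[of K] borel_compact[of K] by (intro integrable_real_indicator) auto

lemma integrable_indicator_bounded:
  "bounded A \<Longrightarrow> A \<in> sets borel \<Longrightarrow> integrable lborel (indicator A :: 'a::euclidean_space \<Rightarrow> real)"
  using emeasure_bounded_finite[of A] by (intro integrable_real_indicator) auto

text \<open>The area of the sphere of radius $r$ in $\mathbb{R}^N$. It is cut off at negative radii so that integrals
over all of $\mathbb{R}$ can be used.\<close>

definition sphere_weight :: "nat \<Rightarrow> real \<Rightarrow> real" where
  "sphere_weight N r = (real N * unit_ball_vol (real N) * r ^ (N - 1)) * indicator {0..} r"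

lemma sphere_weight_measurable [measurable]: "sphere_weight N \<in> borel_measurable borel"
  unfolding sphere_weight_def[abs_def] by measurable

lemma sphere_weight_nonneg: "sphere_weight N r \<ge> 0"
  by (auto simp: sphere_weight_def split: split_indicator)

lemma sphere_weight_mono: "r \<le> s \<Longrightarrow> sphere_weight N r \<le> sphere_weight N s"
  by (auto simp: sphere_weight_def intro!: mult_left_mono power_mono mult_nonneg_nonneg split: split_indicator)

lemma sphere_weight_pos: "N > 0 \<Longrightarrow> r > 0 \<Longrightarrow> sphere_weight N r > 0"
  by (simp add: sphere_weight_def)

lemma radial_integration:
  fixes h :: "real \<Rightarrow> real"
  assumes [measurable]: "h \<in> borel_measurable borel"
  shows "integrable lborel (\<lambda>x::real^'n. h (norm x)) \<longleftrightarrow> integrable lborel (\<lambda>r. sphere_weight CARD('n) r * h r)"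
    "(\<integral>(x::real^'n). h (norm x) \<partial>lborel) = (\<integral>r. sphere_weight CARD('n) r * h r \<partial>lborel)"
proof -
  have D: "distr lborel borel (norm :: real^'n \<Rightarrow> real) = density lborel (\<lambda>r. ennreal (sphere_weight CARD('n) r))"
    unfolding norm_distr_lborel sphere_weight_def
    by (intro density_cong) (auto split: split_indicator)
  have "integrable lborel (\<lambda>x::real^'n. h (norm x)) \<longleftrightarrow> integrable (distr lborel borel (norm :: real^'n \<Rightarrow> real)) h"
    by (rule integrable_distr_eq[symmetric]) auto
  also have "\<dots> \<longleftrightarrow> integrable lborel (\<lambda>r. sphere_weight CARD('n) r * h r)"
    unfolding D by (subst integrable_density) (auto simp: sphere_weight_nonneg)
  finally show "integrable lborel (\<lambda>x::real^'n. h (norm x)) \<longleftrightarrow> integrable lborel (\<lambda>r. sphere_weight CARD('n) r * h r)" .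
  have "(\<integral>(x::real^'n). h (norm x) \<partial>lborel) = integral\<^sup>L (distr lborel borel (norm :: real^'n \<Rightarrow> real)) h"
    by (rule integral_distr[symmetric]) auto
  also have "\<dots> = (\<integral>r. sphere_weight CARD('n) r * h r \<partial>lborel)"
    unfolding D by (subst integral_density) (auto simp: sphere_weight_nonneg)
  finally show "(\<integral>(x::real^'n). h (norm x) \<partial>lborel) = (\<integral>r. sphere_weight CARD('n) r * h r \<partial>lborel)" .
qed

section \<open>Smooth functions built from $e^{-1/t}$\<close>

text \<open>The functions $p(1/t) e^{-1/t}$ for $t > 0$, extended by zero. Taking all polynomials $p$ at once
makes the family closed under differentiation, so that smoothness needs no induction on the order of
the derivative; $p = 1$ is the classical function used to build bump functions.\<close>

definition flat :: "real poly \<Rightarrow> real \<Rightarrow> real" where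
  "flat p t = (if t > 0 then poly p (1 / t) * exp (- (1 / t)) else 0)"

lemma poly_times_exp_tendsto_0: "((\<lambda>s::real. poly p s * exp (- s)) \<longlongrightarrow> 0) at_top"
proof -
  have "((\<lambda>s. \<Sum>i\<le>degree p. coeff p i * (s ^ i / exp s)) \<longlongrightarrow> (\<Sum>i\<le>degree p. coeff p i * 0)) at_top"
    by (intro tendsto_sum tendsto_mult tendsto_const tendsto_power_div_exp_0)
  moreover have "(\<Sum>i\<le>degree p. coeff p i * (s ^ i / exp s)) = poly p s * exp (- s)" for s :: real
    by (simp add: poly_altdef sum_distrib_left exp_minus divide_inverse mult_ac)
  ultimately show ?thesis by simp
qed

text \<open>For $t > 0$ this is the chain rule. At the origin the difference quotient is $s p(s) e^{-s}$ with
$s = 1/h$, which tends to zero.\<close>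

lemma flat_has_derivative:
  "(flat p has_real_derivative flat ([:0, 0, 1:] * (p - pderiv p)) t) (at t)"
proof -
  consider "t > 0" | "t = 0" | "t < 0" by linarith
  then show ?thesis
  proof cases
    case 1
    have "((\<lambda>t. poly p (1 / t) * exp (- (1 / t))) has_real_derivative
        flat ([:0, 0, 1:] * (p - pderiv p)) t) (at t)"
      using 1 by (auto intro!: derivative_eq_intros simp: flat_def field_simps power2_eq_square)
    then show ?thesis
      by (rule has_field_derivative_transform_within_open[where S="{0<..}"]) (auto simp: 1 flat_def)
  next
    case 2
    have "((\<lambda>h. flat p h / h) \<longlongrightarrow> 0) (at_right 0)"
    proof (rule Lim_transform_eventually)
      show "((\<lambda>h::real. poly (pCons 0 p) (inverse h) * exp (- (inverse h))) \<longlongrightarrow> 0) (at_right 0)"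
        by (rule filterlim_compose[OF poly_times_exp_tendsto_0 filterlim_inverse_at_top_right])
      show "\<forall>\<^sub>F h in at_right 0. poly (pCons 0 p) (inverse h) * exp (- (inverse h)) = flat p h / h"
        by (auto simp: eventually_at_filter flat_def field_simps)
    qed
    moreover have "((\<lambda>h. flat p h / h) \<longlongrightarrow> 0) (at_left 0)"
      by (rule Lim_transform_eventually[OF tendsto_const]) (auto simp: eventually_at_filter flat_def)
    ultimately have "((\<lambda>h. flat p h / h) \<longlongrightarrow> 0) (at 0)"
      by (simp add: filterlim_at_split)
    then show ?thesis
      by (simp add: 2 DERIV_def flat_def)
  next
    case 3
    have "((\<lambda>t. 0) has_real_derivative flat ([:0, 0, 1:] * (p - pderiv p)) t) (at t)"
      using 3 by (simp add: flat_def)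
    then show ?thesis
      by (rule has_field_derivative_transform_within_open[where S="{..<0}"]) (auto simp: 3 flat_def)
  qed
qed

text \<open>An algebra of functions that is closed under partial derivatives and contains all cut-off functions
needed below. Membership in it is a formal certificate of smoothness.\<close>

inductive elementary :: "(real^'n \<Rightarrow> real) \<Rightarrow> bool" where
  const: "elementary (\<lambda>x. c)"
| coord: "elementary (\<lambda>x. x $ i)"
| plus: "elementary f \<Longrightarrow> elementary g \<Longrightarrow> elementary (\<lambda>x. f x + g x)"
| times: "elementary f \<Longrightarrow> elementary g \<Longrightarrow> elementary (\<lambda>x. f x * g x)"
| flat: "elementary f \<Longrightarrow> elementary (\<lambda>x. flat p (f x))"

lemma elementary_has_derivative:
  fixes f :: "real^'n \<Rightarrow> real"
  assumes "elementary f"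
  shows "\<exists>D. (\<forall>x. (f has_derivative (\<lambda>h. \<Sum>j\<in>UNIV. D j x * h $ j)) (at x)) \<and> (\<forall>j. elementary (D j))"
  using assms
proof induction
  case (const c)
  show ?case by (rule exI[of _ "\<lambda>j x. 0"]) (auto intro: elementary.const)
next
  case (coord i)
  show ?case
  proof (rule exI[of _ "\<lambda>j x. if j = i then 1 else 0"], intro conjI allI)
    show "((\<lambda>x. x $ i) has_derivative (\<lambda>h. \<Sum>j\<in>UNIV. (if j = i then 1 else 0) * h $ j)) (at x)" for x :: "real^'n"
      by (simp add: if_distrib[of "\<lambda>z. z * _"] cong: if_cong) 
        (rule bounded_linear.has_derivative[OF bounded_linear_vec_nth has_derivative_ident])
    show "elementary (\<lambda>x::real^'n. if j = i then 1 else 0)" for j by (rule elementary.const)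
  qed
next
  case (plus f g)
  then obtain D E where D: "\<And>x. (f has_derivative (\<lambda>h. \<Sum>j\<in>UNIV. D j x * h $ j)) (at x)" "\<And>j. elementary (D j)"
    and E: "\<And>x. (g has_derivative (\<lambda>h. \<Sum>j\<in>UNIV. E j x * h $ j)) (at x)" "\<And>j. elementary (E j)" by blast
  show ?case
  proof (rule exI[of _ "\<lambda>j x. D j x + E j x"], intro conjI allI)
    show "((\<lambda>x. f x + g x) has_derivative (\<lambda>h. \<Sum>j\<in>UNIV. (D j x + E j x) * h $ j)) (at x)" for x
      using has_derivative_add[OF D(1) E(1), of x] by (simp add: algebra_simps sum.distrib)
  qed (intro elementary.intros D E)
next
  case (times f g)
  then obtain D E where D: "\<And>x. (f has_derivative (\<lambda>h. \<Sum>j\<in>UNIV. D j x * h $ j)) (at x)" "\<And>j. elementary (D j)"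
    and E: "\<And>x. (g has_derivative (\<lambda>h. \<Sum>j\<in>UNIV. E j x * h $ j)) (at x)" "\<And>j. elementary (E j)" by blast
  show ?case
  proof (rule exI[of _ "\<lambda>j x. f x * E j x + D j x * g x"], intro conjI allI)
    show "((\<lambda>x. f x * g x) has_derivative (\<lambda>h. \<Sum>j\<in>UNIV. (f x * E j x + D j x * g x) * h $ j)) (at x)" for x
      using has_derivative_mult[OF D(1) E(1), of x] 
      by (simp add: algebra_simps sum.distrib sum_distrib_left sum_distrib_right)
  qed (intro elementary.intros D E times.hyps)
next
  case (flat f p)
  then obtain D where D: "\<And>x. (f has_derivative (\<lambda>h. \<Sum>j\<in>UNIV. D j x * h $ j)) (at x)" "\<And>j. elementary (D j)" by blast
  show ?case
  proof (rule exI[of _ "\<lambda>j x. flat ([:0, 0, 1:] * (p - pderiv p)) (f x) * D j x"], intro conjI allI)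
    show "((\<lambda>x. flat p (f x)) has_derivative 
       (\<lambda>h. \<Sum>j\<in>UNIV. flat ([:0, 0, 1:] * (p - pderiv p)) (f x) * D j x * h $ j)) (at x)" for x
      using DERIV_compose_FDERIV[OF flat_has_derivative D(1), of p x]
      by (simp add: sum_distrib_left sum_distrib_right mult_ac)
  qed (intro elementary.intros D flat.hyps)
qed

lemma elementary_partial_deriv:
  fixes f :: "real^'n \<Rightarrow> real"
  assumes "elementary f"
  shows "elementary (partial_deriv j f)"
proof -
  obtain D where D: "\<And>x. (f has_derivative (\<lambda>h. \<Sum>j\<in>UNIV. D j x * h $ j)) (at x)" "\<And>j. elementary (D j)"
    using elementary_has_derivative[OF assms] by blast
  have "partial_deriv j f = D j"
  proof
    fix x
    have "frechet_derivative f (at x) = (\<lambda>h. \<Sum>j\<in>UNIV. D j x * h $ j)"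
      using D(1)[of x] by (metis frechet_derivative_at)
    then show "partial_deriv j f x = D j x"
      by (simp add: partial_deriv_def axis_def if_distrib[of "\<lambda>z. _ * z"] cong: if_cong)
  qed
  then show ?thesis using D(2) by simp
qed

text \<open>Closure under partial derivatives makes every iterated partial derivative elementary again, hence differentiable.\<close>

lemma elementary_smooth:
  assumes "elementary f" shows "smooth f"
proof -
  have "elementary (iter_partial js f)" for js
    by (induction js) (simp_all add: assms elementary_partial_deriv)
  then show ?thesis
    unfolding smooth_def differentiable_def using elementary_has_derivative by blast
qed

lemma elementary_sum: "finite S \<Longrightarrow> (\<And>i. i \<in> S \<Longrightarrow> elementary (f i)) \<Longrightarrow> elementary (\<lambda>x. \<Sum>i\<in>S. f i x)"
  by (induction S rule: finite_induct) (auto intro: elementary.const elementary.plus)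

lemma elementary_norm_sq: "elementary (\<lambda>x::real^'n. (norm (x - y))\<^sup>2)"
proof -
  have "elementary (\<lambda>x::real^'n. (x $ i + (- (y $ i))) * (x $ i + (- (y $ i))))" for i
    by (intro elementary.intros)
  then have "elementary (\<lambda>x::real^'n. \<Sum>i\<in>UNIV. (x $ i + (- (y $ i))) * (x $ i + (- (y $ i))))"
    by (intro elementary_sum) auto
  moreover have "(norm (x - y))\<^sup>2 = (\<Sum>i\<in>UNIV. (x $ i + (- (y $ i))) * (x $ i + (- (y $ i))))" for x
    by (simp add: power2_norm_eq_inner inner_vec_def)
  ultimately show ?thesis by simp
qed

definition grad :: "(real^'n \<Rightarrow> real) \<Rightarrow> real^'n \<Rightarrow> real^'n" where
  "grad f x = (\<chi> j. partial_deriv j f x)"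

text \<open>Smoothness is formulated through partial derivatives obtained from the Frechet derivative; expanding a vector in
the coordinate basis recovers the full derivative as the inner product with the gradient.\<close>

lemma smooth_has_derivative:
  fixes f :: "real^'n \<Rightarrow> real"
  assumes "smooth f"
  shows "(f has_derivative (\<lambda>h. grad f x \<bullet> h)) (at x)"
proof -
  have "f differentiable (at x)" using assms by (metis smooth_def iter_partial.simps(1))
  then have D: "(f has_derivative frechet_derivative f (at x)) (at x)" by (simp add: frechet_derivative_works)
  interpret linear "frechet_derivative f (at x)" using D by (rule has_derivative_linear)
  have "frechet_derivative f (at x) h = grad f x \<bullet> h" for h
  proof -
    have "h = (\<Sum>j\<in>UNIV. h $ j *\<^sub>R axis j 1)" by (simp add: basis_expansion scalar_mult_eq_scaleR[symmetric])
    moreover have "frechet_derivative f (at x) (\<Sum>j\<in>UNIV. h $ j *\<^sub>R axis j 1) =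
        (\<Sum>j\<in>UNIV. h $ j * frechet_derivative f (at x) (axis j 1))"
      by (simp add: sum scale)
    ultimately have "frechet_derivative f (at x) h = (\<Sum>j\<in>UNIV. h $ j * frechet_derivative f (at x) (axis j 1))"
      by simp
    then show ?thesis by (simp add: grad_def inner_vec_def partial_deriv_def mult.commute)
  qed
  then show ?thesis using D by (metis (no_types, lifting) ext)
qed

lemma smooth_continuous_grad:
  fixes f :: "real^'n \<Rightarrow> real"
  assumes "smooth f"
  shows "continuous_on UNIV (grad f)"
proof -
  have "iter_partial [j] f differentiable (at x)" for j x using assms unfolding smooth_def by blast
  then have "continuous_on UNIV (partial_deriv j f)" for j
    by (simp add: continuous_on_eq_continuous_at differentiable_imp_continuous_within)
  then show ?thesis unfolding grad_def by (intro continuous_on_vec_lambda)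
qed

lemma gradI: "(f has_derivative (\<lambda>h. G \<bullet> h)) (at x) \<Longrightarrow> grad f x = G"
proof -
  assume "(f has_derivative (\<lambda>h. G \<bullet> h)) (at x)"
  then have "frechet_derivative f (at x) = (\<lambda>h. G \<bullet> h)" by (metis frechet_derivative_at)
  then show ?thesis by (simp add: grad_def partial_deriv_def vec_eq_iff inner_axis)
qed

section \<open>Calculus of $C^1$ functions\<close>

text \<open>The regularity that integration by parts requires. It is kept apart from smoothness because products with
primitives of merely continuous functions occur below.\<close>

definition C1 :: "(real^'n \<Rightarrow> real) \<Rightarrow> bool" where
  "C1 f \<longleftrightarrow> (\<forall>x. (f has_derivative (\<lambda>h. grad f x \<bullet> h)) (at x)) \<and> continuous_on UNIV (grad f)"

definition vanishes_outside :: "(real^'n) set \<Rightarrow> (real^'n \<Rightarrow> 'b::zero) \<Rightarrow> bool" where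
  "vanishes_outside K f \<longleftrightarrow> (\<forall>x. x \<notin> K \<longrightarrow> f x = 0)"

lemma C1_continuous: "C1 f \<Longrightarrow> continuous_on UNIV f"
  unfolding C1_def by (meson continuous_at_imp_continuous_on has_derivative_continuous)

lemma C1_grad_continuous: "C1 f \<Longrightarrow> continuous_on UNIV (\<lambda>x. grad f x $ j)"
  unfolding C1_def by (intro continuous_on_component) auto

lemma smooth_C1: "smooth f \<Longrightarrow> C1 f"
  by (simp add: C1_def smooth_has_derivative smooth_continuous_grad)

lemma C1I:
  assumes "\<And>x. (f has_derivative (\<lambda>h. G x \<bullet> h)) (at x)" "continuous_on UNIV G"
  shows "C1 f" "grad f = G"
proof -
  show "grad f = G" using gradI[OF assms(1)] by auto
  then show "C1 f" using assms by (simp add: C1_def)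
qed

lemma C1_mult:
  assumes f: "C1 f" and g: "C1 g"
  shows "C1 (\<lambda>x. f x * g x)" "grad (\<lambda>x. f x * g x) = (\<lambda>x. f x *\<^sub>R grad g x + g x *\<^sub>R grad f x)"
proof -
  have D: "((\<lambda>x. f x * g x) has_derivative (\<lambda>h. (f x *\<^sub>R grad g x + g x *\<^sub>R grad f x) \<bullet> h)) (at x)" for x
    using has_derivative_mult[of f "\<lambda>h. grad f x \<bullet> h" x UNIV g "\<lambda>h. grad g x \<bullet> h"] f g
    by (simp add: C1_def inner_add_left mult_ac)
  have "continuous_on UNIV (\<lambda>x. f x *\<^sub>R grad g x + g x *\<^sub>R grad f x)"
    using f g C1_continuous[OF f] C1_continuous[OF g] by (auto simp: C1_def intro!: continuous_intros)
  from C1I[OF D this] show "C1 (\<lambda>x. f x * g x)" "grad (\<lambda>x. f x * g x) = (\<lambda>x. f x *\<^sub>R grad g x + g x *\<^sub>R grad f x)"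
    by auto
qed

lemma C1_compose_affine:
  assumes f: "C1 f"
  shows "C1 (\<lambda>x. f (a + c *\<^sub>R x))" "grad (\<lambda>x. f (a + c *\<^sub>R x)) = (\<lambda>x. c *\<^sub>R grad f (a + c *\<^sub>R x))"
proof -
  have D: "((\<lambda>x. f (a + c *\<^sub>R x)) has_derivative (\<lambda>h. (c *\<^sub>R grad f (a + c *\<^sub>R x)) \<bullet> h)) (at x)" for x
  proof -
    have "((\<lambda>x. a + c *\<^sub>R x) has_derivative (\<lambda>h. c *\<^sub>R h)) (at x)"
      by (auto intro!: derivative_eq_intros)
    from has_derivative_compose[OF this, of f "\<lambda>h. grad f (a + c *\<^sub>R x) \<bullet> h"] show ?thesis
      using f by (simp add: C1_def)
  qed
  have "continuous_on UNIV (\<lambda>x. c *\<^sub>R grad f (a + c *\<^sub>R x))"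
  proof -
    have "continuous_on UNIV (grad f)" using f by (simp add: C1_def)
    moreover have "continuous_on UNIV (\<lambda>x. a + c *\<^sub>R x)" by (intro continuous_intros)
    ultimately have "continuous_on UNIV (\<lambda>x. grad f (a + c *\<^sub>R x))"
      by (rule continuous_on_compose2) auto
    then show ?thesis by (intro continuous_intros)
  qed
  from C1I[OF D this] show "C1 (\<lambda>x. f (a + c *\<^sub>R x))" "grad (\<lambda>x. f (a + c *\<^sub>R x)) = (\<lambda>x. c *\<^sub>R grad f (a + c *\<^sub>R x))"
    by auto
qed

text \<open>The complement of $K$ is open and the function is locally zero on it.\<close>

lemma grad_vanishes_outside:
  assumes "C1 f" "closed K" "vanishes_outside K f"
  shows "vanishes_outside K (grad f)"
  unfolding vanishes_outside_def
proof (intro allI impI)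
  fix x assume x: "x \<notin> K"
  have "((\<lambda>x. 0) has_derivative (\<lambda>h. 0 \<bullet> h)) (at x)" by simp
  then have "(f has_derivative (\<lambda>h. 0 \<bullet> h)) (at x)"
    by (rule has_derivative_transform_within_open[where s="-K"]) 
      (use assms x in \<open>auto simp: vanishes_outside_def open_Compl\<close>)
  then show "grad f x = 0" by (rule gradI)
qed

lemma cont_supported_integrable:
  fixes f :: "real^'n \<Rightarrow> real"
  assumes "continuous_on UNIV f" "compact K" "vanishes_outside K f"
  shows "integrable lborel f"
proof -
  have "integrable lborel (\<lambda>x. indicator K x *\<^sub>R f x)"
    by (rule borel_integrable_compact[OF assms(2) continuous_on_subset[OF assms(1)]]) simp
  also have "(\<lambda>x. indicator K x *\<^sub>R f x) = f"
    using assms(3) by (auto simp: vanishes_outside_def fun_eq_iff split: split_indicator)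
  finally show ?thesis .
qed

lemma cont_supported_bounded:
  fixes f :: "real^'n \<Rightarrow> real"
  assumes "continuous_on UNIV f" "compact K" "vanishes_outside K f"
  obtains M where "M > 0" "\<And>x. \<bar>f x\<bar> \<le> M"
proof -
  have "bounded (f ` K)" using assms continuous_on_subset
    by (meson compact_continuous_image compact_imp_bounded subset_UNIV)
  then obtain M where "M > 0" "\<And>x. x \<in> K \<Longrightarrow> \<bar>f x\<bar> \<le> M" by (auto simp: bounded_pos)
  then have "\<bar>f x\<bar> \<le> M" for x using assms(3) by (cases "x \<in> K") (auto simp: vanishes_outside_def)
  with \<open>M > 0\<close> show thesis using that by blast
qed

text \<open>By translation invariance the integral of the difference quotient $(f(x + t e_j) - f(x))/t$ is zero. The quotients
converge to the partial derivative and, by the mean value theorem, are bounded on a fixed ball outside of which they vanish.\<close>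

lemma integral_grad_eq_0:
  fixes f :: "real^'n \<Rightarrow> real"
  assumes f: "C1 f" and K: "compact K" and v: "vanishes_outside K f"
  shows "(\<integral>x. grad f x $ j \<partial>lborel) = 0"
proof -
  define e :: "real^'n" where "e = axis j 1"
  define t where "t n = 1 / real (Suc n)" for n
  have t: "t n > 0" "t n \<le> 1" for n by (auto simp: t_def)
  have ne: "norm e = 1" by (simp add: e_def norm_axis_1)
  have cont: "continuous_on UNIV f" using f by (rule C1_continuous)
  have [measurable]: "f \<in> borel_measurable borel" using cont by (rule borel_measurable_continuous_onI)
  have int: "integrable lborel f" by (rule cont_supported_integrable[OF cont K v])
  have gc: "continuous_on UNIV (\<lambda>x. grad f x $ j)" using f by (rule C1_grad_continuous)
  have [measurable]: "(\<lambda>x. grad f x $ j) \<in> borel_measurable borel" using gc by (rule borel_measurable_continuous_onI)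
  have gv: "vanishes_outside K (\<lambda>x. grad f x $ j)"
    using grad_vanishes_outside[OF f compact_imp_closed[OF K] v] by (simp add: vanishes_outside_def)
  obtain M where M: "M > 0" "\<And>x. \<bar>grad f x $ j\<bar> \<le> M" using cont_supported_bounded[OF gc K gv] by blast
  obtain r where r: "\<And>x. x \<in> K \<Longrightarrow> norm x \<le> r" using compact_imp_bounded[OF K] by (auto simp: bounded_iff)
  have der: "((\<lambda>s. f (x + s *\<^sub>R e)) has_real_derivative grad f (x + s *\<^sub>R e) $ j) (at s)" for x s
  proof -
    have "((\<lambda>s. x + s *\<^sub>R e) has_derivative (\<lambda>h. h *\<^sub>R e)) (at s)" by (auto intro!: derivative_eq_intros)
    from has_derivative_compose[OF this, of f "\<lambda>h. grad f (x + s *\<^sub>R e) \<bullet> h"] 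
    have "((\<lambda>s. f (x + s *\<^sub>R e)) has_derivative (\<lambda>h. grad f (x + s *\<^sub>R e) \<bullet> (h *\<^sub>R e))) (at s)"
      using f by (simp add: C1_def)
    moreover have "(\<lambda>h. grad f (x + s *\<^sub>R e) \<bullet> (h *\<^sub>R e)) = (*) (grad f (x + s *\<^sub>R e) $ j)"
      by (simp add: fun_eq_iff e_def inner_axis)
    ultimately show ?thesis by (simp only: has_field_derivative_def)
  qed
  have bd: "\<bar>f (x + t n *\<^sub>R e) - f x\<bar> \<le> t n * M" for x n
  proof -
    obtain z where "f (x + t n *\<^sub>R e) - f (x + 0 *\<^sub>R e) = (t n - 0) * (grad f (x + z *\<^sub>R e) $ j)"
      using MVT2[OF t(1)[of n] der] by blast
    then show ?thesis using M(2)[of "x + z *\<^sub>R e"] t(1)[of n] by (auto simp: abs_mult intro!: mult_left_mono)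
  qed
  have "(\<lambda>n. \<integral>x. (f (x + t n *\<^sub>R e) - f x) / t n \<partial>lborel) \<longlonglongrightarrow> (\<integral>x. grad f x $ j \<partial>lborel)"
  proof (rule integral_dominated_convergence[where w="\<lambda>x. M * indicator (cball 0 (r + 1)) x"])
    show "integrable lborel (\<lambda>x::real^'n. M * indicator (cball 0 (r + 1)) x)"
      by (cases "r + 1 \<ge> 0") (auto intro!: integrable_real_indicator simp: emeasure_cball cball_empty)
    show "AE x in lborel. (\<lambda>n. (f (x + t n *\<^sub>R e) - f x) / t n) \<longlonglongrightarrow> grad f x $ j"
    proof (rule AE_I2)
      fix x
      have "((\<lambda>h. (f (x + h *\<^sub>R e) - f x) / h) \<longlongrightarrow> grad f x $ j) (at 0)"
        using der[of x 0] by (simp add: DERIV_def)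
      moreover have "filterlim t (at 0) sequentially"
        unfolding filterlim_at
      proof
        show "t \<longlonglongrightarrow> 0" unfolding t_def by (rule LIMSEQ_Suc[OF lim_1_over_n])
        show "\<forall>\<^sub>F n in sequentially. t n \<in> UNIV \<and> t n \<noteq> 0" by (simp add: t_def)
      qed
      ultimately show "(\<lambda>n. (f (x + t n *\<^sub>R e) - f x) / t n) \<longlonglongrightarrow> grad f x $ j"
        by (rule filterlim_compose)
    qed
    fix n
    show "AE x in lborel. norm ((f (x + t n *\<^sub>R e) - f x) / t n) \<le> M * indicator (cball 0 (r + 1)) x"
    proof (rule AE_I2)
      fix x :: "real^'n"
      show "norm ((f (x + t n *\<^sub>R e) - f x) / t n) \<le> M * indicator (cball 0 (r + 1)) x"
      proof (cases "norm x \<le> r + 1")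
        case True
        then show ?thesis using bd[of x n] t(1)[of n] by (simp add: field_simps)
      next
        case False
        have "norm (x + t n *\<^sub>R e) \<ge> norm x - norm (t n *\<^sub>R e)" by (rule norm_diff_ineq)
        then have "norm (x + t n *\<^sub>R e) > r" using t[of n] False ne by simp
        then have "x + t n *\<^sub>R e \<notin> K" "x \<notin> K" using r False by force+
        then show ?thesis using v M by (simp add: vanishes_outside_def)
      qed
    qed
  qed (auto)
  moreover have "(\<integral>x. (f (x + t n *\<^sub>R e) - f x) / t n \<partial>lborel) = 0" for n
    using integral_shift[of f "t n *\<^sub>R e"] integrable_shift[OF int, of "t n *\<^sub>R e"] int
    by (simp add: add.commute Bochner_Integration.integral_diff)
  ultimately have "(\<lambda>n. 0) \<longlonglongrightarrow> (\<integral>x. grad f x $ j \<partial>lborel)" by (simp only:)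
  then show ?thesis by (simp add: LIMSEQ_const_iff)
qed

lemma integration_by_parts:
  fixes f g :: "real^'n \<Rightarrow> real"
  assumes f: "C1 f" and g: "C1 g" and K: "compact K" and v: "vanishes_outside K g"
  shows "(\<integral>x. f x * grad g x $ j \<partial>lborel) = - (\<integral>x. grad f x $ j * g x \<partial>lborel)"
proof -
  have gv: "vanishes_outside K (grad g)" using grad_vanishes_outside[OF g compact_imp_closed[OF K] v] .
  note cont = C1_continuous[OF f] C1_continuous[OF g] C1_grad_continuous[OF f, of j] C1_grad_continuous[OF g, of j]
  have i1: "integrable lborel (\<lambda>x. f x * grad g x $ j)"
    by (rule cont_supported_integrable[OF continuous_on_mult[OF cont(1,4)] K]) (use gv in \<open>simp add: vanishes_outside_def\<close>)
  have i2: "integrable lborel (\<lambda>x. grad f x $ j * g x)"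
    by (rule cont_supported_integrable[OF continuous_on_mult[OF cont(3,2)] K]) (use v in \<open>simp add: vanishes_outside_def\<close>)
  have "(\<integral>x. grad (\<lambda>x. f x * g x) x $ j \<partial>lborel) = 0"
    by (rule integral_grad_eq_0[OF C1_mult(1)[OF f g] K]) (use v in \<open>auto simp: vanishes_outside_def\<close>)
  then have "(\<integral>x. f x * grad g x $ j + grad f x $ j * g x \<partial>lborel) = 0"
    by (simp add: C1_mult(2)[OF f g] mult.commute)
  then show ?thesis using i1 i2 by (simp add: Bochner_Integration.integral_add)
qed

text \<open>Radial functions are written through $|x|^2$ and not through $|x|$, which keeps them differentiable at the origin.\<close>

lemma C1_radial:
  assumes h: "\<And>t. (h has_real_derivative h' t) (at t)" and c: "continuous_on UNIV h'"
  shows "C1 (\<lambda>x::real^'n. h ((norm x)\<^sup>2))" "grad (\<lambda>x::real^'n. h ((norm x)\<^sup>2)) = (\<lambda>x. (2 * h' ((norm x)\<^sup>2)) *\<^sub>R x)"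
proof -
  have D: "((\<lambda>x::real^'n. h ((norm x)\<^sup>2)) has_derivative (\<lambda>v. ((2 * h' ((norm x)\<^sup>2)) *\<^sub>R x) \<bullet> v)) (at x)" for x
  proof -
    have "((\<lambda>x::real^'n. x \<bullet> x) has_derivative (\<lambda>v. x \<bullet> v + v \<bullet> x)) (at x)"
      by (intro has_derivative_inner has_derivative_ident)
    then have "((\<lambda>x::real^'n. (norm x)\<^sup>2) has_derivative (\<lambda>v. 2 * (x \<bullet> v))) (at x)"
      by (simp add: power2_norm_eq_inner inner_commute)
    from DERIV_compose_FDERIV[OF h this] show ?thesis by (simp add: mult_ac)
  qed
  have "continuous_on UNIV (\<lambda>x::real^'n. (2 * h' ((norm x)\<^sup>2)) *\<^sub>R x)"
    by (intro continuous_on_scaleR continuous_on_mult continuous_on_const continuous_on_id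
        continuous_on_compose2[OF c] continuous_on_power continuous_on_norm) auto
  from C1I[OF D this] show "C1 (\<lambda>x::real^'n. h ((norm x)\<^sup>2))" 
    "grad (\<lambda>x::real^'n. h ((norm x)\<^sup>2)) = (\<lambda>x. (2 * h' ((norm x)\<^sup>2)) *\<^sub>R x)" by auto
qed

lemma C1_coord: "C1 (\<lambda>x::real^'n. x $ a)" "grad (\<lambda>x::real^'n. x $ a) = (\<lambda>x. axis a 1)"
proof -
  have "((\<lambda>x::real^'n. x $ a) has_derivative (\<lambda>h. axis a 1 \<bullet> h)) (at x)" for x
  proof -
    have "((\<lambda>x::real^'n. x $ a) has_derivative (\<lambda>h. h $ a)) (at x)"
      by (rule bounded_linear.has_derivative[OF bounded_linear_vec_nth has_derivative_ident])
    then show ?thesis by (simp add: inner_axis')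
  qed
  from C1I[OF this] show "C1 (\<lambda>x::real^'n. x $ a)" "grad (\<lambda>x::real^'n. x $ a) = (\<lambda>x. axis a 1)" by auto
qed

lemma flat_continuous: "continuous_on UNIV (flat p)"
  using flat_has_derivative by (meson DERIV_isCont continuous_at_imp_continuous_on)

lemma integrable_cont_times_local:
  fixes w f :: "real^'n \<Rightarrow> real"
  assumes w: "continuous_on UNIV w" and K: "compact K" and v: "vanishes_outside K w"
    and f: "integrable lborel (\<lambda>x. indicator K x * f x)" and fm[measurable]: "f \<in> borel_measurable borel"
  shows "integrable lborel (\<lambda>x. w x * f x)"
proof -
  obtain M where M: "M > 0" "\<And>x. \<bar>w x\<bar> \<le> M" using cont_supported_bounded[OF w K v] by blast
  have [measurable]: "w \<in> borel_measurable borel" using w by (rule borel_measurable_continuous_onI)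
  show ?thesis
  proof (rule Bochner_Integration.integrable_bound)
    show "integrable lborel (\<lambda>x. M * (indicator K x * f x))" using f by simp
    show "AE x in lborel. norm (w x * f x) \<le> norm (M * (indicator K x * f x))"
      using M v by (intro AE_I2) (auto simp: abs_mult vanishes_outside_def intro!: mult_right_mono split: split_indicator)
  qed measurable
qed

lemma partial_deriv_grad: "partial_deriv j \<psi> = (\<lambda>x. grad \<psi> x $ j)"
  by (simp add: grad_def)

lemma test_function_C1:
  assumes "\<psi> \<in> test_functions \<Omega>"
  obtains K where "compact K" "K \<subseteq> \<Omega>" "vanishes_outside K \<psi>" "C1 \<psi>"
proof
  show "compact (closure {x. \<psi> x \<noteq> 0})" "closure {x. \<psi> x \<noteq> 0} \<subseteq> \<Omega>" "C1 \<psi>"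
    using assms smooth_C1 by (auto simp: test_functions_def)
  show "vanishes_outside (closure {x. \<psi> x \<noteq> 0}) \<psi>"
    unfolding vanishes_outside_def
  proof (intro allI impI)
    fix x assume "x \<notin> closure {x. \<psi> x \<noteq> 0}"
    then have "x \<notin> {x. \<psi> x \<noteq> 0}" using closure_subset[THEN subsetD] by metis
    then show "\<psi> x = 0" by simp
  qed
qed

section \<open>Mollification\<close>

definition conv :: "(real^'n \<Rightarrow> real) \<Rightarrow> (real^'n \<Rightarrow> real) \<Rightarrow> real^'n \<Rightarrow> real" where
  "conv \<eta> f x = (\<integral>y. \<eta> (x - y) * f y \<partial>lborel)"

lemma measurable_conv_integrand:
  assumes [measurable]: "\<eta> \<in> borel_measurable borel" "f \<in> borel_measurable borel"
  shows "(\<lambda>(x, y). \<eta> (x - y) * f y :: real) \<in> borel_measurable (lborel \<Otimes>\<^sub>M (lborel :: (real^'n) measure))"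
  by measurable

lemma measurable_conv [measurable]:
  assumes [measurable]: "\<eta> \<in> borel_measurable borel" "f \<in> borel_measurable borel"
  shows "conv \<eta> f \<in> borel_measurable borel"
proof -
  have "(\<lambda>x. \<integral>y. \<eta> (x - y) * f y \<partial>lborel) \<in> borel_measurable lborel"
    using measurable_conv_integrand[OF assms] by (rule lborel.borel_measurable_lebesgue_integral)
  then show ?thesis by (simp add: conv_def[abs_def])
qed

text \<open>Translation invariance gives the inner integral $|f(y)| \int |\eta|$, and Tonelli's theorem applies.\<close>

lemma integrable_conv_integrand:
  fixes \<eta> f :: "real^'n \<Rightarrow> real"
  assumes \<eta>: "integrable lborel \<eta>" and f: "integrable lborel f"
  shows "integrable (lborel \<Otimes>\<^sub>M lborel) (\<lambda>(x, y). \<eta> (x - y) * f y)"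
proof -
  have [measurable]: "\<eta> \<in> borel_measurable borel" "f \<in> borel_measurable borel" using assms by auto
  have sh: "integrable lborel (\<lambda>x. \<eta> (x - y))" for y using integrable_shift[OF \<eta>, of "-y"] by simp
  have sh': "(\<integral>x. \<bar>\<eta> (x - y)\<bar> \<partial>lborel) = (\<integral>x. \<bar>\<eta> x\<bar> \<partial>lborel)" for y 
    using integral_shift[of "\<lambda>x. \<bar>\<eta> x\<bar>" "-y"] by simp
  have "integrable (lborel \<Otimes>\<^sub>M lborel) (\<lambda>(y, x). \<eta> (x - y) * f y)"
  proof (rule lborel_pair.Fubini_integrable)
    have "(\<lambda>y. \<integral>x. norm (case (y, x) of (y, x) \<Rightarrow> \<eta> (x - y) * f y) \<partial>lborel) = (\<lambda>y. (\<integral>x. \<bar>\<eta> x\<bar> \<partial>lborel) * \<bar>f y\<bar>)"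
      by (simp add: abs_mult sh')
    then show "integrable lborel (\<lambda>y. \<integral>x. norm (case (y, x) of (y, x) \<Rightarrow> \<eta> (x - y) * f y) \<partial>lborel)"
      using f by simp
    show "AE y in lborel. integrable lborel (\<lambda>x. case (y, x) of (y, x) \<Rightarrow> \<eta> (x - y) * f y)"
      using sh by (intro AE_I2) simp
  qed measurable
  from lborel_pair.integrable_product_swap[OF this] show ?thesis by (simp add: split_beta')
qed

lemma integrable_conv:
  assumes \<eta>: "integrable lborel \<eta>" and f: "integrable lborel f"
  shows "integrable lborel (conv \<eta> f)"
  using lborel_pair.integrable_fst'[OF integrable_conv_integrand[OF assms]] by (simp add: conv_def[abs_def])

text \<open>Young's inequality for $L^1$: exchange the integrals and use translation invariance.\<close>

lemma conv_L1_bound: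
  assumes \<eta>: "integrable lborel \<eta>" and f: "integrable lborel f"
  shows "(\<integral>x. \<bar>conv \<eta> f x\<bar> \<partial>lborel) \<le> (\<integral>x. \<bar>\<eta> x\<bar> \<partial>lborel) * (\<integral>x. \<bar>f x\<bar> \<partial>lborel)"
proof -
  have [measurable]: "\<eta> \<in> borel_measurable borel" "f \<in> borel_measurable borel" using assms by auto
  have sh': "(\<integral>x. \<bar>\<eta> (x - y)\<bar> \<partial>lborel) = (\<integral>x. \<bar>\<eta> x\<bar> \<partial>lborel)" for y 
    using integral_shift[of "\<lambda>x. \<bar>\<eta> x\<bar>" "-y"] by simp
  have i: "integrable (lborel \<Otimes>\<^sub>M lborel) (\<lambda>(x, y). \<bar>\<eta> (x - y)\<bar> * \<bar>f y\<bar>)"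
    using integrable_conv_integrand[of "\<lambda>x. \<bar>\<eta> x\<bar>" "\<lambda>x. \<bar>f x\<bar>"] assms by simp
  have "(\<integral>x. \<bar>conv \<eta> f x\<bar> \<partial>lborel) \<le> (\<integral>x. (\<integral>y. \<bar>\<eta> (x - y)\<bar> * \<bar>f y\<bar> \<partial>lborel) \<partial>lborel)"
  proof (rule integral_mono)
    show "integrable lborel (\<lambda>x. \<bar>conv \<eta> f x\<bar>)" using integrable_conv[OF assms] by simp
    show "integrable lborel (\<lambda>x. \<integral>y. \<bar>\<eta> (x - y)\<bar> * \<bar>f y\<bar> \<partial>lborel)"
      using lborel_pair.integrable_fst'[OF i] by simp
    show "\<bar>conv \<eta> f x\<bar> \<le> (\<integral>y. \<bar>\<eta> (x - y)\<bar> * \<bar>f y\<bar> \<partial>lborel)" for x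
      unfolding conv_def using integral_abs_bound[of lborel "\<lambda>y. \<eta> (x - y) * f y"] by (simp add: abs_mult)
  qed
  also have "\<dots> = (\<integral>y. (\<integral>x. \<bar>\<eta> (x - y)\<bar> * \<bar>f y\<bar> \<partial>lborel) \<partial>lborel)"
    by (rule lborel_pair.Fubini_integral[OF i, symmetric])
  also have "\<dots> = (\<integral>x. \<bar>\<eta> x\<bar> \<partial>lborel) * (\<integral>x. \<bar>f x\<bar> \<partial>lborel)"
    by (simp add: sh')
  finally show ?thesis .
qed

definition bump :: "real \<Rightarrow> real^'n \<Rightarrow> real" where
  "bump \<epsilon> x = flat 1 (\<epsilon>\<^sup>2 - (norm x)\<^sup>2)"

definition mollifier :: "real \<Rightarrow> real^'n \<Rightarrow> real" where
  "mollifier \<epsilon> x = bump \<epsilon> x / (\<integral>y. bump \<epsilon> y \<partial>(lborel :: (real^'n) measure))"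

lemma bump_nonneg: "bump \<epsilon> x \<ge> 0" by (simp add: bump_def flat_def)

lemma bump_pos_iff: "\<epsilon> > 0 \<Longrightarrow> bump \<epsilon> x > 0 \<longleftrightarrow> norm x < \<epsilon>"
  using power_less_imp_less_base[of "norm x" 2 \<epsilon>] power_strict_mono[of "norm x" \<epsilon> 2]
  by (auto simp: bump_def flat_def)

lemma elementary_bump: "elementary (bump \<epsilon> :: real^'n \<Rightarrow> real)"
proof -
  have "elementary (\<lambda>x::real^'n. flat 1 (\<epsilon>\<^sup>2 + (-1) * (norm (x - 0))\<^sup>2))"
    by (intro elementary.flat elementary.plus elementary.times elementary.const elementary_norm_sq)
  then show ?thesis by (simp add: bump_def[abs_def])
qed

lemma vanishes_bump: "\<epsilon> > 0 \<Longrightarrow> vanishes_outside (ball 0 \<epsilon>) (bump \<epsilon>)"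
  using bump_pos_iff[of \<epsilon>] bump_nonneg[of \<epsilon>] by (auto simp: vanishes_outside_def order_le_less)

lemma bump_integral:
  assumes "\<epsilon> > 0"
  shows "integrable lborel (bump \<epsilon> :: real^'n \<Rightarrow> real)" "(\<integral>y. bump \<epsilon> y \<partial>(lborel :: (real^'n) measure)) > 0"
proof -
  have cont: "continuous_on UNIV (bump \<epsilon> :: real^'n \<Rightarrow> real)"
    by (intro C1_continuous smooth_C1 elementary_smooth elementary_bump)
  then have [measurable]: "(bump \<epsilon> :: real^'n \<Rightarrow> real) \<in> borel_measurable borel" by (rule borel_measurable_continuous_onI)
  show i: "integrable lborel (bump \<epsilon> :: real^'n \<Rightarrow> real)"
    by (rule cont_supported_integrable[OF cont compact_cball[of 0 \<epsilon>]]) 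
      (use vanishes_bump[OF assms, where 'a='n] in \<open>auto simp: vanishes_outside_def\<close>)
  have "(\<integral>y. bump \<epsilon> y \<partial>(lborel :: (real^'n) measure)) \<noteq> 0"
  proof
    assume "(\<integral>y. bump \<epsilon> y \<partial>(lborel :: (real^'n) measure)) = 0"
    then have "AE x in (lborel :: (real^'n) measure). bump \<epsilon> x = 0"
      using integral_nonneg_eq_0_iff_AE[OF i] bump_nonneg by auto
    then have "emeasure lborel {x::real^'n. bump \<epsilon> x \<noteq> 0} = 0"
      by (subst (asm) AE_iff_measurable[OF _ refl]) auto
    moreover have "{x::real^'n. bump \<epsilon> x \<noteq> 0} = ball 0 \<epsilon>"
      using bump_pos_iff[OF assms] bump_nonneg[of \<epsilon>] by (force simp: order_le_less)
    ultimately show False using assms by (simp add: emeasure_ball unit_ball_vol_pos[THEN less_imp_neq, THEN not_sym])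
  qed
  moreover have "(\<integral>y. bump \<epsilon> y \<partial>(lborel :: (real^'n) measure)) \<ge> 0" by (simp add: bump_nonneg)
  ultimately show "(\<integral>y. bump \<epsilon> y \<partial>(lborel :: (real^'n) measure)) > 0" by simp
qed

context
  fixes \<epsilon> :: real assumes \<epsilon>: "\<epsilon> > 0"
begin

lemma mollifier_nonneg: "mollifier \<epsilon> (x :: real^'n) \<ge> 0"
  using bump_integral(2)[OF \<epsilon>, where 'n='n] bump_nonneg[of \<epsilon> x] by (simp add: mollifier_def less_imp_le)

lemma mollifier_vanishes: "vanishes_outside (ball 0 \<epsilon>) (mollifier \<epsilon> :: real^'n \<Rightarrow> real)"
  using vanishes_bump[OF \<epsilon>, where 'a='n] by (simp add: mollifier_def vanishes_outside_def)

lemma mollifier_integrable: "integrable lborel (mollifier \<epsilon> :: real^'n \<Rightarrow> real)"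
  using bump_integral(1)[OF \<epsilon>, where 'n='n] by (simp add: mollifier_def[abs_def])

lemma mollifier_integral: "(\<integral>(x::real^'n). mollifier \<epsilon> x \<partial>lborel) = 1"
  using bump_integral(2)[OF \<epsilon>, where 'n='n] by (simp add: mollifier_def[abs_def])

lemma mollifier_norm: "norm x = norm (y :: real^'n) \<Longrightarrow> mollifier \<epsilon> (x :: real^'n) = mollifier \<epsilon> y"
  by (simp add: mollifier_def bump_def)

lemma mollifier_smooth: "smooth (\<lambda>y::real^'n. mollifier \<epsilon> (x - y))"
proof (rule elementary_smooth)
  define Z where "Z = (\<integral>y. bump \<epsilon> y \<partial>(lborel :: (real^'n) measure))"
  have "elementary (\<lambda>y::real^'n. (1 / Z) * flat 1 (\<epsilon>\<^sup>2 + (-1) * (norm (y - x))\<^sup>2))"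
    by (intro elementary.flat elementary.plus elementary.times elementary.const elementary_norm_sq)
  then show "elementary (\<lambda>y. mollifier \<epsilon> (x - y))"
    by (simp add: mollifier_def bump_def Z_def norm_minus_commute)
qed

lemma mollifier_C1: "C1 (mollifier \<epsilon> :: real^'n \<Rightarrow> real)"
proof -
  have "C1 (\<lambda>y :: real^'n. mollifier \<epsilon> (0 - y))" by (rule smooth_C1[OF mollifier_smooth])
  moreover have "(\<lambda>y :: real^'n. mollifier \<epsilon> (0 - y)) = mollifier \<epsilon>" by (rule ext, rule mollifier_norm) simp
  ultimately show ?thesis by simp
qed

text \<open>This is what allows a distribution to be evaluated on mollifiers centred at points of the domain.\<close>

lemma mollifier_test_function:
  fixes x :: "real^'n"
  assumes "cball x \<epsilon> \<subseteq> \<Omega>"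
  shows "(\<lambda>y. mollifier \<epsilon> (x - y)) \<in> test_functions \<Omega>"
proof -
  have "{y. mollifier \<epsilon> (x - y) \<noteq> 0} \<subseteq> cball x \<epsilon>"
    using mollifier_vanishes by (force simp: vanishes_outside_def dist_norm)
  then have "closure {y. mollifier \<epsilon> (x - y) \<noteq> 0} \<subseteq> cball x \<epsilon>" by (rule closure_minimal) simp
  moreover from this have "compact (closure {y. mollifier \<epsilon> (x - y) \<noteq> 0})"
    by (meson closed_closure compact_cball compact_Int_closed inf.absorb_iff2 compact_closure bounded_subset bounded_cball closure_subset subset_trans)
  ultimately show ?thesis using mollifier_smooth assms by (auto simp: test_functions_def)
qed

end

text \<open>A continuous function with compact support is uniformly continuous, and the mollifier is a
probability density concentrated near the origin.\<close>

lemma conv_mollifier_approx: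
  fixes g :: "real^'n \<Rightarrow> real"
  assumes cont: "continuous_on UNIV g" and K: "compact K" and v: "vanishes_outside K g" and e: "e > 0"
  shows "\<exists>\<delta>>0. \<forall>\<epsilon>. 0 < \<epsilon> \<longrightarrow> \<epsilon> < \<delta> \<longrightarrow> (\<forall>x. \<bar>conv (mollifier \<epsilon>) g x - g x\<bar> \<le> e)"
proof -
  obtain r where r: "r > 0" "\<And>x. x \<in> K \<Longrightarrow> norm x \<le> r" using compact_imp_bounded[OF K] by (auto simp: bounded_pos)
  have "uniformly_continuous_on (cball 0 (r + 2)) g"
    by (rule compact_uniformly_continuous) (use cont continuous_on_subset in blast, simp)
  then obtain \<delta>' where \<delta>': "\<delta>' > 0" "\<And>x y. x \<in> cball 0 (r + 2) \<Longrightarrow> y \<in> cball 0 (r + 2) \<Longrightarrow> dist y x < \<delta>' \<Longrightarrow> dist (g y) (g x) < e"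
    using e unfolding uniformly_continuous_on_def by metis
  define \<delta> where "\<delta> = min \<delta>' 1"
  \<comment> \<open>the constants $r + 1$ and $r + 2$ leave room for $\delta \le 1$: two points closer than $\delta$ lie either both in the larger ball or both off the support\<close>
  have uc: "\<bar>g y - g x\<bar> \<le> e" if "dist y x < \<delta>" for x y
  proof (cases "norm x \<le> r + 1")
    case True
    have "norm y \<le> norm x + dist y x" by (metis dist_norm norm_triangle_sub)
    then have "norm y \<le> r + 2" using True that by (simp add: \<delta>_def)
    then show ?thesis using \<delta>'(2)[of x y] True that by (simp add: \<delta>_def dist_real_def)
  next
    case False
    have "norm x \<le> norm y + dist y x" by (metis dist_commute dist_norm norm_triangle_sub)
    then have "norm y > r" using False that by (simp add: \<delta>_def)
    then have "x \<notin> K" "y \<notin> K" using r(2) False by force+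
    then show ?thesis using v e by (simp add: vanishes_outside_def)
  qed
  have [measurable]: "g \<in> borel_measurable borel" using cont by (rule borel_measurable_continuous_onI)
  have gi: "integrable lborel g" by (rule cont_supported_integrable[OF cont K v])
  obtain M where M: "M > 0" "\<And>x. \<bar>g x\<bar> \<le> M" using cont_supported_bounded[OF cont K v] by blast
  have "\<bar>conv (mollifier \<epsilon>) g x - g x\<bar> \<le> e" if \<epsilon>: "0 < \<epsilon>" "\<epsilon> < \<delta>" for \<epsilon> x
  proof -
    note i0 = mollifier_integrable[OF \<epsilon>(1), where 'n='n]
    have [measurable]: "(mollifier \<epsilon> :: real^'n \<Rightarrow> real) \<in> borel_measurable borel" using i0 by auto
    have i1: "integrable lborel (\<lambda>y. mollifier \<epsilon> (x - y))" by (rule integrable_reflect[OF i0])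
    have I1: "(\<integral>y. mollifier \<epsilon> (x - y) \<partial>lborel) = 1" by (simp add: integral_reflect mollifier_integral[OF \<epsilon>(1)])
    have i2: "integrable lborel (\<lambda>y. mollifier \<epsilon> (x - y) * g y)"
    proof (rule Bochner_Integration.integrable_bound)
      show "integrable lborel (\<lambda>y. M * mollifier \<epsilon> (x - y))" using i1 by simp
      show "AE y in lborel. norm (mollifier \<epsilon> (x - y) * g y) \<le> norm (M * mollifier \<epsilon> (x - y))"
        using M by (intro AE_I2) (auto simp: abs_mult intro!: mult_right_mono simp: mult.commute)
    qed measurable
    have "conv (mollifier \<epsilon>) g x - g x = (\<integral>y. mollifier \<epsilon> (x - y) * g y - mollifier \<epsilon> (x - y) * g x \<partial>lborel)"
      using i1 i2 by (simp add: Bochner_Integration.integral_diff I1 conv_def)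
    also have "\<bar>\<dots>\<bar> \<le> (\<integral>y. e * mollifier \<epsilon> (x - y) \<partial>lborel)"
    proof (rule order_trans[OF integral_abs_bound integral_mono])
      show "integrable lborel (\<lambda>y. \<bar>mollifier \<epsilon> (x - y) * g y - mollifier \<epsilon> (x - y) * g x\<bar>)" using i1 i2 by simp
      show "integrable lborel (\<lambda>y. e * mollifier \<epsilon> (x - y))" using i1 by simp
      fix y
      show "\<bar>mollifier \<epsilon> (x - y) * g y - mollifier \<epsilon> (x - y) * g x\<bar> \<le> e * mollifier \<epsilon> (x - y)"
      proof (cases "norm (x - y) < \<epsilon>")
        case True
        then have "\<bar>g y - g x\<bar> \<le> e" using uc[of y x] \<epsilon> by (simp add: dist_norm norm_minus_commute)
        then have "mollifier \<epsilon> (x - y) * \<bar>g y - g x\<bar> \<le> mollifier \<epsilon> (x - y) * e"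
          using mollifier_nonneg[OF \<epsilon>(1)] by (intro mult_left_mono) auto
        moreover have "mollifier \<epsilon> (x - y) * g y - mollifier \<epsilon> (x - y) * g x = mollifier \<epsilon> (x - y) * (g y - g x)"
          by (rule right_diff_distrib[symmetric])
        ultimately show ?thesis using mollifier_nonneg[OF \<epsilon>(1), of "x - y"]
          by (simp only: abs_mult abs_of_nonneg mult.commute)
      next
        case False
        then show ?thesis using mollifier_vanishes[OF \<epsilon>(1), where 'n='n] by (simp add: vanishes_outside_def)
      qed
    qed
    also have "\<dots> = e" by (simp add: I1)
    finally show ?thesis .
  qed
  moreover have "\<delta> > 0" using \<delta>'(1) by (simp add: \<delta>_def)
  ultimately show ?thesis by blast
qed

lemma conv_vanishes_outside:
  assumes \<eta>: "vanishes_outside (ball 0 \<epsilon>) \<eta>" and f: "vanishes_outside K f"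
  shows "vanishes_outside {x + y |x y. x \<in> K \<and> y \<in> cball 0 \<epsilon>} (conv \<eta> f)"
  unfolding vanishes_outside_def
proof (intro allI impI)
  fix x assume x: "x \<notin> {x + y |x y. x \<in> K \<and> y \<in> cball 0 \<epsilon>}"
  have "\<eta> (x - y) * f y = 0" for y
  proof (cases "y \<in> K")
    case True
    have "x - y \<notin> ball 0 \<epsilon>"
    proof
      assume "x - y \<in> ball 0 \<epsilon>"
      then have "\<exists>a b. x = a + b \<and> a \<in> K \<and> b \<in> cball 0 \<epsilon>"
        using True by (intro exI[of _ y] exI[of _ "x - y"]) auto
      then show False using x by blast
    qed
    then show ?thesis using \<eta> by (simp add: vanishes_outside_def)
  next
    case False then show ?thesis using f by (simp add: vanishes_outside_def)
  qed
  then have "(\<lambda>y. \<eta> (x - y) * f y) = (\<lambda>y. 0)" by (rule ext)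
  then show "conv \<eta> f x = 0" by (simp only: conv_def Bochner_Integration.integral_zero)
qed

text \<open>For continuous functions of compact support the convergence is uniform, with supports in a fixed ball. The general case follows
by density, since convolution with the mollifier does not increase the $L^1$ norm.\<close>

lemma conv_mollifier_L1:
  fixes f :: "real^'n \<Rightarrow> real"
  assumes f: "integrable lborel f"
  shows "(\<lambda>k. \<integral>x. \<bar>conv (mollifier (1 / real (Suc k))) f x - f x\<bar> \<partial>lborel) \<longlonglongrightarrow> 0"
proof (rule tendstoI)
  fix e :: real assume e: "e > 0"
  obtain g r where g: "continuous_on UNIV g" "\<forall>x. r < norm x \<longrightarrow> g x = 0" "integrable lborel g" 
    and fg: "(\<integral>x. \<bar>f x - g x\<bar> \<partial>lborel) < e/3"
    using integrable_approx_continuous[OF f, of "e/3"] e by auto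
  define K where "K = cball (0::real^'n) \<bar>r\<bar>"
  have v: "vanishes_outside K g" using g(2) by (auto simp: vanishes_outside_def K_def)
  have K: "compact K" by (simp add: K_def)
  define V where "V = measure lborel (cball (0::real^'n) (\<bar>r\<bar> + 1))"
  have V: "V \<ge> 0" by (simp add: V_def)
  obtain \<delta> where \<delta>: "\<delta> > 0" "\<And>\<epsilon> x. 0 < \<epsilon> \<Longrightarrow> \<epsilon> < \<delta> \<Longrightarrow> \<bar>conv (mollifier \<epsilon>) g x - g x\<bar> \<le> e / (3 * (V + 1))"
    using conv_mollifier_approx[OF g(1) K v, of "e / (3 * (V + 1))"] e V by auto
  have main: "(\<integral>x. \<bar>conv (mollifier \<epsilon>) f x - f x\<bar> \<partial>lborel) < e" if \<epsilon>: "0 < \<epsilon>" "\<epsilon> < \<delta>" "\<epsilon> \<le> 1" for \<epsilon>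
  proof -
    note m = mollifier_integrable[OF \<epsilon>(1), where 'n='n]
    note i = integrable_conv[OF m f] integrable_conv[OF m g(3)]
    have mm: "(\<integral>(x::real^'n). \<bar>mollifier \<epsilon> x\<bar> \<partial>lborel) = 1"
      using mollifier_integral[OF \<epsilon>(1), where 'n='n] mollifier_nonneg[OF \<epsilon>(1), where 'n='n] by simp
    have ae: "conv (mollifier \<epsilon>) f x - conv (mollifier \<epsilon>) g x = conv (mollifier \<epsilon>) (\<lambda>y. f y - g y) x"
      if "integrable lborel (\<lambda>y. mollifier \<epsilon> (x - y) * f y)" "integrable lborel (\<lambda>y. mollifier \<epsilon> (x - y) * g y)" for x
      using that by (simp add: conv_def right_diff_distrib Bochner_Integration.integral_diff)
    have "(\<integral>x. \<bar>conv (mollifier \<epsilon>) f x - conv (mollifier \<epsilon>) g x\<bar> \<partial>lborel) = (\<integral>x. \<bar>conv (mollifier \<epsilon>) (\<lambda>y. f y - g y) x\<bar> \<partial>lborel)"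
    proof (rule integral_cong_AE)
      have "AE x in lborel. integrable lborel (\<lambda>y. mollifier \<epsilon> (x - y) * f y)"
        using lborel_pair.AE_integrable_fst'[OF integrable_conv_integrand[OF m f]] by simp
      moreover have "AE x in lborel. integrable lborel (\<lambda>y. mollifier \<epsilon> (x - y) * g y)"
        using lborel_pair.AE_integrable_fst'[OF integrable_conv_integrand[OF m g(3)]] by simp
      ultimately show "AE x in lborel. \<bar>conv (mollifier \<epsilon>) f x - conv (mollifier \<epsilon>) g x\<bar> = \<bar>conv (mollifier \<epsilon>) (\<lambda>y. f y - g y) x\<bar>"
        by eventually_elim (simp add: ae)
    qed (use i integrable_conv[OF m Bochner_Integration.integrable_diff[OF f g(3)]] in auto)
    also have "\<dots> \<le> 1 * (\<integral>x. \<bar>f x - g x\<bar> \<partial>lborel)"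
      using conv_L1_bound[OF m Bochner_Integration.integrable_diff[OF f g(3)]] mm by simp
    also have "\<dots> < e/3" using fg by simp
    finally have 1: "(\<integral>x. \<bar>conv (mollifier \<epsilon>) f x - conv (mollifier \<epsilon>) g x\<bar> \<partial>lborel) < e/3" .
    have vc: "conv (mollifier \<epsilon>) g x - g x = 0" if "norm x > \<bar>r\<bar> + 1" for x
    proof -
      have "x \<notin> {x + y |x y. x \<in> K \<and> y \<in> cball 0 \<epsilon>}"
      proof
        assume "x \<in> {x + y |x y. x \<in> K \<and> y \<in> cball 0 \<epsilon>}"
        then obtain a b where "x = a + b" "norm a \<le> \<bar>r\<bar>" "norm b \<le> \<epsilon>" by (auto simp: K_def)
        then show False using that \<epsilon>(3) norm_triangle_ineq[of a b] by simp
      qed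
      then have "conv (mollifier \<epsilon>) g x = 0"
        using conv_vanishes_outside[OF mollifier_vanishes[OF \<epsilon>(1)] v] unfolding vanishes_outside_def by blast
      moreover have "g x = 0" using g(2) that by auto
      ultimately show ?thesis by simp
    qed
    have "(\<integral>x. \<bar>conv (mollifier \<epsilon>) g x - g x\<bar> \<partial>lborel) \<le> (\<integral>x. e / (3 * (V + 1)) * indicator (cball (0::real^'n) (\<bar>r\<bar> + 1)) x \<partial>lborel)"
    proof (rule integral_mono)
      show "integrable lborel (\<lambda>x. \<bar>conv (mollifier \<epsilon>) g x - g x\<bar>)" using i g(3) by auto
      show "integrable lborel (\<lambda>x. e / (3 * (V + 1)) * indicator (cball (0::real^'n) (\<bar>r\<bar> + 1)) x)"
        by (auto intro!: integrable_real_indicator simp: emeasure_cball)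
      show "\<bar>conv (mollifier \<epsilon>) g x - g x\<bar> \<le> e / (3 * (V + 1)) * indicator (cball (0::real^'n) (\<bar>r\<bar> + 1)) x" for x
        using \<delta>(2)[OF \<epsilon>(1,2), of x] vc[of x] by (auto split: split_indicator)
    qed
    also have "\<dots> = e / (3 * (V + 1)) * V" by (simp add: V_def)
    also have "\<dots> \<le> e / 3" using e V by (simp add: divide_simps mult_left_mono)
    finally have 2: "(\<integral>x. \<bar>conv (mollifier \<epsilon>) g x - g x\<bar> \<partial>lborel) \<le> e/3" .
    have "(\<integral>x. \<bar>conv (mollifier \<epsilon>) f x - f x\<bar> \<partial>lborel) \<le> 
        (\<integral>x. \<bar>conv (mollifier \<epsilon>) f x - conv (mollifier \<epsilon>) g x\<bar> + \<bar>conv (mollifier \<epsilon>) g x - g x\<bar> + \<bar>f x - g x\<bar> \<partial>lborel)"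
      using i f g(3) by (intro integral_mono) auto
    also have "\<dots> = (\<integral>x. \<bar>conv (mollifier \<epsilon>) f x - conv (mollifier \<epsilon>) g x\<bar> \<partial>lborel) + (\<integral>x. \<bar>conv (mollifier \<epsilon>) g x - g x\<bar> \<partial>lborel) + (\<integral>x. \<bar>f x - g x\<bar> \<partial>lborel)"
      using i f g(3) by (simp add: Bochner_Integration.integral_add)
    also have "\<dots> < e" using 1 2 fg by simp
    finally show ?thesis .
  qed
  have "eventually (\<lambda>k. 1 / real (Suc k) < \<delta>) sequentially"
    using order_tendstoD(2)[OF LIMSEQ_Suc[OF lim_1_over_n] \<delta>(1)] by simp
  then show "\<forall>\<^sub>F k in sequentially. dist (\<integral>x. \<bar>conv (mollifier (1 / real (Suc k))) f x - f x\<bar> \<partial>lborel) 0 < e"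
  proof eventually_elim
    case (elim k)
    then show ?case using main[of "1 / real (Suc k)"] by simp
  qed
qed

text \<open>The function $f$ is integrable on $K$ only; the hypothesis on $W$ says that the values of the convolution on $W$ see $f$ only inside $K$.
Dominated convergence then applies.\<close>

lemma conv_continuous_on:
  fixes f :: "real^'n \<Rightarrow> real"
  assumes cont: "continuous_on UNIV \<eta>" and v: "vanishes_outside (cball 0 \<epsilon>) \<eta>"
    and f: "integrable lborel (\<lambda>x. indicator K x * f x)" and fm[measurable]: "f \<in> borel_measurable borel"
    and W: "\<And>x. x \<in> W \<Longrightarrow> cball x \<epsilon> \<subseteq> K"
  shows "continuous_on W (conv \<eta> f)"
  unfolding continuous_on_sequentially
proof (intro allI ballI impI, elim conjE)
  fix u a assume a: "a \<in> W" and u: "\<forall>n. u n \<in> W" "u \<longlonglongrightarrow> a"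
  obtain M where M: "M > 0" "\<And>x. \<bar>\<eta> x\<bar> \<le> M" using cont_supported_bounded[OF cont compact_cball v] by blast
  have [measurable]: "\<eta> \<in> borel_measurable borel" using cont by (rule borel_measurable_continuous_onI)
  have "(\<lambda>n. \<integral>y. \<eta> (u n - y) * f y \<partial>lborel) \<longlonglongrightarrow> (\<integral>y. \<eta> (a - y) * f y \<partial>lborel)"
  proof (rule integral_dominated_convergence[where w="\<lambda>y. M * \<bar>indicator K y * f y\<bar>"])
    show "integrable lborel (\<lambda>y. M * \<bar>indicator K y * f y\<bar>)" using f by simp
    have "isCont \<eta> x" for x using cont by (simp add: continuous_on_eq_continuous_at)
    then have "(\<lambda>n. \<eta> (u n - y)) \<longlonglongrightarrow> \<eta> (a - y)" for y
      by (rule isCont_tendsto_compose) (intro tendsto_intros u)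
    then show "AE y in lborel. (\<lambda>n. \<eta> (u n - y) * f y) \<longlonglongrightarrow> \<eta> (a - y) * f y"
      by (intro AE_I2 tendsto_intros)
    show "AE y in lborel. norm (\<eta> (u n - y) * f y) \<le> M * \<bar>indicator K y * f y\<bar>" for n
    proof (rule AE_I2)
      fix y
      show "norm (\<eta> (u n - y) * f y) \<le> M * \<bar>indicator K y * f y\<bar>"
      proof (cases "y \<in> cball (u n) \<epsilon>")
        case True
        then have "y \<in> K" using W u(1) by blast
        then show ?thesis using M(2)[of "u n - y"] by (simp add: abs_mult mult_right_mono)
      next
        case False
        then have "\<eta> (u n - y) = 0" using v by (simp add: vanishes_outside_def dist_norm)
        then show ?thesis using M(1) by simp
      qed
    qed
  qed measurable
  then show "((conv \<eta> f) \<circ> u) \<longlonglongrightarrow> conv \<eta> f a" by (simp add: conv_def o_def)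
qed

text \<open>The closed $\epsilon$-neighbourhood of $K$: the set on which a convolution with the mollifier of radius $\epsilon$ may be nonzero when
one factor is supported in $K$.\<close>

definition thick :: "(real^'n) set \<Rightarrow> real \<Rightarrow> (real^'n) set" where
  "thick K \<epsilon> = {x + y |x y. x \<in> K \<and> y \<in> cball 0 \<epsilon>}"

lemma compact_thick: "compact K \<Longrightarrow> compact (thick K \<epsilon>)"
  unfolding thick_def by (rule compact_sums) auto

lemma thick_mem: "x \<in> K \<Longrightarrow> norm (x - y) \<le> \<epsilon> \<Longrightarrow> y \<in> thick K \<epsilon>"
  unfolding thick_def by (rule CollectI, rule exI[of _ x], rule exI[of _ "y - x"]) (auto simp: norm_minus_commute)

lemma thick_mono: "\<epsilon> \<le> \<delta> \<Longrightarrow> thick K \<epsilon> \<subseteq> thick K \<delta>"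
  by (force simp: thick_def)

text \<open>The points at which a distribution on $\Omega$ can be tested against the mollifier of radius $\epsilon$. Asking for a strictly larger
ball makes the set open.\<close>

definition shrink :: "(real^'n) set \<Rightarrow> real \<Rightarrow> (real^'n) set" where
  "shrink \<Omega> \<epsilon> = {x. \<exists>\<delta>>\<epsilon>. ball x \<delta> \<subseteq> \<Omega>}"

lemma open_shrink: "open (shrink \<Omega> \<epsilon>)"
  unfolding open_contains_ball
proof
  fix x assume "x \<in> shrink \<Omega> \<epsilon>"
  then obtain \<delta> where \<delta>: "\<delta> > \<epsilon>" "ball x \<delta> \<subseteq> \<Omega>" by (auto simp: shrink_def)
  have "ball x ((\<delta> - \<epsilon>) / 2) \<subseteq> shrink \<Omega> \<epsilon>"
  proof
    fix y assume y: "y \<in> ball x ((\<delta> - \<epsilon>) / 2)"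
    have "ball y ((\<delta> + \<epsilon>) / 2) \<subseteq> ball x \<delta>"
    proof
      fix z assume "z \<in> ball y ((\<delta> + \<epsilon>) / 2)"
      then show "z \<in> ball x \<delta>" using y dist_triangle[of x z y] by (simp add: field_simps)
    qed
    then show "y \<in> shrink \<Omega> \<epsilon>" using \<delta> by (auto simp: shrink_def intro!: exI[of _ "(\<delta> + \<epsilon>) / 2"])
  qed
  then show "\<exists>e>0. ball x e \<subseteq> shrink \<Omega> \<epsilon>" using \<delta>(1) by (intro exI[of _ "(\<delta> - \<epsilon>) / 2"]) auto
qed

lemma shrink_cball: "x \<in> shrink \<Omega> \<epsilon> \<Longrightarrow> cball x \<epsilon> \<subseteq> \<Omega>"
  by (force simp: shrink_def)

lemma shrink_thick: "K \<subseteq> shrink \<Omega> \<epsilon> \<Longrightarrow> thick K \<epsilon> \<subseteq> \<Omega>"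
proof
  fix z assume K: "K \<subseteq> shrink \<Omega> \<epsilon>" and "z \<in> thick K \<epsilon>"
  then obtain x y where "x \<in> K" "norm y \<le> \<epsilon>" "z = x + y" by (auto simp: thick_def)
  then have "z \<in> cball x \<epsilon>" by (simp add: dist_norm)
  then show "z \<in> \<Omega>" using shrink_cball K \<open>x \<in> K\<close> by blast
qed

lemma compact_subset_shrink:
  assumes "open \<Omega>" "compact K" "K \<subseteq> \<Omega>"
  obtains \<epsilon>0 where "\<epsilon>0 > 0" "\<And>\<epsilon>. \<epsilon> < \<epsilon>0 \<Longrightarrow> K \<subseteq> shrink \<Omega> \<epsilon>"
proof -
  obtain e where "e > 0" "(\<Union>x\<in>K. ball x e) \<subseteq> \<Omega>"
    using compact_subset_open_imp_ball_epsilon_subset[OF assms(2,1,3)] by blast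
  then show thesis using that[of e] by (force simp: shrink_def)
qed

text \<open>Fubini's theorem and one integration by parts move both the mollification and the derivative onto the test function;
the mollifier is even.\<close>

lemma integral_conv_grad_mollifier:
  fixes f \<psi> :: "real^'n \<Rightarrow> real"
  assumes \<epsilon>: "\<epsilon> > 0" and \<psi>: "C1 \<psi>" and K: "compact K" and v: "vanishes_outside K \<psi>"
    and f: "integrable lborel (\<lambda>x. indicator (thick K \<epsilon>) x * f x)" and fm[measurable]: "f \<in> borel_measurable borel"
  shows "(\<integral>x. \<psi> x * conv (\<lambda>z. grad (mollifier \<epsilon>) z $ j) f x \<partial>lborel) =
    - (\<integral>y. conv (mollifier \<epsilon>) (\<lambda>x. grad \<psi> x $ j) y * f y \<partial>lborel)"
proof -
  let ?m = "mollifier \<epsilon> :: real^'n \<Rightarrow> real" and ?I = "indicator (thick K \<epsilon>) :: real^'n \<Rightarrow> real"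
  note m = mollifier_C1[OF \<epsilon>, where 'n='n]
  have mv: "vanishes_outside (cball 0 \<epsilon>) ?m" using mollifier_vanishes[OF \<epsilon>, where 'n='n] by (auto simp: vanishes_outside_def)
  have gv: "vanishes_outside (cball 0 \<epsilon>) (\<lambda>z. grad ?m z $ j)"
    using grad_vanishes_outside[OF m closed_cball mv] by (simp add: vanishes_outside_def)
  have gc: "continuous_on UNIV (\<lambda>z. grad ?m z $ j)" by (rule C1_grad_continuous[OF m])
  have gi: "integrable lborel (\<lambda>z. grad ?m z $ j)" by (rule cont_supported_integrable[OF gc compact_cball gv])
  have [measurable]: "(\<lambda>z. grad ?m z $ j) \<in> borel_measurable borel" using gc by (rule borel_measurable_continuous_onI)
  have \<psi>c: "continuous_on UNIV \<psi>" by (rule C1_continuous[OF \<psi>])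
  have [measurable]: "\<psi> \<in> borel_measurable borel" using \<psi>c by (rule borel_measurable_continuous_onI)
  have [measurable]: "thick K \<epsilon> \<in> sets borel" by (rule borel_compact[OF compact_thick[OF K]])
  obtain M where M: "M > 0" "\<And>x. \<bar>\<psi> x\<bar> \<le> M" using cont_supported_bounded[OF \<psi>c K v] by blast
  have I: "integrable (lborel \<Otimes>\<^sub>M lborel) (\<lambda>(x, y). \<psi> x * (grad ?m (x - y) $ j * (?I y * f y)))"
  proof (rule Bochner_Integration.integrable_bound)
    show "integrable (lborel \<Otimes>\<^sub>M lborel) (\<lambda>z. M * (case z of (x, y) \<Rightarrow> grad ?m (x - y) $ j * (?I y * f y)))"
      using integrable_conv_integrand[OF gi f] by simp
    show "AE z in lborel \<Otimes>\<^sub>M lborel. norm (case z of (x, y) \<Rightarrow> \<psi> x * (grad ?m (x - y) $ j * (?I y * f y)))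
        \<le> norm (M * (case z of (x, y) \<Rightarrow> grad ?m (x - y) $ j * (?I y * f y)))"
      using M by (intro AE_I2) (auto simp: abs_mult intro!: mult_right_mono)
  qed measurable
  have loc: "\<psi> x * (grad ?m (x - y) $ j * f y) = \<psi> x * (grad ?m (x - y) $ j * (?I y * f y))" for x y
    using v gv thick_mem[of x K y \<epsilon>] by (cases "x \<in> K"; cases "norm (x - y) \<le> \<epsilon>") (auto simp: vanishes_outside_def)
  have inner: "(\<integral>x. \<psi> x * grad ?m (x - y) $ j \<partial>lborel) = - conv ?m (\<lambda>x. grad \<psi> x $ j) y" for y
  proof -
    have s: "C1 (\<lambda>x. ?m (- y + 1 *\<^sub>R x))" "grad (\<lambda>x. ?m (- y + 1 *\<^sub>R x)) = (\<lambda>x. 1 *\<^sub>R grad ?m (- y + 1 *\<^sub>R x))"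
      by (rule C1_compose_affine[OF m]; simp)+
    have a: "grad (\<lambda>x. ?m (- y + 1 *\<^sub>R x)) x $ j = grad ?m (x - y) $ j" for x by (subst s(2)) simp
    have b: "?m (- y + 1 *\<^sub>R x) = ?m (y - x)" for x by (rule mollifier_norm[OF \<epsilon>]) (simp add: norm_minus_commute)
    have "(\<integral>x. ?m (- y + 1 *\<^sub>R x) * grad \<psi> x $ j \<partial>lborel) = - (\<integral>x. grad (\<lambda>x. ?m (- y + 1 *\<^sub>R x)) x $ j * \<psi> x \<partial>lborel)"
      by (rule integration_by_parts[OF s(1) \<psi> K v])
    from this[unfolded a, unfolded b] show ?thesis unfolding conv_def by (simp only: mult.commute minus_minus)
  qed
  have "(\<integral>x. \<psi> x * conv (\<lambda>z. grad ?m z $ j) f x \<partial>lborel) = (\<integral>x. (\<integral>y. \<psi> x * (grad ?m (x - y) $ j * (?I y * f y)) \<partial>lborel) \<partial>lborel)"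
    unfolding conv_def loc[symmetric] by simp
  also have "\<dots> = (\<integral>y. (\<integral>x. \<psi> x * (grad ?m (x - y) $ j * (?I y * f y)) \<partial>lborel) \<partial>lborel)"
    by (rule lborel_pair.Fubini_integral[OF I, symmetric])
  also have "\<dots> = (\<integral>y. - conv ?m (\<lambda>x. grad \<psi> x $ j) y * (?I y * f y) \<partial>lborel)"
  proof (rule Bochner_Integration.integral_cong[OF refl])
    fix y
    have "(\<integral>x. \<psi> x * (grad ?m (x - y) $ j * (?I y * f y)) \<partial>lborel) = (\<integral>x. (\<psi> x * grad ?m (x - y) $ j) * (?I y * f y) \<partial>lborel)"
      by (simp add: mult.assoc)
    also have "\<dots> = (\<integral>x. \<psi> x * grad ?m (x - y) $ j \<partial>lborel) * (?I y * f y)" by (rule integral_mult_left_zero)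
    finally show "(\<integral>x. \<psi> x * (grad ?m (x - y) $ j * (?I y * f y)) \<partial>lborel) = - conv ?m (\<lambda>x. grad \<psi> x $ j) y * (?I y * f y)"
      by (simp only: inner)
  qed
  also have "\<dots> = (\<integral>y. - (conv ?m (\<lambda>x. grad \<psi> x $ j) y * f y) \<partial>lborel)"
  proof (rule Bochner_Integration.integral_cong[OF refl])
    have "vanishes_outside K (\<lambda>x. grad \<psi> x $ j)"
      using grad_vanishes_outside[OF \<psi> compact_imp_closed[OF K] v] by (simp add: vanishes_outside_def)
    from conv_vanishes_outside[OF mollifier_vanishes[OF \<epsilon>] this]
    have "vanishes_outside (thick K \<epsilon>) (conv ?m (\<lambda>x. grad \<psi> x $ j))" by (simp only: thick_def)
    then show "- conv ?m (\<lambda>x. grad \<psi> x $ j) y * (?I y * f y) = - (conv ?m (\<lambda>x. grad \<psi> x $ j) y * f y)" for y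
      by (auto simp: vanishes_outside_def split: split_indicator)
  qed
  finally show ?thesis by simp
qed

text \<open>The mollified test function converges uniformly, and all supports stay in a fixed compact set, on which $f$ is integrable.\<close>

lemma mollified_pairing_limit:
  fixes f w :: "real^'n \<Rightarrow> real"
  assumes w: "continuous_on UNIV w" and K: "compact K" and v: "vanishes_outside K w" and \<epsilon>1: "\<epsilon>1 > 0"
    and f: "integrable lborel (\<lambda>x. indicator (thick K \<epsilon>1) x * f x)" and fm[measurable]: "f \<in> borel_measurable borel" and e: "e > 0"
  shows "\<exists>\<delta>>0. \<forall>\<epsilon>. 0 < \<epsilon> \<longrightarrow> \<epsilon> < \<delta> \<longrightarrow> \<bar>(\<integral>y. conv (mollifier \<epsilon>) w y * f y \<partial>lborel) - (\<integral>y. w y * f y \<partial>lborel)\<bar> \<le> e"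
proof -
  let ?I = "indicator (thick K \<epsilon>1) :: real^'n \<Rightarrow> real"
  define Z where "Z = (\<integral>x. \<bar>?I x * f x\<bar> \<partial>lborel)"
  have Z: "Z \<ge> 0" by (simp add: Z_def)
  have [measurable]: "thick K \<epsilon>1 \<in> sets borel" by (rule borel_compact[OF compact_thick[OF K]])
  have wi: "integrable lborel w" by (rule cont_supported_integrable[OF w K v])
  have [measurable]: "w \<in> borel_measurable borel" using wi by auto
  obtain \<delta> where \<delta>: "\<delta> > 0" "\<And>\<epsilon> x. 0 < \<epsilon> \<Longrightarrow> \<epsilon> < \<delta> \<Longrightarrow> \<bar>conv (mollifier \<epsilon>) w x - w x\<bar> \<le> e / (Z + 1)"
    using conv_mollifier_approx[OF w K v, of "e / (Z + 1)"] e Z by auto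
  have "\<bar>(\<integral>y. conv (mollifier \<epsilon>) w y * f y \<partial>lborel) - (\<integral>y. w y * f y \<partial>lborel)\<bar> \<le> e" if \<epsilon>: "0 < \<epsilon>" "\<epsilon> < min \<delta> \<epsilon>1" for \<epsilon>
  proof -
    let ?m = "mollifier \<epsilon> :: real^'n \<Rightarrow> real"
    have [measurable]: "?m \<in> borel_measurable borel" using mollifier_integrable[OF \<epsilon>(1)] by auto
    have vc: "vanishes_outside (thick K \<epsilon>1) (conv ?m w)"
      using conv_vanishes_outside[OF mollifier_vanishes[OF \<epsilon>(1)] v] thick_mono[of \<epsilon> \<epsilon>1 K] \<epsilon>(2)
      unfolding thick_def[symmetric] vanishes_outside_def by auto
    have vw: "vanishes_outside (thick K \<epsilon>1) w"
      using v thick_mem[of _ K _ \<epsilon>1] \<epsilon>1 unfolding vanishes_outside_def by (metis diff_self less_imp_le norm_zero)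
    have bnd: "\<bar>(conv ?m w y - w y) * f y\<bar> \<le> e / (Z + 1) * \<bar>?I y * f y\<bar>" for y
    proof (cases "y \<in> thick K \<epsilon>1")
      case True
      have "\<bar>conv ?m w y - w y\<bar> * \<bar>f y\<bar> \<le> e / (Z + 1) * \<bar>f y\<bar>"
        using \<delta>(2)[OF \<epsilon>(1), of y] \<epsilon>(2) by (intro mult_right_mono) auto
      then show ?thesis using True by (simp add: abs_mult)
    next
      case False
      then show ?thesis using vc vw by (simp add: vanishes_outside_def)
    qed
    have bi: "integrable lborel (\<lambda>y. e / (Z + 1) * \<bar>?I y * f y\<bar>)" using f by simp
    have di: "integrable lborel (\<lambda>y. (conv ?m w y - w y) * f y)"
      by (rule Bochner_Integration.integrable_bound[OF bi]) (use bnd Z e in \<open>auto intro!: AE_I2\<close>)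
    have wf: "integrable lborel (\<lambda>y. w y * f y)"
      by (rule integrable_cont_times_local[OF w compact_thick[OF K] vw f fm])
    have "(\<integral>y. conv ?m w y * f y \<partial>lborel) - (\<integral>y. w y * f y \<partial>lborel) = (\<integral>y. (conv ?m w y - w y) * f y \<partial>lborel)"
    proof -
      have "(\<integral>y. conv ?m w y * f y \<partial>lborel) = (\<integral>y. (conv ?m w y - w y) * f y + w y * f y \<partial>lborel)"
        by (simp add: algebra_simps)
      then show ?thesis using di wf by (simp add: Bochner_Integration.integral_add)
    qed
    also have "\<bar>\<dots>\<bar> \<le> (\<integral>y. e / (Z + 1) * \<bar>?I y * f y\<bar> \<partial>lborel)"
      by (rule order_trans[OF integral_abs_bound integral_mono]) (use di bi bnd in auto)
    also have "\<dots> = e / (Z + 1) * Z" by (simp add: Z_def)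
    also have "\<dots> \<le> e" using e Z by (simp add: divide_simps)
    finally show ?thesis .
  qed
  then show ?thesis using \<delta>(1) \<epsilon>1 by (intro exI[of _ "min \<delta> \<epsilon>1"]) auto
qed

section \<open>Rotations and equivariant fields at a point\<close>

lemma rotation_orthogonal: "rotation_matrix g \<Longrightarrow> orthogonal_transformation (\<lambda>x. g *v (x :: real^'n))"
  by (simp add: rotation_matrix_def orthogonal_transformation_matrix)

lemma rotation_norm: "rotation_matrix g \<Longrightarrow> norm (g *v (x :: real^'n)) = norm x"
  using orthogonal_transformation_norm[OF rotation_orthogonal] .

lemma rotation_transpose: "rotation_matrix g \<Longrightarrow> rotation_matrix (transpose (g :: real^'n^'n))"
  by (simp add: rotation_matrix_def orthogonal_matrix_def)

lemma rotation_inverse: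
  fixes g :: "real^'n^'n"
  assumes "rotation_matrix g"
  shows "transpose g ** g = mat 1" "g ** transpose g = mat 1" "matrix_inv g = transpose g"
    "transpose g *v (g *v x) = x" "g *v (transpose g *v x) = x"
proof -
  show 1: "transpose g ** g = mat 1" "g ** transpose g = mat 1"
    using assms by (auto simp: rotation_matrix_def orthogonal_matrix_def)
  have "g ** matrix_inv g = mat 1 \<and> matrix_inv g ** g = mat 1"
    unfolding matrix_inv_def by (rule someI[of _ "transpose g"]) (use 1 in simp)
  then show "matrix_inv g = transpose g"
    using 1 by (metis matrix_mul_assoc matrix_mul_lid matrix_mul_rid)
  show "transpose g *v (g *v x) = x" "g *v (transpose g *v x) = x"
    using 1 by (simp_all only: matrix_vector_mul_assoc matrix_vector_mul_lid)
qed

lemma rotation_transitive: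
  fixes x y :: "real^'n"
  assumes "CARD('n) \<ge> 3" "norm x = norm y"
  obtains g where "rotation_matrix g" "g *v x = y"
proof -
  have "2 \<le> CARD('n)" using assms by simp
  from rotation_exists[OF this assms(2)] obtain f where f: "orthogonal_transformation f" "det (matrix f) = 1" "f x = y" .
  then have "matrix f *v x = y" by (simp add: matrix_works orthogonal_transformation_linear)
  moreover have "rotation_matrix (matrix f)" using f by (simp add: rotation_matrix_def orthogonal_transformation_matrix)
  ultimately show thesis using that by blast
qed

lemma radially_symmetric_norm:
  fixes \<Omega> :: "(real^'n) set"
  assumes "CARD('n) \<ge> 3" "radially_symmetric \<Omega>" "x \<in> \<Omega>" "norm y = norm x"
  shows "y \<in> \<Omega>"
  using rotation_transitive[OF assms(1), of x y] assms by (metis radially_symmetric_def)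

text \<open>The diagonal matrix with entries $-1$ at $i$ and $j$ and $1$ elsewhere. These rotations are the only elements of
the stabilizer of a coordinate axis that the argument needs.\<close>

definition flip_two :: "'n \<Rightarrow> 'n \<Rightarrow> real^'n^'n" where
  "flip_two i j = (\<chi> k l. if k = l then if k = i \<or> k = j then -1 else 1 else 0)"

lemma flip_two_vec: "(flip_two i j *v x) $ k = (if k = i \<or> k = j then - x $ k else x $ k)"
  by (simp add: flip_two_def matrix_vector_mult_def if_distrib[of "\<lambda>z. z * _"] cong: if_cong)

lemma transpose_flip_two: "transpose (flip_two i j) = flip_two i j"
  by (simp add: flip_two_def transpose_def vec_eq_iff)

lemma rotation_flip_two:
  assumes "i \<noteq> j"
  shows "rotation_matrix (flip_two i j)"
  unfolding rotation_matrix_def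
proof
  have "flip_two i j *v (flip_two i j *v x) = x" for x
    by (simp add: vec_eq_iff flip_two_vec)
  then have "flip_two i j ** flip_two i j = mat 1"
    by (simp add: matrix_eq matrix_vector_mul_assoc[symmetric])
  then show "orthogonal_matrix (flip_two i j)" by (simp add: orthogonal_matrix_def transpose_flip_two)
  have "det (flip_two i j) = (\<Prod>k\<in>UNIV. if k = i \<or> k = j then -1 else 1)"
    by (subst det_diagonal) (simp_all add: flip_two_def)
  also have "\<dots> = (\<Prod>k\<in>{i, j}. -1)"
    by (intro prod.mono_neutral_cong_right) auto
  finally show "det (flip_two i j) = 1" using assms by simp
qed

lemma flip_two_conj:
  "(flip_two i j ** M ** transpose (flip_two i j)) $ p $ q =
    (if p = i \<or> p = j then -1 else 1) * (if q = i \<or> q = j then -1 else 1) * M $ p $ q"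
  by (simp add: transpose_flip_two) 
    (simp add: flip_two_def matrix_matrix_mult_def if_distrib[of "\<lambda>z. z * _"] if_distrib[of "\<lambda>z. _ * z"] cong: if_cong)

lemma flip_two_fixes_axis: "i \<noteq> a \<Longrightarrow> j \<noteq> a \<Longrightarrow> flip_two i j *v (r *\<^sub>R axis a 1) = r *\<^sub>R axis a 1"
  by (simp add: vec_eq_iff flip_two_vec axis_def)

lemma exists_avoiding:
  fixes S :: "'n::finite set"
  assumes "card S < CARD('n)"
  obtains j where "j \<notin> S"
  using assms by (metis UNIV_eq_I less_irrefl)

text \<open>Since $N \ge 3$ there is an index $j$ different from $a$ and $i$. The rotation flipping $i$ and $j$ fixes the point on the axis and changes
the sign of the $i$-th component.\<close>

lemma equivariant_field_on_axis:
  fixes A :: "real^'n \<Rightarrow> real^'n"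
  assumes n: "CARD('n) \<ge> 3" and eq: "\<And>g x. rotation_matrix g \<Longrightarrow> x \<in> \<Omega> \<Longrightarrow> A (g *v x) = g *v A x"
    and x: "r *\<^sub>R axis a 1 \<in> \<Omega>" and i: "i \<noteq> a"
  shows "A (r *\<^sub>R axis a 1) $ i = 0"
proof -
  obtain j where j: "j \<notin> {a, i}"
    using exists_avoiding[of "{a, i}"] i n by auto
  have "A (r *\<^sub>R axis a 1) = flip_two i j *v A (r *\<^sub>R axis a 1)"
  proof -
    have f: "flip_two i j *v (r *\<^sub>R axis a 1) = r *\<^sub>R axis a 1" using i j by (intro flip_two_fixes_axis) auto
    have "rotation_matrix (flip_two i j)" using j by (intro rotation_flip_two) auto
    from eq[OF this x] show ?thesis unfolding f .
  qed
  from arg_cong[where f="\<lambda>v. v $ i", OF this] 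
  have "A (r *\<^sub>R axis a 1) $ i = - A (r *\<^sub>R axis a 1) $ i" by (simp only: flip_two_vec simp_thms if_True)
  then show ?thesis by linarith
qed

text \<open>On the axis all components but one vanish, and a rotation carries the axis to any other point of the same
norm. At the origin every coordinate axis is available, so the value there is zero, which agrees with the right-hand side.\<close>

lemma equivariant_field_radial:
  fixes A :: "real^'n \<Rightarrow> real^'n"
  assumes n: "CARD('n) \<ge> 3" and \<Omega>: "radially_symmetric \<Omega>"
    and eq: "\<And>g x. rotation_matrix g \<Longrightarrow> x \<in> \<Omega> \<Longrightarrow> A (g *v x) = g *v A x"
    and x: "x \<in> \<Omega>"
  shows "A x = (A (norm x *\<^sub>R axis a 1) $ a / norm x) *\<^sub>R x"
proof -
  define y :: "real^'n" where "y = norm x *\<^sub>R axis a 1"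
  have ny: "norm y = norm x" by (simp add: y_def norm_axis_1)
  then have y: "y \<in> \<Omega>" using radially_symmetric_norm[OF n \<Omega> x] by blast
  show ?thesis
  proof (cases "x = 0")
    case True
    have "A 0 $ i = 0" for i
    proof -
      have "card {i} < CARD('n)" using n by simp
      then obtain b where "b \<notin> {i}" by (rule exists_avoiding)
      then have "A (0 *\<^sub>R axis b 1) $ i = 0"
        using x True by (intro equivariant_field_on_axis[OF n eq, of \<Omega>]) simp_all
      then show ?thesis by simp
    qed
    then have "A 0 = 0" by (simp add: vec_eq_iff)
    then show ?thesis using True by simp
  next
    case False
    obtain g where g: "rotation_matrix g" "g *v y = x" using rotation_transitive[OF n ny] .
    have "A y = (A y $ a / norm x) *\<^sub>R y"
    proof -
      have "A y $ i = ((A y $ a / norm x) *\<^sub>R y) $ i" for i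
      proof (cases "i = a")
        case True
        have "y $ a = norm x" by (simp add: y_def)
        then show ?thesis using True False by simp
      next
        case i: False
        have "A (norm x *\<^sub>R axis a 1) $ i = 0"
          by (rule equivariant_field_on_axis[OF n eq y[unfolded y_def] i])
        moreover have "y $ i = 0" using i by (simp add: y_def axis_def)
        ultimately show ?thesis by (simp only: y_def vector_scaleR_component) simp
      qed
      then show ?thesis by (intro vec_eq_iff[THEN iffD2] allI)
    qed
    then have "g *v A y = g *v ((A y $ a / norm x) *\<^sub>R y)" by (rule arg_cong)
    also have "\<dots> = (A y $ a / norm x) *\<^sub>R x" by (simp only: matrix_vector_mult_scaleR g(2))
    finally have "g *v A y = (A y $ a / norm x) *\<^sub>R x" .
    moreover have "A x = g *v A y" using eq[OF g(1) y] unfolding g(2) .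
    ultimately show ?thesis by (simp only: y_def)
  qed
qed

text \<open>Flipping $p$ and a third index $j$ changes the sign of the entries at $(p,q)$ and $(q,p)$ and fixes the point on the axis.\<close>

lemma equivariant_matrix_on_axis:
  fixes B :: "real^'n \<Rightarrow> real^'n^'n"
  assumes eq: "\<And>g x. rotation_matrix g \<Longrightarrow> x \<in> \<Omega> \<Longrightarrow> B (g *v x) = g ** B x ** transpose g"
    and x: "r *\<^sub>R axis a 1 \<in> \<Omega>" and p: "p \<noteq> q" and j: "j \<notin> {a, p, q}" "p \<noteq> a"
  shows "B (r *\<^sub>R axis a 1) $ p $ q = 0" "B (r *\<^sub>R axis a 1) $ q $ p = 0"
proof -
  have e: "B (r *\<^sub>R axis a 1) = flip_two p j ** B (r *\<^sub>R axis a 1) ** transpose (flip_two p j)"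
  proof -
    have f: "flip_two p j *v (r *\<^sub>R axis a 1) = r *\<^sub>R axis a 1" using j by (intro flip_two_fixes_axis) auto
    have "rotation_matrix (flip_two p j)" using j by (intro rotation_flip_two) auto
    from eq[OF this x] show ?thesis unfolding f .
  qed
  have c: "(1 - (if k = p \<or> k = j then -1 else 1) * (if l = p \<or> l = j then -1 else 1)) * B (r *\<^sub>R axis a 1) $ k $ l = 0" for k l
  proof -
    have "b = s * b \<Longrightarrow> (1 - s) * b = 0" for b s :: real by (simp add: algebra_simps)
    from this[OF trans[OF arg_cong[where f="\<lambda>M. M $ k $ l", OF e] flip_two_conj]] show ?thesis .
  qed
  show "B (r *\<^sub>R axis a 1) $ p $ q = 0" using c[of p q] p j by auto
  show "B (r *\<^sub>R axis a 1) $ q $ p = 0" using c[of q p] p j by auto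
qed

text \<open>In dimension at least four, any three indices $a$, $p$, $q$ leave room for the auxiliary index $j$ of \<open>equivariant_matrix_on_axis\<close>.\<close>

lemma equivariant_skew_zero:
  fixes B :: "real^'n \<Rightarrow> real^'n^'n"
  assumes n: "CARD('n) \<ge> 4" and \<Omega>: "radially_symmetric \<Omega>"
    and eq: "\<And>g x. rotation_matrix g \<Longrightarrow> x \<in> \<Omega> \<Longrightarrow> B (g *v x) = g ** B x ** transpose g"
    and skew: "\<And>x p. B x $ p $ p = 0"
    and x: "x \<in> \<Omega>"
  shows "B x = 0"
proof -
  fix a :: 'n
  define y :: "real^'n" where "y = norm x *\<^sub>R axis a 1"
  have ny: "norm y = norm x" by (simp add: y_def norm_axis_1)
  have n3: "CARD('n) \<ge> 3" using n by simp
  have y: "y \<in> \<Omega>" using radially_symmetric_norm[OF n3 \<Omega> x ny] .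
  have "B y $ p $ q = 0" for p q
  proof (cases "p = q")
    case False
    have "card {a, p, q} \<le> 3" by (simp add: card_insert_if)
    then have "card {a, p, q} < CARD('n)" using n by linarith
    then obtain j where j: "j \<notin> {a, p, q}" by (rule exists_avoiding)
    show ?thesis
    proof (cases "p = a")
      case True
      have "B (norm x *\<^sub>R axis a 1) $ p $ q = 0"
        by (rule equivariant_matrix_on_axis(2)[OF eq y[unfolded y_def], of q p j]) (use True False j in auto)
      then show ?thesis by (simp only: y_def)
    next
      case pa: False
      have "B (norm x *\<^sub>R axis a 1) $ p $ q = 0"
        by (rule equivariant_matrix_on_axis(1)[OF eq y[unfolded y_def], of p q j]) (use pa False j in auto)
      then show ?thesis by (simp only: y_def)
    qed
  qed (simp add: skew)
  then have "B y = 0" by (simp add: vec_eq_iff)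
  moreover obtain g where g: "rotation_matrix g" "g *v y = x" using rotation_transitive[OF n3 ny] .
  ultimately have "B x = g ** 0 ** transpose g" using eq[OF g(1) y] by (simp only:)
  also have "\<dots> = 0" by (simp add: matrix_matrix_mult_def vec_eq_iff)
  finally show ?thesis .
qed

lemma det_three_indices:
  fixes A :: "real^'n^'n"
  assumes U: "UNIV = {a, b, c}" and d: "a \<noteq> b" "a \<noteq> c" "b \<noteq> c"
  shows "det A = A$a$a * A$b$b * A$c$c + A$a$b * A$b$c * A$c$a + A$a$c * A$b$a * A$c$b
    - A$a$a * A$b$c * A$c$b - A$a$b * A$b$a * A$c$c - A$a$c * A$b$b * A$c$a"
proof -
  have f123: "finite {b, c}" "a \<notin> {b, c}" using d by auto
  have f23: "finite {c}" "b \<notin> {c}" using d by auto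
  show ?thesis
    unfolding det_def U
    unfolding sum_over_permutations_insert[OF f123]
    unfolding sum_over_permutations_insert[OF f23]
    unfolding permutes_sing
    using d d[symmetric] by (simp add: sign_swap_id permutation_swap_id sign_compose sign_id swap_id_eq)
qed

text \<open>In dimension three with indices $a$, $b$, $c$, the skew matrix $B(x)$ corresponds to the vector
$b = (B_{bc}, B_{ca}, B_{ab})$, and this is $x \cdot b(x)$: up to the factor $|x|$, the flux density through the sphere.\<close>

definition flux :: "'n \<Rightarrow> 'n \<Rightarrow> 'n \<Rightarrow> (real^'n \<Rightarrow> real^'n^'n) \<Rightarrow> real^'n \<Rightarrow> real" where
  "flux a b c B x = x $ a * B x $ b $ c + x $ b * B x $ c $ a + x $ c * B x $ a $ b"

text \<open>On the axis only $\beta = B_{bc}$ survives. Conjugating by a rotation $g$ that carries the axis point to $x$ turns the flux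
density into $|x| \beta \det g$, so it depends on $|x|$ only and it determines $B(x)$. Here it
matters that the determinant is $1$: a reflection would change the sign. At the origin $\beta = 0$ because the axis through $b$ may be used instead.\<close>

lemma equivariant_skew_flux:
  fixes B :: "real^'n \<Rightarrow> real^'n^'n"
  assumes U: "UNIV = {a, b, c}" and d: "a \<noteq> b" "a \<noteq> c" "b \<noteq> c" and \<Omega>: "radially_symmetric \<Omega>"
    and eq: "\<And>g x. rotation_matrix g \<Longrightarrow> x \<in> \<Omega> \<Longrightarrow> B (g *v x) = g ** B x ** transpose g"
    and skew: "\<And>x p q. B x $ p $ q = - B x $ q $ p"
    and x: "x \<in> \<Omega>"
  shows "flux a b c B x = norm x * B (norm x *\<^sub>R axis a 1) $ b $ c"
    "flux a b c B x = 0 \<Longrightarrow> B x = 0"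
proof -
  have "CARD('n) = card {a, b, c}" by (simp add: U)
  also have "\<dots> = 3" using d by simp
  finally have n: "CARD('n) = 3" .
  then have n3: "CARD('n) \<ge> 3" by simp
  have diag: "B x $ p $ p = 0" for x p using skew[of x p p] by simp
  have S: "(\<Sum>k\<in>UNIV. f k) = f a + f b + f c" for f :: "'n \<Rightarrow> real" using d by (simp add: U)
  define y :: "real^'n" where "y = norm x *\<^sub>R axis a 1"
  define \<beta> where "\<beta> = B y $ b $ c"
  have ny: "norm y = norm x" by (simp add: y_def norm_axis_1)
  have y: "y \<in> \<Omega>" using radially_symmetric_norm[OF n3 \<Omega> x ny] .
  have ab: "B y $ b $ a = 0" "B y $ a $ b = 0"
    unfolding y_def using d by (auto intro!: equivariant_matrix_on_axis[OF eq y[unfolded y_def], of b a c])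
  have ac: "B y $ c $ a = 0" "B y $ a $ c = 0"
    unfolding y_def using d by (auto intro!: equivariant_matrix_on_axis[OF eq y[unfolded y_def], of c a b])
  have cb: "B y $ c $ b = - \<beta>" using skew[of y c b] by (simp add: \<beta>_def)
  obtain g where g: "rotation_matrix g" "g *v y = x" using rotation_transitive[OF n3 ny] .
  have Bx: "B x $ p $ q = \<beta> * (g$p$b * g$q$c - g$p$c * g$q$b)" for p q
    using eq[OF g(1) y] g(2)
    by (simp add: matrix_matrix_mult_def transpose_def S ab ac cb diag \<beta>_def[symmetric] algebra_simps)
  have "(g *v y) $ p = norm x * g$p$a" for p
    using d by (simp add: matrix_vector_mult_def S y_def axis_def)
  then have xg: "x $ p = norm x * g$p$a" for p unfolding g(2) .
  have "flux a b c B x = norm x * \<beta> * det g"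
    unfolding flux_def Bx det_three_indices[OF U d] xg[of a] xg[of b] xg[of c] by (simp add: algebra_simps)
  then have fl: "flux a b c B x = norm x * \<beta>" using g(1) by (simp add: rotation_matrix_def)
  then show "flux a b c B x = norm x * B (norm x *\<^sub>R axis a 1) $ b $ c" by (simp add: \<beta>_def y_def)
  assume "flux a b c B x = 0"
  then consider "\<beta> = 0" | "x = 0" using fl by auto
  then have "\<beta> = 0"
  proof cases
    case 2
    then have "0 *\<^sub>R axis b 1 \<in> \<Omega>" using x by simp
    from equivariant_matrix_on_axis(2)[OF eq this, where p=c and q=b and j=a] d 2
    show ?thesis by (simp add: \<beta>_def y_def)
  qed
  then show "B x = 0" by (simp add: vec_eq_iff Bx)
qed

section \<open>Borel versions of locally square integrable fields\<close>

text \<open>Fubini's theorem is available for Borel functions on the product of two copies of Lebesgue-Borel measure.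
Fields measurable with respect to the completed measure on $\Omega$ are therefore replaced by Borel fields on the whole space that
agree with them almost everywhere on $\Omega$ and vanish elsewhere.\<close>

definition borel_version :: "(real^'n) set \<Rightarrow> (real^'n \<Rightarrow> real^'n) \<Rightarrow> (real^'n \<Rightarrow> real^'n) \<Rightarrow> bool" where
  "borel_version \<Omega> f F \<longleftrightarrow> F \<in> borel_measurable borel \<and> vanishes_outside \<Omega> F \<and> (AE x in lborel. x \<in> \<Omega> \<longrightarrow> f x = F x)"

definition locally_L2 :: "(real^'n) set \<Rightarrow> (real^'n \<Rightarrow> real^'n) \<Rightarrow> bool" where
  "locally_L2 \<Omega> F \<longleftrightarrow> (\<forall>K. compact K \<longrightarrow> K \<subseteq> \<Omega> \<longrightarrow> integrable lborel (\<lambda>x. indicator K x * (norm (F x))\<^sup>2))"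

lemma AE_lebesgue_on_iff:
  assumes "open \<Omega>"
  shows "(AE x in lebesgue_on \<Omega>. P x) \<longleftrightarrow> (AE x in lborel. x \<in> \<Omega> \<longrightarrow> P x)"
  using assms by (subst AE_restrict_space_iff) (auto simp: AE_completion_iff)

lemma borel_version_exists:
  fixes f :: "real^'n \<Rightarrow> real^'n"
  assumes \<Omega>: "open \<Omega>" and f: "f \<in> borel_measurable (lebesgue_on \<Omega>)"
  shows "\<exists>F. borel_version \<Omega> f F"
proof -
  have "(\<lambda>x. indicator \<Omega> x *\<^sub>R f x) \<in> borel_measurable lebesgue"
    using f \<Omega> by (subst (asm) borel_measurable_restrict_space_iff) auto
  then have m: "(\<lambda>x. (indicator \<Omega> x *\<^sub>R f x) $ i) \<in> borel_measurable lebesgue" for i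
    by (rule borel_measurable_vec_nth)
  have "\<exists>g\<in>borel_measurable lborel. AE x in lborel. (indicator \<Omega> x *\<^sub>R f x) $ i = g x" for i
    using completion_ex_borel_measurable_real[OF m] .
  then obtain G where G: "\<And>i. G i \<in> borel_measurable lborel" "\<And>i. AE x in lborel. (indicator \<Omega> x *\<^sub>R f x) $ i = G i x"
    by metis
  have [measurable]: "G i \<in> borel_measurable borel" for i using G(1)[of i] by simp
  have [measurable]: "\<Omega> \<in> sets borel" using \<Omega> by (rule borel_open)
  define F where "F x = indicator \<Omega> x *\<^sub>R (\<chi> i. G i x)" for x
  have "F \<in> borel_measurable borel" 
    unfolding F_def by (intro borel_measurable_scaleR borel_measurable_vec_lambda) measurable
  moreover have "vanishes_outside \<Omega> F" by (simp add: vanishes_outside_def F_def)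
  moreover have "AE x in lborel. \<forall>i. (indicator \<Omega> x *\<^sub>R f x) $ i = G i x"
    using G(2) by (simp add: AE_all_countable)
  then have "AE x in lborel. x \<in> \<Omega> \<longrightarrow> f x = F x"
    by eventually_elim (auto simp: F_def vec_eq_iff)
  ultimately show ?thesis by (auto simp: borel_version_def)
qed

lemma borel_version_L2:
  assumes \<Omega>: "open \<Omega>" and f: "f \<in> L2_loc \<Omega>" and F: "borel_version \<Omega> f F"
  shows "locally_L2 \<Omega> F"
  unfolding locally_L2_def
proof (intro allI impI)
  fix K assume K: "compact K" "K \<subseteq> \<Omega>"
  have [measurable]: "F \<in> borel_measurable borel" "K \<in> sets borel" 
    using F borel_compact[OF K(1)] by (auto simp: borel_version_def)
  have "integrable (lebesgue_on K) (\<lambda>x. (norm (f x))\<^sup>2)" using f K by (auto simp: L2_loc_def)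
  then have i: "integrable lebesgue (\<lambda>x. indicator K x * (norm (f x))\<^sup>2)"
    by (subst (asm) integrable_restrict_space) auto
  have "integrable lebesgue (\<lambda>x. indicator K x * (norm (F x))\<^sup>2)"
  proof (rule integrable_cong_AE_imp[OF i])
    have "AE x in lborel. indicator K x * (norm (f x))\<^sup>2 = indicator K x * (norm (F x))\<^sup>2"
    proof -
      have "AE x in lborel. x \<in> \<Omega> \<longrightarrow> f x = F x" using F by (simp add: borel_version_def)
      then show ?thesis by eventually_elim (use K in \<open>auto split: split_indicator\<close>)
    qed
    then show "AE x in lebesgue. indicator K x * (norm (f x))\<^sup>2 = indicator K x * (norm (F x))\<^sup>2"
      by (rule AE_completion)
    show "(\<lambda>x. indicator K x * (norm (F x))\<^sup>2) \<in> borel_measurable lebesgue" by (rule measurable_completion) measurable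
  qed
  then show "integrable lborel (\<lambda>x. indicator K x * (norm (F x))\<^sup>2)"
    by (subst (asm) integrable_completion) auto
qed

lemma locally_L2_imp_L1:
  assumes F: "locally_L2 \<Omega> F" and [measurable]: "F \<in> borel_measurable borel" and K: "compact K" "K \<subseteq> \<Omega>"
  shows "integrable lborel (\<lambda>x. indicator K x * norm (F x))" "integrable lborel (\<lambda>x. indicator K x * F x $ i)"
proof -
  have [measurable]: "K \<in> sets borel" by (rule borel_compact[OF K(1)])
  have b: "integrable lborel (\<lambda>x. indicator K x * (norm (F x))\<^sup>2 + indicator K x)"
    using F K integrable_indicator_compact[OF K(1)] by (auto simp: locally_L2_def)
  have le: "t \<le> t\<^sup>2 + 1" for t :: real
    using zero_le_power2[of "t - 1/2"] by (simp add: power2_eq_square algebra_simps)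
  show "integrable lborel (\<lambda>x. indicator K x * norm (F x))"
    by (rule Bochner_Integration.integrable_bound[OF b]) (auto intro!: AE_I2 simp: le split: split_indicator)
  have [measurable]: "(\<lambda>x. F x $ i) \<in> borel_measurable borel" by (rule borel_measurable_vec_nth) simp
  have le': "\<bar>F x $ i\<bar> \<le> (norm (F x))\<^sup>2 + 1" for x
    using component_le_norm_cart[of "F x" i] le[of "norm (F x)"] by linarith
  show "integrable lborel (\<lambda>x. indicator K x * F x $ i)"
    by (rule Bochner_Integration.integrable_bound[OF b]) (auto intro!: AE_I2 simp: le' split: split_indicator)
qed

lemma borel_version_regular_dist:
  fixes f F :: "real^'n \<Rightarrow> real^'n"
  assumes \<Omega>: "open \<Omega>" and f: "f \<in> borel_measurable (lebesgue_on \<Omega>)" and F: "borel_version \<Omega> f F" 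
    and [measurable]: "\<psi> \<in> borel_measurable borel"
  shows "regular_dist \<Omega> (\<lambda>x. f x $ k) \<psi> = (\<integral>x. \<psi> x * F x $ k \<partial>lborel)"
proof -
  have [measurable]: "F \<in> borel_measurable borel" "\<Omega> \<in> sets borel" using F borel_open[OF \<Omega>] by (auto simp: borel_version_def)
  have \<psi>m: "\<psi> \<in> borel_measurable lebesgue" and \<psi>Fm: "(\<lambda>x. \<psi> x * F x $ k) \<in> borel_measurable lebesgue" 
    by (rule measurable_completion, measurable)+
  have fm: "(\<lambda>x. indicator \<Omega> x *\<^sub>R f x) \<in> borel_measurable lebesgue"
    using f \<Omega> by (subst (asm) borel_measurable_restrict_space_iff) auto
  have "regular_dist \<Omega> (\<lambda>x. f x $ k) \<psi> = (\<integral>x. indicator \<Omega> x *\<^sub>R (\<psi> x *\<^sub>R f x $ k) \<partial>lebesgue)"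
    unfolding regular_dist_def by (subst integral_restrict_space) auto
  also have "\<dots> = (\<integral>x. \<psi> x * (indicator \<Omega> x *\<^sub>R f x) $ k \<partial>lebesgue)"
    by (intro Bochner_Integration.integral_cong) auto
  also have "\<dots> = (\<integral>x. \<psi> x * F x $ k \<partial>lebesgue)"
  proof (rule integral_cong_AE)
    have "AE x in lborel. x \<in> \<Omega> \<longrightarrow> f x = F x" using F by (simp add: borel_version_def)
    then have "AE x in lborel. \<psi> x * (indicator \<Omega> x *\<^sub>R f x) $ k = \<psi> x * F x $ k"
      by eventually_elim (use F in \<open>auto split: split_indicator simp: borel_version_def vanishes_outside_def\<close>)
    then show "AE x in lebesgue. \<psi> x * (indicator \<Omega> x *\<^sub>R f x) $ k = \<psi> x * F x $ k" by (rule AE_completion)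
  qed (intro borel_measurable_times borel_measurable_vec_nth \<psi>m fm \<psi>Fm)+
  also have "\<dots> = (\<integral>x. \<psi> x * F x $ k \<partial>lborel)"
    by (rule integral_completion) measurable
  finally show ?thesis .
qed

lemma regular_dist_borel:
  fixes f :: "real^'n \<Rightarrow> real"
  assumes \<Omega>: "open \<Omega>" and [measurable]: "f \<in> borel_measurable borel" "\<psi> \<in> borel_measurable borel"
    and v: "vanishes_outside \<Omega> \<psi>"
  shows "regular_dist \<Omega> f \<psi> = (\<integral>x. f x * \<psi> x \<partial>lborel)"
proof -
  have "regular_dist \<Omega> f \<psi> = (\<integral>x. indicator \<Omega> x *\<^sub>R (\<psi> x *\<^sub>R f x) \<partial>lebesgue)"
    unfolding regular_dist_def using \<Omega> by (subst integral_restrict_space) auto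
  also have "\<dots> = (\<integral>x. f x * \<psi> x \<partial>lebesgue)"
    by (rule Bochner_Integration.integral_cong[OF refl]) (use v in \<open>auto simp: vanishes_outside_def split: split_indicator\<close>)
  also have "\<dots> = (\<integral>x. f x * \<psi> x \<partial>lborel)" by (rule integral_completion) measurable
  finally show ?thesis .
qed

text \<open>Integrability of $\psi A$ has to be established before the components may be taken inside the vector-valued integral.\<close>

lemma regular_dist_component:
  fixes A F :: "real^'n \<Rightarrow> real^'n"
  assumes \<Omega>: "open \<Omega>" and A: "A \<in> L2_loc \<Omega>" and F: "borel_version \<Omega> A F"
    and \<psi>: "continuous_on UNIV \<psi>" and K: "compact K" "K \<subseteq> \<Omega>" and v: "vanishes_outside K \<psi>"
  shows "regular_dist \<Omega> A \<psi> $ j = (\<integral>x. F x $ j * \<psi> x \<partial>lborel)"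
proof -
  have Am: "A \<in> borel_measurable (lebesgue_on \<Omega>)" using A by (simp add: L2_loc_def)
  have Fm[measurable]: "F \<in> borel_measurable borel" using F by (simp add: borel_version_def)
  have L2: "locally_L2 \<Omega> F" by (rule borel_version_L2[OF \<Omega> A F])
  have [measurable]: "\<psi> \<in> borel_measurable borel" using \<psi> by (rule borel_measurable_continuous_onI)
  have \<psi>m: "\<psi> \<in> borel_measurable lebesgue" by (rule measurable_completion) simp
  have [measurable]: "K \<in> sets borel" by (rule borel_compact[OF K(1)])
  obtain M where M: "M > 0" "\<And>x. \<bar>\<psi> x\<bar> \<le> M" using cont_supported_bounded[OF \<psi> K(1) v] by blast
  have "integrable lborel (\<lambda>x. \<psi> x *\<^sub>R F x)"
  proof (rule Bochner_Integration.integrable_bound)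
    show "integrable lborel (\<lambda>x. M * (indicator K x * norm (F x)))" using locally_L2_imp_L1(1)[OF L2 Fm K] by simp
    show "AE x in lborel. norm (\<psi> x *\<^sub>R F x) \<le> norm (M * (indicator K x * norm (F x)))"
    proof (rule AE_I2)
      fix x show "norm (\<psi> x *\<^sub>R F x) \<le> norm (M * (indicator K x * norm (F x)))"
        using M v by (cases "x \<in> K") (auto simp: vanishes_outside_def intro!: mult_right_mono)
    qed
  qed measurable
  then have i: "integrable lebesgue (\<lambda>x. \<psi> x *\<^sub>R F x)" by (subst integrable_completion) auto
  have "integrable lebesgue (\<lambda>x. \<psi> x *\<^sub>R (indicator \<Omega> x *\<^sub>R A x))"
  proof (rule integrable_cong_AE_imp[OF i])
    show "(\<lambda>x. \<psi> x *\<^sub>R (indicator \<Omega> x *\<^sub>R A x)) \<in> borel_measurable lebesgue"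
    proof (rule borel_measurable_scaleR[OF \<psi>m])
      show "(\<lambda>x. indicator \<Omega> x *\<^sub>R A x) \<in> borel_measurable lebesgue"
        using Am \<Omega> by (subst (asm) borel_measurable_restrict_space_iff) auto
    qed
    have "AE x in lborel. x \<in> \<Omega> \<longrightarrow> A x = F x" using F by (simp add: borel_version_def)
    then have "AE x in lborel. \<psi> x *\<^sub>R F x = \<psi> x *\<^sub>R (indicator \<Omega> x *\<^sub>R A x)"
      by eventually_elim (use F in \<open>auto split: split_indicator simp: borel_version_def vanishes_outside_def\<close>)
    then show "AE x in lebesgue. \<psi> x *\<^sub>R F x = \<psi> x *\<^sub>R (indicator \<Omega> x *\<^sub>R A x)" by (rule AE_completion)
  qed
  then have I: "integrable (lebesgue_on \<Omega>) (\<lambda>x. \<psi> x *\<^sub>R A x)"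
    using \<Omega> by (subst integrable_restrict_space) (auto simp: mult.commute)
  have "regular_dist \<Omega> A \<psi> $ j = (\<integral>x. (\<psi> x *\<^sub>R A x) $ j \<partial>lebesgue_on \<Omega>)"
    unfolding regular_dist_def by (rule integral_bounded_linear[OF bounded_linear_vec_nth I, symmetric])
  also have "\<dots> = regular_dist \<Omega> (\<lambda>x. A x $ j) \<psi>" by (simp add: regular_dist_def)
  also have "\<dots> = (\<integral>x. \<psi> x * F x $ j \<partial>lborel)" by (rule borel_version_regular_dist[OF \<Omega> Am F]) simp
  finally show ?thesis by (simp add: mult.commute)
qed

section \<open>The profile of an equivariant field\<close>

definition rot_equivariant_ae :: "(real^'n \<Rightarrow> real^'n) \<Rightarrow> bool" where
  "rot_equivariant_ae F \<longleftrightarrow> (\<forall>g. rotation_matrix g \<longrightarrow> (AE x in lborel. F (g *v x) = g *v F x))"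

lemma rotation_mem_iff:
  assumes "radially_symmetric \<Omega>" "rotation_matrix g"
  shows "g *v x \<in> \<Omega> \<longleftrightarrow> x \<in> \<Omega>"
  using assms rotation_transpose[OF assms(2)] rotation_inverse(4)[OF assms(2), of x] unfolding radially_symmetric_def by metis

lemma borel_version_equivariant:
  fixes f F :: "real^'n \<Rightarrow> real^'n"
  assumes \<Omega>: "open \<Omega>" "radially_symmetric \<Omega>" and F: "borel_version \<Omega> f F"
    and eq: "\<And>g. rotation_matrix g \<Longrightarrow> AE x in lebesgue_on \<Omega>. f (g *v x) = g *v f x"
  shows "rot_equivariant_ae F"
  unfolding rot_equivariant_ae_def
proof (intro allI impI)
  fix g :: "real^'n^'n" assume g: "rotation_matrix g"
  have gm: "(\<lambda>x. g *v x) \<in> borel_measurable borel" by (rule measurable_orthogonal[OF rotation_orthogonal[OF g]])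
  have ae: "AE x in lborel. x \<in> \<Omega> \<longrightarrow> f x = F x" using F by (simp add: borel_version_def)
  then have "AE x in distr lborel borel (\<lambda>x. g *v x). x \<in> \<Omega> \<longrightarrow> f x = F x"
    unfolding lborel_distr_orthogonal[OF rotation_orthogonal[OF g]] .
  then have ae': "AE x in lborel. g *v x \<in> \<Omega> \<longrightarrow> f (g *v x) = F (g *v x)"
    by (rule AE_distrD[rotated]) (use gm in simp)
  have "AE x in lborel. x \<in> \<Omega> \<longrightarrow> f (g *v x) = g *v f x" using eq[OF g] by (simp add: AE_lebesgue_on_iff \<Omega>)
  with ae ae' show "AE x in lborel. F (g *v x) = g *v F x"
  proof eventually_elim
    case (elim x)
    show ?case
    proof (cases "x \<in> \<Omega>")
      case True
      then show ?thesis using elim rotation_mem_iff[OF \<Omega>(2) g] by metis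
    next
      case False
      then have "F x = 0" "F (g *v x) = 0"
        using F rotation_mem_iff[OF \<Omega>(2) g] by (auto simp: borel_version_def vanishes_outside_def)
      then show ?thesis by simp
    qed
  qed
qed

text \<open>After the substitution $y = g z$, which preserves the measure, the mollifier is evaluated at $g(x - z)$, where it has the same
value as at $x - z$ because it is radial.\<close>

lemma mollified_field_equivariant:
  fixes F :: "real^'n \<Rightarrow> real^'n"
  assumes \<epsilon>: "\<epsilon> > 0" and [measurable]: "F \<in> borel_measurable borel" and int: "\<And>i. integrable lborel (\<lambda>x. F x $ i)"
    and eq: "rot_equivariant_ae F" and g: "rotation_matrix g"
  shows "(\<chi> i. conv (mollifier \<epsilon>) (\<lambda>y. F y $ i) (g *v x)) = g *v (\<chi> i. conv (mollifier \<epsilon>) (\<lambda>y. F y $ i) x)"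
proof -
  note o = rotation_orthogonal[OF g]
  have gm[measurable]: "(\<lambda>x. g *v x) \<in> borel_measurable borel" by (rule measurable_orthogonal[OF o])
  have cont: "continuous_on UNIV (mollifier \<epsilon> :: real^'n \<Rightarrow> real)" by (rule C1_continuous[OF mollifier_C1[OF \<epsilon>]])
  have mm[measurable]: "(mollifier \<epsilon> :: real^'n \<Rightarrow> real) \<in> borel_measurable borel" using cont by (rule borel_measurable_continuous_onI)
  have Fm[measurable]: "(\<lambda>x. F x $ i) \<in> borel_measurable borel" for i by (rule borel_measurable_vec_nth) simp
  have v: "vanishes_outside (cball 0 \<epsilon>) (mollifier \<epsilon> :: real^'n \<Rightarrow> real)"
    using mollifier_vanishes[OF \<epsilon>, where 'n='n] by (auto simp: vanishes_outside_def)
  obtain M where M: "M > 0" "\<And>x::real^'n. \<bar>mollifier \<epsilon> x\<bar> \<le> M" using cont_supported_bounded[OF cont compact_cball v] by blast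
  have i: "integrable lborel (\<lambda>y. mollifier \<epsilon> (x - y) * F y $ j)" for j
  proof (rule Bochner_Integration.integrable_bound)
    show "integrable lborel (\<lambda>y. M * \<bar>F y $ j\<bar>)" using int[of j] by simp
    show "AE y in lborel. norm (mollifier \<epsilon> (x - y) * F y $ j) \<le> norm (M * \<bar>F y $ j\<bar>)"
      using M by (intro AE_I2) (auto simp: abs_mult intro!: mult_right_mono)
  qed measurable
  have "conv (mollifier \<epsilon>) (\<lambda>y. F y $ i) (g *v x) = (\<Sum>j\<in>UNIV. g $ i $ j * conv (mollifier \<epsilon>) (\<lambda>y. F y $ j) x)" for i
  proof -
    have "conv (mollifier \<epsilon>) (\<lambda>y. F y $ i) (g *v x) = (\<integral>z. mollifier \<epsilon> (g *v x - g *v z) * F (g *v z) $ i \<partial>lborel)"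
      unfolding conv_def
      by (rule integral_orthogonal[OF o, of "\<lambda>y. mollifier \<epsilon> (g *v x - y) * F y $ i", symmetric]) measurable
    also have "\<dots> = (\<integral>z. (\<Sum>j\<in>UNIV. g $ i $ j * (mollifier \<epsilon> (x - z) * F z $ j)) \<partial>lborel)"
    proof (rule integral_cong_AE)
      have "AE z in lborel. F (g *v z) = g *v F z" using eq g by (simp add: rot_equivariant_ae_def)
      then show "AE z in lborel. mollifier \<epsilon> (g *v x - g *v z) * F (g *v z) $ i = (\<Sum>j\<in>UNIV. g $ i $ j * (mollifier \<epsilon> (x - z) * F z $ j))"
      proof eventually_elim
        case (elim z)
        have "mollifier \<epsilon> (g *v x - g *v z) = mollifier \<epsilon> (x - z)"
          by (rule mollifier_norm[OF \<epsilon>]) (simp add: matrix_vector_mult_diff_distrib[symmetric] rotation_norm[OF g])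
        then show ?case unfolding elim
          by (simp add: matrix_vector_mult_def sum_distrib_left mult_ac)
      qed
    qed measurable
    also have "\<dots> = (\<Sum>j\<in>UNIV. g $ i $ j * conv (mollifier \<epsilon>) (\<lambda>y. F y $ j) x)"
      using i by (simp add: Bochner_Integration.integral_sum conv_def)
    finally show ?thesis .
  qed
  then show ?thesis by (simp add: vec_eq_iff matrix_vector_mult_def)
qed

text \<open>The mollified fields are radial at every point, $A_k(x) = \nu_k(|x|) x$, and converge to $F$ in $L^1$, hence almost everywhere along a
subsequence. Where they converge at some $x \ne 0$, so do the numbers $\nu_k(|x|)$; their limit is the profile of $F$.
As a limit of Borel functions of one variable it is Borel, which could not be read off from $F$ directly.\<close>

lemma radial_profile_integrable:
  fixes F :: "real^'n \<Rightarrow> real^'n"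
  assumes n: "CARD('n) \<ge> 3" and Fb[measurable]: "F \<in> borel_measurable borel" and int: "\<And>i. integrable lborel (\<lambda>x. F x $ i)"
    and eq: "rot_equivariant_ae F"
  shows "\<exists>\<nu>. \<nu> \<in> borel_measurable borel \<and> (AE x in lborel. F x = \<nu> (norm x) *\<^sub>R x)"
proof -
  fix a :: 'n
  define m :: "nat \<Rightarrow> real^'n \<Rightarrow> real" where "m k = mollifier (1 / real (Suc k))" for k
  define A where "A k x = (\<chi> i. conv (m k) (\<lambda>y. F y $ i) x)" for k x
  define \<nu>k where "\<nu>k k s = A k (s *\<^sub>R axis a 1) $ a / s" for k and s :: real
  have Fm[measurable]: "(\<lambda>x. F x $ i) \<in> borel_measurable borel" for i by (rule borel_measurable_vec_nth) simp
  have mi: "integrable lborel (m k)" for k unfolding m_def by (rule mollifier_integrable) simp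
  have mm[measurable]: "m k \<in> borel_measurable borel" for k using mi[of k] by auto
  have Am: "(\<lambda>x. A k x $ i) \<in> borel_measurable borel" for k i by (simp add: A_def)
  have ax[measurable]: "(\<lambda>s. s *\<^sub>R axis a 1 :: real^'n) \<in> borel_measurable borel" by measurable
  have \<nu>m[measurable]: "\<nu>k k \<in> borel_measurable borel" for k
    unfolding \<nu>k_def[abs_def] by (intro borel_measurable_divide measurable_compose[OF ax Am]) simp
  have Arad: "A k x = \<nu>k k (norm x) *\<^sub>R x" for k x
    unfolding \<nu>k_def
  proof (rule equivariant_field_radial[OF n, of UNIV])
    show "A k (g *v x) = g *v A k x" if "rotation_matrix g" for g x
      unfolding A_def m_def by (rule mollified_field_equivariant[OF _ Fb int eq that]) simp
  qed (auto simp: radially_symmetric_def)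
  have ci: "integrable lborel (\<lambda>x. A k x $ i)" for k i
    by (simp add: A_def integrable_conv[OF mi int])
  have di: "integrable lborel (\<lambda>x. \<bar>A k x $ i - F x $ i\<bar>)" for k i
    using ci int by simp
  have [measurable]: "A k \<in> borel_measurable borel" for k
    unfolding A_def[abs_def] by (intro borel_measurable_vec_lambda) measurable
  have "(\<lambda>k. \<Sum>i\<in>UNIV. \<integral>x. \<bar>A k x $ i - F x $ i\<bar> \<partial>lborel) \<longlonglongrightarrow> (\<Sum>i\<in>(UNIV :: 'n set). 0)"
    by (intro tendsto_sum) (use conv_mollifier_L1[OF int] in \<open>simp add: A_def m_def\<close>)
  then have lim: "(\<lambda>k. \<Sum>i\<in>UNIV. \<integral>x. \<bar>A k x $ i - F x $ i\<bar> \<partial>lborel) \<longlonglongrightarrow> 0" by simp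
  have ni: "integrable lborel (\<lambda>x. A k x - F x)" for k
  proof (rule Bochner_Integration.integrable_bound)
    show "integrable lborel (\<lambda>x. \<Sum>i\<in>UNIV. \<bar>A k x $ i - F x $ i\<bar>)" using di by simp
    show "AE x in lborel. norm (A k x - F x) \<le> norm (\<Sum>i\<in>UNIV. \<bar>A k x $ i - F x $ i\<bar>)"
      using norm_le_l1_cart[of "A k _ - F _"] by (intro AE_I2) (auto simp: sum_nonneg)
  qed measurable
  have nle: "(\<integral>x. norm (A k x - F x) \<partial>lborel) \<le> (\<Sum>i\<in>UNIV. \<integral>x. \<bar>A k x $ i - F x $ i\<bar> \<partial>lborel)" for k
  proof -
    have "(\<integral>x. norm (A k x - F x) \<partial>lborel) \<le> (\<integral>x. (\<Sum>i\<in>UNIV. \<bar>A k x $ i - F x $ i\<bar>) \<partial>lborel)"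
      using ni di norm_le_l1_cart[of "A k _ - F _"] by (intro integral_mono) auto
    then show ?thesis using di by (simp add: Bochner_Integration.integral_sum)
  qed
  have "(\<lambda>k. \<integral>x. norm (A k x - F x) \<partial>lborel) \<longlonglongrightarrow> 0"
    by (rule tendsto_sandwich[OF _ _ tendsto_const lim]) (use nle in auto)
  from tendsto_L1_AE_subseq[OF ni this] obtain r where r: "strict_mono r" "AE x in lborel. (\<lambda>k. A (r k) x - F x) \<longlonglongrightarrow> 0"
    by blast
  define \<nu> where "\<nu> s = lim (\<lambda>k. \<nu>k (r k) s)" for s
  have "\<nu> \<in> borel_measurable borel" unfolding \<nu>_def[abs_def] by (rule borel_measurable_lim_metric) measurable
  moreover have "AE x in lborel. F x = \<nu> (norm x) *\<^sub>R x"
    using r(2) AE_lborel_singleton[of 0]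
  proof eventually_elim
    case (elim x)
    have "(\<lambda>k. (A (r k) x - F x) + F x) \<longlonglongrightarrow> 0 + F x" by (intro tendsto_add elim(1) tendsto_const)
    then have A: "(\<lambda>k. A (r k) x) \<longlonglongrightarrow> F x" by simp
    then have "(\<lambda>k. (A (r k) x \<bullet> x) / (x \<bullet> x)) \<longlonglongrightarrow> (F x \<bullet> x) / (x \<bullet> x)"
      using elim(2) by (intro tendsto_intros) auto
    moreover have "(A (r k) x \<bullet> x) / (x \<bullet> x) = \<nu>k (r k) (norm x)" for k
      using elim(2) by (subst Arad) simp
    ultimately have *: "(\<lambda>k. \<nu>k (r k) (norm x)) \<longlonglongrightarrow> (F x \<bullet> x) / (x \<bullet> x)" by simp
    then have \<nu>: "\<nu> (norm x) = (F x \<bullet> x) / (x \<bullet> x)" unfolding \<nu>_def by (rule limI)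
    have "(\<lambda>k. A (r k) x) \<longlonglongrightarrow> \<nu> (norm x) *\<^sub>R x"
      unfolding Arad \<nu> by (intro tendsto_intros *)
    then show ?case using A LIMSEQ_unique by blast
  qed
  ultimately show ?thesis by blast
qed

text \<open>Points of norm at most $m$ and distance at least $1/(m+1)$ from the complement; the complement is rotation invariant.\<close>

lemma radial_exhaustion:
  fixes \<Omega> :: "(real^'n) set"
  assumes \<Omega>: "open \<Omega>" "radially_symmetric \<Omega>"
  shows "\<exists>K :: nat \<Rightarrow> (real^'n) set. (\<forall>m. compact (K m) \<and> K m \<subseteq> \<Omega> \<and> radially_symmetric (K m)) \<and> \<Omega> \<subseteq> (\<Union>m. K m)"
proof -
  define K where "K m = cball 0 (real m) - (\<Union>y\<in>-\<Omega>. ball y (1 / real (Suc m)))" for m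
  have "compact (K m)" for m unfolding K_def by (intro compact_diff open_UN ballI) auto
  moreover have "K m \<subseteq> \<Omega>" for m by (auto simp: K_def)
  moreover have "\<Omega> \<subseteq> (\<Union>m. K m)"
  proof
    fix x assume "x \<in> \<Omega>"
    then obtain e where e: "e > 0" "ball x e \<subseteq> \<Omega>" using \<Omega>(1) openE by blast
    obtain k :: nat where k: "norm x \<le> real k" using real_arch_simple by blast
    obtain l where l: "1 / real (Suc l) < e" using e(1) nat_approx_posE by auto
    have "1 / real (Suc (max k l)) \<le> 1 / real (Suc l)" by (simp add: frac_le)
    then have "x \<in> K (max k l)" using k l e(2) by (force simp: K_def dist_commute subset_iff)
    then show "x \<in> (\<Union>m. K m)" by blast
  qed
  moreover have "radially_symmetric (K m)" for m
    unfolding radially_symmetric_def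
  proof (intro allI impI ballI)
    fix g :: "real^'n^'n" and x assume g: "rotation_matrix g" and x: "x \<in> K m"
    show "g *v x \<in> K m"
      unfolding K_def
    proof
      show "g *v x \<in> cball 0 (real m)" using x by (simp add: K_def rotation_norm[OF g])
      show "g *v x \<notin> (\<Union>y\<in>-\<Omega>. ball y (1 / real (Suc m)))"
      proof
        assume "g *v x \<in> (\<Union>y\<in>-\<Omega>. ball y (1 / real (Suc m)))"
        then obtain y where y: "y \<notin> \<Omega>" "dist y (g *v x) < 1 / real (Suc m)" by auto
        define z where "z = transpose g *v y"
        have z: "g *v z = y" unfolding z_def by (rule rotation_inverse(5)[OF g])
        have "z \<notin> \<Omega>" using y(1) rotation_mem_iff[OF \<Omega>(2) g, of z] z by simp
        moreover have "dist z x = dist y (g *v x)"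
          unfolding z[symmetric] dist_norm by (simp add: matrix_vector_mult_diff_distrib[symmetric] rotation_norm[OF g])
        ultimately have "x \<in> (\<Union>y\<in>-\<Omega>. ball y (1 / real (Suc m)))" using y(2) by (intro UN_I[of z]) auto
        then show False using x unfolding K_def by blast
      qed
    qed
  qed
  ultimately show ?thesis by blast
qed

text \<open>Cutting $F$ off to a radial compact set preserves equivariance and makes it integrable. The resulting profiles are glued by using,
at radius $s$, the first set of the exhaustion that contains the sphere of radius $s$.\<close>

lemma radial_profile:
  fixes F :: "real^'n \<Rightarrow> real^'n"
  assumes n: "CARD('n) \<ge> 3" and \<Omega>: "open \<Omega>" "radially_symmetric \<Omega>"
    and Fb[measurable]: "F \<in> borel_measurable borel" and L2: "locally_L2 \<Omega> F"
    and eq: "rot_equivariant_ae F"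
  shows "\<exists>\<nu>. \<nu> \<in> borel_measurable borel \<and> (AE x in lborel. x \<in> \<Omega> \<longrightarrow> F x = \<nu> (norm x) *\<^sub>R x)"
proof -
  fix a :: 'n
  obtain K :: "nat \<Rightarrow> (real^'n) set" where K: "\<And>m. compact (K m)" "\<And>m. K m \<subseteq> \<Omega>" "\<Omega> \<subseteq> (\<Union>m. K m)" "\<And>m. radially_symmetric (K m)"
    using radial_exhaustion[OF \<Omega>] by blast
  have Km[measurable]: "K m \<in> sets borel" for m by (rule borel_compact[OF K(1)])
  have "\<exists>\<nu>. \<nu> \<in> borel_measurable borel \<and> (AE x in lborel. indicator (K m) x *\<^sub>R F x = \<nu> (norm x) *\<^sub>R x)" for m
  proof (rule radial_profile_integrable[OF n])
    show "(\<lambda>x. indicator (K m) x *\<^sub>R F x) \<in> borel_measurable borel" by measurable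
    show "integrable lborel (\<lambda>x. (indicator (K m) x *\<^sub>R F x) $ i)" for i
      using locally_L2_imp_L1(2)[OF L2 Fb K(1,2)] by simp
    show "rot_equivariant_ae (\<lambda>x. indicator (K m) x *\<^sub>R F x)"
      unfolding rot_equivariant_ae_def
    proof (intro allI impI)
      fix g :: "real^'n^'n" assume g: "rotation_matrix g"
      have "AE x in lborel. F (g *v x) = g *v F x" using eq g by (simp add: rot_equivariant_ae_def)
      then show "AE x in lborel. indicator (K m) (g *v x) *\<^sub>R F (g *v x) = g *v (indicator (K m) x *\<^sub>R F x)"
        by eventually_elim (simp add: rotation_mem_iff[OF K(4) g] indicator_def matrix_vector_mult_scaleR)
    qed
  qed
  then have "\<forall>m. \<exists>\<nu>. \<nu> \<in> borel_measurable borel \<and> (AE x in lborel. indicator (K m) x *\<^sub>R F x = \<nu> (norm x) *\<^sub>R x)" ..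
  from choice[OF this] obtain N where N': "\<forall>m. N m \<in> borel_measurable borel \<and> (AE x in lborel. indicator (K m) x *\<^sub>R F x = N m (norm x) *\<^sub>R x)" ..
  then have N: "\<And>m. N m \<in> borel_measurable borel" "\<And>m. AE x in lborel. indicator (K m) x *\<^sub>R F x = N m (norm x) *\<^sub>R x"
    by blast+
  define L where "L s = (LEAST m. s *\<^sub>R axis a 1 \<in> K m)" for s :: real
  define \<nu> where "\<nu> s = N (L s) s" for s
  have ax: "(\<lambda>s. s *\<^sub>R axis a 1 :: real^'n) \<in> borel_measurable borel"
    by (intro borel_measurable_continuous_onI continuous_intros)
  have "(\<lambda>s::real. s *\<^sub>R axis a 1 \<in> K m) \<in> measurable borel (count_space UNIV)" for m by (rule pred_sets2[OF Km ax])
  then have "L \<in> measurable borel (count_space UNIV)" unfolding L_def[abs_def] by (rule measurable_Least)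
  then have "\<nu> \<in> borel_measurable borel" unfolding \<nu>_def[abs_def]
    by (rule measurable_compose_countable[OF N(1)])
  moreover have "AE x in lborel. \<forall>m. indicator (K m) x *\<^sub>R F x = N m (norm x) *\<^sub>R x"
    using N(2) by (simp add: AE_all_countable)
  then have "AE x in lborel. x \<in> \<Omega> \<longrightarrow> F x = \<nu> (norm x) *\<^sub>R x"
  proof eventually_elim
    case (elim x)
    show ?case
    proof
      assume "x \<in> \<Omega>"
      then obtain m where m: "x \<in> K m" using K(3) by blast
      define y :: "real^'n" where "y = norm x *\<^sub>R axis a 1"
      have ny: "norm y = norm x" by (simp add: y_def norm_axis_1)
      have iff: "y \<in> K m \<longleftrightarrow> x \<in> K m" for m
        using radially_symmetric_norm[OF n K(4)] ny by metis
      have "y \<in> K (L (norm x))" unfolding L_def y_def[symmetric] by (rule LeastI) (use iff m in blast)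
      then have "x \<in> K (L (norm x))" using iff by blast
      then have "F x = indicator (K (L (norm x))) x *\<^sub>R F x" by simp
      also have "\<dots> = \<nu> (norm x) *\<^sub>R x" unfolding \<nu>_def by (rule elim[rule_format])
      finally show "F x = \<nu> (norm x) *\<^sub>R x" .
    qed
  qed
  ultimately show ?thesis by blast
qed

section \<open>Equivariant curls vanish\<close>

text \<open>The curl of the mollified field, with the derivatives placed on the mollifier: $\partial_j (\rho_\epsilon * F_k) - \partial_k (\rho_\epsilon * F_j)$.\<close>

definition mollified_curl :: "real \<Rightarrow> (real^'n \<Rightarrow> real^'n) \<Rightarrow> real^'n \<Rightarrow> real^'n^'n" where
  "mollified_curl \<epsilon> F x = (\<chi> j k. conv (\<lambda>z. grad (mollifier \<epsilon>) z $ j) (\<lambda>y. F y $ k) x - conv (\<lambda>z. grad (mollifier \<epsilon>) z $ k) (\<lambda>y. F y $ j) x)"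

lemma radially_symmetric_shrink:
  fixes \<Omega> :: "(real^'n) set"
  assumes \<Omega>: "radially_symmetric \<Omega>"
  shows "radially_symmetric (shrink \<Omega> \<epsilon>)"
  unfolding radially_symmetric_def
proof (intro allI impI ballI)
  fix g :: "real^'n^'n" and x assume g: "rotation_matrix g" and x: "x \<in> shrink \<Omega> \<epsilon>"
  then obtain \<delta> where \<delta>: "\<delta> > \<epsilon>" "ball x \<delta> \<subseteq> \<Omega>" by (auto simp: shrink_def)
  have "ball (g *v x) \<delta> \<subseteq> \<Omega>"
  proof
    fix y assume y: "y \<in> ball (g *v x) \<delta>"
    define z where "z = transpose g *v y"
    have z: "g *v z = y" unfolding z_def by (rule rotation_inverse(5)[OF g])
    have "dist x z = dist (g *v x) y"
      unfolding z[symmetric] dist_norm by (simp add: matrix_vector_mult_diff_distrib[symmetric] rotation_norm[OF g])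
    then have "z \<in> \<Omega>" using y \<delta>(2) by auto
    then show "y \<in> \<Omega>" using rotation_mem_iff[OF \<Omega> g, of z] z by simp
  qed
  then show "g *v x \<in> shrink \<Omega> \<epsilon>" using \<delta>(1) by (auto simp: shrink_def)
qed

lemma dist_curl_borel_version:
  assumes \<Omega>: "open \<Omega>" and A: "A \<in> L2_loc \<Omega>" and F: "borel_version \<Omega> A F" and \<psi>: "C1 \<psi>"
  shows "dist_curl \<Omega> A \<psi> $ j $ k = (\<integral>x. grad \<psi> x $ k * F x $ j \<partial>lborel) - (\<integral>x. grad \<psi> x $ j * F x $ k \<partial>lborel)"
proof -
  have A': "A \<in> borel_measurable (lebesgue_on \<Omega>)" using A by (simp add: L2_loc_def)
  have m: "(\<lambda>x. grad \<psi> x $ j) \<in> borel_measurable borel" for j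
    by (rule borel_measurable_continuous_onI[OF C1_grad_continuous[OF \<psi>]])
  show ?thesis
    by (simp add: dist_curl_def dist_partial_def partial_deriv_grad borel_version_regular_dist[OF \<Omega> A' F m])
qed

text \<open>The derivative of $y \mapsto \rho_\epsilon(x - y)$ produces a sign that cancels the sign in the definition of the distributional derivative.\<close>

lemma dist_curl_mollifier:
  assumes \<epsilon>: "\<epsilon> > 0" and \<Omega>: "open \<Omega>" and A: "A \<in> L2_loc \<Omega>" and F: "borel_version \<Omega> A F"
  shows "dist_curl \<Omega> A (\<lambda>y. mollifier \<epsilon> (x - y)) = mollified_curl \<epsilon> F x"
proof -
  have s: "C1 (\<lambda>y. mollifier \<epsilon> (x + (-1) *\<^sub>R y))" "grad (\<lambda>y. mollifier \<epsilon> (x + (-1) *\<^sub>R y)) = (\<lambda>y. (-1) *\<^sub>R grad (mollifier \<epsilon>) (x + (-1) *\<^sub>R y))"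
    by (rule C1_compose_affine[OF mollifier_C1[OF \<epsilon>]]; simp)+
  then have s': "C1 (\<lambda>y. mollifier \<epsilon> (x - y))" "grad (\<lambda>y. mollifier \<epsilon> (x - y)) = (\<lambda>y. - grad (mollifier \<epsilon>) (x - y))"
    by simp_all
  have "dist_curl \<Omega> A (\<lambda>y. mollifier \<epsilon> (x - y)) $ j $ k = mollified_curl \<epsilon> F x $ j $ k" for j k
    by (subst dist_curl_borel_version[OF \<Omega> A F s'(1)]) (simp add: s'(2) mollified_curl_def conv_def)
  then show ?thesis by (simp add: vec_eq_iff)
qed

text \<open>The mollifier centred at $x$, composed with $g^{-1}$, is the mollifier centred at $g x$, because it is radial. Hence the equivariance of the
distribution $B$ becomes a pointwise identity.\<close>

lemma mollified_curl_equivariant: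
  fixes A :: "real^'n \<Rightarrow> real^'n"
  assumes \<epsilon>: "\<epsilon> > 0" and \<Omega>: "open \<Omega>" "radially_symmetric \<Omega>" and A: "A \<in> L2_loc \<Omega>" and F: "borel_version \<Omega> A F"
    and B: "dist_eq \<Omega> B (dist_curl \<Omega> A)"
    and eq: "\<And>g. rotation_matrix g \<Longrightarrow> dist_eq \<Omega> (dist_comp B g) (dist_conj g B)"
    and g: "rotation_matrix g" and x: "x \<in> shrink \<Omega> \<epsilon>"
  shows "mollified_curl \<epsilon> F (g *v x) = g ** mollified_curl \<epsilon> F x ** transpose g"
proof -
  have t: "(\<lambda>y. mollifier \<epsilon> (z - y)) \<in> test_functions \<Omega>" if "z \<in> shrink \<Omega> \<epsilon>" for z
    by (rule mollifier_test_function[OF \<epsilon> shrink_cball[OF that]])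
  have BM: "B (\<lambda>y. mollifier \<epsilon> (z - y)) = mollified_curl \<epsilon> F z" if "z \<in> shrink \<Omega> \<epsilon>" for z
    using B t[OF that] dist_curl_mollifier[OF \<epsilon> \<Omega>(1) A F, of z] by (simp add: dist_eq_def)
  have gx: "g *v x \<in> shrink \<Omega> \<epsilon>" using radially_symmetric_shrink[OF \<Omega>(2)] g x by (auto simp: radially_symmetric_def)
  have "mollifier \<epsilon> (x - matrix_inv g *v y) = mollifier \<epsilon> (g *v x - y)" for y
  proof (rule mollifier_norm[OF \<epsilon>])
    have "norm (x - transpose g *v y) = norm (g *v (x - transpose g *v y))" by (simp only: rotation_norm[OF g])
    also have "\<dots> = norm (g *v x - y)" by (simp only: matrix_vector_mult_diff_distrib rotation_inverse(5)[OF g])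
    finally show "norm (x - matrix_inv g *v y) = norm (g *v x - y)" by (simp only: rotation_inverse(3)[OF g])
  qed
  then have "B (\<lambda>y. mollifier \<epsilon> (g *v x - y)) = dist_comp B g (\<lambda>y. mollifier \<epsilon> (x - y))"
    by (simp add: dist_comp_def)
  also have "\<dots> = dist_conj g B (\<lambda>y. mollifier \<epsilon> (x - y))"
    using eq[OF g] t[OF x] by (simp add: dist_eq_def)
  also have "\<dots> = g ** B (\<lambda>y. mollifier \<epsilon> (x - y)) ** transpose g"
    by (simp only: dist_conj_def rotation_inverse(3)[OF g])
  finally show ?thesis by (simp only: BM[OF x] BM[OF gx])
qed

lemma mollified_curl_skew: "mollified_curl \<epsilon> F x $ j $ k = - mollified_curl \<epsilon> F x $ k $ j"
  by (simp add: mollified_curl_def)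

text \<open>Pairing the mollified curl with $\psi$ is pairing the curl with the mollified $\psi$.\<close>

lemma integral_mollified_curl:
  fixes F :: "real^'n \<Rightarrow> real^'n"
  assumes \<epsilon>: "\<epsilon> > 0" and F[measurable]: "F \<in> borel_measurable borel" and L2: "locally_L2 \<Omega> F"
    and \<psi>: "C1 \<psi>" and K: "compact K" "K \<subseteq> shrink \<Omega> \<epsilon>" and v: "vanishes_outside K \<psi>"
  shows "integrable lborel (\<lambda>x. \<psi> x * mollified_curl \<epsilon> F x $ j $ k)"
    "(\<integral>x. \<psi> x * mollified_curl \<epsilon> F x $ j $ k \<partial>lborel) =
      (\<integral>y. conv (mollifier \<epsilon>) (\<lambda>x. grad \<psi> x $ k) y * F y $ j \<partial>lborel) - (\<integral>y. conv (mollifier \<epsilon>) (\<lambda>x. grad \<psi> x $ j) y * F y $ k \<partial>lborel)"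
    "continuous_on K (\<lambda>x. mollified_curl \<epsilon> F x $ j $ k)"
proof -
  let ?m = "mollifier \<epsilon> :: real^'n \<Rightarrow> real"
  note m = mollifier_C1[OF \<epsilon>, where 'n='n]
  have Fi: "integrable lborel (\<lambda>x. indicator (thick K \<epsilon>) x * F x $ i)" for i
    by (rule locally_L2_imp_L1(2)[OF L2 F compact_thick[OF K(1)] shrink_thick[OF K(2)]])
  have Fm: "(\<lambda>x. F x $ i) \<in> borel_measurable borel" for i by measurable
  have mv: "vanishes_outside (cball 0 \<epsilon>) ?m" using mollifier_vanishes[OF \<epsilon>, where 'n='n] by (auto simp: vanishes_outside_def)
  have gv: "vanishes_outside (cball 0 \<epsilon>) (\<lambda>z. grad ?m z $ j)" for j
    using grad_vanishes_outside[OF m closed_cball mv] by (simp add: vanishes_outside_def)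
  have gc: "continuous_on UNIV (\<lambda>z. grad ?m z $ j)" for j by (rule C1_grad_continuous[OF m])
  have cc: "continuous_on K (conv (\<lambda>z. grad ?m z $ j) (\<lambda>y. F y $ i))" for i j
  proof (rule conv_continuous_on[OF gc gv Fi Fm])
    fix x assume "x \<in> K"
    then show "cball x \<epsilon> \<subseteq> thick K \<epsilon>" by (auto intro!: thick_mem[of x] simp: dist_norm)
  qed
  have ii: "integrable lborel (\<lambda>x. \<psi> x * conv (\<lambda>z. grad ?m z $ j) (\<lambda>y. F y $ i) x)" for i j
  proof -
    have "integrable lborel (\<lambda>x. indicator K x *\<^sub>R (\<psi> x * conv (\<lambda>z. grad ?m z $ j) (\<lambda>y. F y $ i) x))"
      by (rule borel_integrable_compact[OF K(1)]) 
        (intro continuous_on_mult cc continuous_on_subset[OF C1_continuous[OF \<psi>]] subset_UNIV)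
    also have "(\<lambda>x. indicator K x *\<^sub>R (\<psi> x * conv (\<lambda>z. grad ?m z $ j) (\<lambda>y. F y $ i) x)) = (\<lambda>x. \<psi> x * conv (\<lambda>z. grad ?m z $ j) (\<lambda>y. F y $ i) x)"
      using v by (auto simp: vanishes_outside_def fun_eq_iff split: split_indicator)
    finally show ?thesis .
  qed
  show "integrable lborel (\<lambda>x. \<psi> x * mollified_curl \<epsilon> F x $ j $ k)"
    using ii by (simp add: mollified_curl_def right_diff_distrib)
  show "continuous_on K (\<lambda>x. mollified_curl \<epsilon> F x $ j $ k)"
    unfolding mollified_curl_def by (simp add: continuous_on_diff cc)
  have "(\<integral>x. \<psi> x * mollified_curl \<epsilon> F x $ j $ k \<partial>lborel) = 
     (\<integral>x. \<psi> x * conv (\<lambda>z. grad ?m z $ j) (\<lambda>y. F y $ k) x \<partial>lborel) - (\<integral>x. \<psi> x * conv (\<lambda>z. grad ?m z $ k) (\<lambda>y. F y $ j) x \<partial>lborel)"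
    using ii by (simp add: mollified_curl_def right_diff_distrib Bochner_Integration.integral_diff)
  then show "(\<integral>x. \<psi> x * mollified_curl \<epsilon> F x $ j $ k \<partial>lborel) =
      (\<integral>y. conv (mollifier \<epsilon>) (\<lambda>x. grad \<psi> x $ k) y * F y $ j \<partial>lborel) - (\<integral>y. conv (mollifier \<epsilon>) (\<lambda>x. grad \<psi> x $ j) y * F y $ k \<partial>lborel)"
    by (simp add: integral_conv_grad_mollifier[OF \<epsilon> \<psi> K(1) v Fi Fm])
qed

text \<open>For suitable $\alpha$ and $\beta$ this function is supported in an annulus; its gradient is radial.\<close>

lemma radial_bump_C1:
  "C1 (\<lambda>x::real^'n. flat 1 ((norm x)\<^sup>2 - \<alpha>) * flat 1 (\<beta> - (norm x)\<^sup>2))" (is ?C)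
  "\<exists>\<mu>. grad (\<lambda>x::real^'n. flat 1 ((norm x)\<^sup>2 - \<alpha>) * flat 1 (\<beta> - (norm x)\<^sup>2)) = (\<lambda>x. \<mu> x *\<^sub>R x)" (is ?G)
proof -
  let ?f' = "flat ([:0, 0, 1:] * (1 - pderiv 1))"
  define h where "h t = flat 1 (t - \<alpha>) * flat 1 (\<beta> - t)" for t
  define h' where "h' t = ?f' (t - \<alpha>) * flat 1 (\<beta> - t) + - ?f' (\<beta> - t) * flat 1 (t - \<alpha>)" for t
  have d: "(h has_real_derivative h' t) (at t)" for t
    unfolding h_def h'_def
  proof (rule DERIV_mult)
    have "((\<lambda>t. t - \<alpha>) has_real_derivative 1) (at t)" by (auto intro!: derivative_eq_intros)
    from DERIV_chain2[OF flat_has_derivative this, of 1]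
    show "((\<lambda>t. flat 1 (t - \<alpha>)) has_real_derivative ?f' (t - \<alpha>)) (at t)" by simp
    have "((\<lambda>t. \<beta> - t) has_real_derivative -1) (at t)" by (auto intro!: derivative_eq_intros)
    from DERIV_chain2[OF flat_has_derivative this, of 1]
    show "((\<lambda>t. flat 1 (\<beta> - t)) has_real_derivative - ?f' (\<beta> - t)) (at t)" by simp
  qed
  have c: "continuous_on UNIV h'"
    unfolding h'_def
    by (intro continuous_on_add continuous_on_mult continuous_on_minus continuous_on_compose2[OF flat_continuous] 
        continuous_on_diff continuous_on_id continuous_on_const subset_UNIV)
  show ?C using C1_radial(1)[OF d c] by (simp add: h_def)
  show ?G using C1_radial(2)[OF d c] by (auto simp: h_def)
qed

lemma flat_1_pos: "flat 1 t > 0 \<longleftrightarrow> t > 0" "flat 1 t \<ge> 0" "t \<le> 0 \<Longrightarrow> flat 1 t = 0"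
  by (auto simp: flat_def)

text \<open>With $\psi_i = x_i \eta$ the integral is the pairing of the mollified field with the curl of the radial field $\eta(x) x$. As the gradient
of $\eta$ is radial, $\partial_j \psi_i = x_i x_j \mu = \partial_i \psi_j$ for $i \ne j$, so that this curl vanishes. No flux leaves through spheres.\<close>

lemma mollified_flux_integral_zero:
  fixes F :: "real^'n \<Rightarrow> real^'n"
  assumes \<epsilon>: "\<epsilon> > 0" and F: "F \<in> borel_measurable borel" and L2: "locally_L2 \<Omega> F"
    and d: "a \<noteq> b" "a \<noteq> c" "b \<noteq> c"
    and \<eta>: "C1 \<eta>" "grad \<eta> = (\<lambda>x. \<mu> x *\<^sub>R x)" and K: "compact K" "K \<subseteq> shrink \<Omega> \<epsilon>" and v: "vanishes_outside K \<eta>"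
  shows "integrable lborel (\<lambda>x. \<eta> x * flux a b c (mollified_curl \<epsilon> F) x)"
    "(\<integral>x. \<eta> x * flux a b c (mollified_curl \<epsilon> F) x \<partial>lborel) = 0"
proof -
  define \<psi> where "\<psi> i x = x $ i * \<eta> x" for i and x :: "real^'n"
  have \<psi>: "C1 (\<psi> i)" for i unfolding \<psi>_def[abs_def] by (rule C1_mult(1)[OF C1_coord(1) \<eta>(1)])
  have g: "grad (\<psi> i) x $ j = x $ i * x $ j * \<mu> x" if "i \<noteq> j" for i j x
    using that unfolding \<psi>_def[abs_def] 
    by (simp add: C1_mult(2)[OF C1_coord(1) \<eta>(1)] C1_coord(2) \<eta>(2) axis_def)
  have \<psi>v: "vanishes_outside K (\<psi> i)" for i using v by (simp add: vanishes_outside_def \<psi>_def)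
  have sym: "(\<lambda>x. grad (\<psi> i) x $ j) = (\<lambda>x. grad (\<psi> j) x $ i)" if "i \<noteq> j" for i j
    using that by (auto simp: g)
  note I = integral_mollified_curl[OF \<epsilon> F L2 \<psi> K \<psi>v]
  have eq: "\<eta> x * flux a b c (mollified_curl \<epsilon> F) x = \<psi> a x * mollified_curl \<epsilon> F x $ b $ c
     + \<psi> b x * mollified_curl \<epsilon> F x $ c $ a + \<psi> c x * mollified_curl \<epsilon> F x $ a $ b" for x
    by (simp add: flux_def \<psi>_def algebra_simps)
  show "integrable lborel (\<lambda>x. \<eta> x * flux a b c (mollified_curl \<epsilon> F) x)"
    unfolding eq by (intro Bochner_Integration.integrable_add I(1))
  have "(\<integral>x. \<eta> x * flux a b c (mollified_curl \<epsilon> F) x \<partial>lborel) = 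
     (\<integral>x. \<psi> a x * mollified_curl \<epsilon> F x $ b $ c \<partial>lborel) + (\<integral>x. \<psi> b x * mollified_curl \<epsilon> F x $ c $ a \<partial>lborel)
     + (\<integral>x. \<psi> c x * mollified_curl \<epsilon> F x $ a $ b \<partial>lborel)"
    unfolding eq by (simp add: I(1) Bochner_Integration.integral_add)
  also have "\<dots> = 0"
    unfolding I(2) using sym[OF d(1)] sym[OF d(2)] sym[OF d(3)] by simp
  finally show "(\<integral>x. \<eta> x * flux a b c (mollified_curl \<epsilon> F) x \<partial>lborel) = 0" .
qed

text \<open>If a continuous function that is constant on spheres were positive at $x_0$, it would be positive on a thin annulus
around the sphere through $x_0$, and its integral against a radial bump supported in that annulus would be positive.\<close>

lemma radial_continuous_zero:
  fixes S :: "real^'n \<Rightarrow> real"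
  assumes n: "CARD('n) \<ge> 3" and W: "open W" "radially_symmetric W" and c: "continuous_on W S"
    and rad: "\<And>x y. x \<in> W \<Longrightarrow> y \<in> W \<Longrightarrow> norm x = norm y \<Longrightarrow> S x = S y"
    and int: "\<And>\<eta> K. C1 \<eta> \<Longrightarrow> \<exists>\<mu>. grad \<eta> = (\<lambda>x. \<mu> x *\<^sub>R x) \<Longrightarrow> compact K \<Longrightarrow> K \<subseteq> W \<Longrightarrow> vanishes_outside K \<eta> \<Longrightarrow>
      integrable lborel (\<lambda>x. \<eta> x * S x) \<and> (\<integral>x. \<eta> x * S x \<partial>lborel) = 0"
    and x0: "x0 \<in> W" "x0 \<noteq> 0"
  shows "S x0 \<le> 0"
proof (rule ccontr)
  assume "\<not> S x0 \<le> 0"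
  then have pos: "S x0 > 0" by simp
  define r where "r = norm x0"
  have r: "r > 0" using x0 by (simp add: r_def)
  obtain e where e: "e > 0" "ball x0 e \<subseteq> W" using W(1) x0(1) openE by blast
  have "isCont S x0" using c W(1) x0(1) by (simp add: continuous_on_eq_continuous_at)
  then have "eventually (\<lambda>x. S x > 0) (nhds x0)" using pos 
    by (auto simp: isCont_def tendsto_at_iff_tendsto_nhds dest: order_tendstoD(1))
  then obtain e' where e': "e' > 0" "\<And>x. dist x x0 < e' \<Longrightarrow> S x > 0" by (auto simp: eventually_nhds_metric)
  define \<delta> where "\<delta> = min (min e e') r / 2"
  have \<delta>: "\<delta> > 0" "\<delta> < e" "\<delta> < e'" "\<delta> < r" using e(1) e'(1) r by (auto simp: \<delta>_def)
  have near: "y \<in> W \<and> S y > 0" if y: "\<bar>norm y - r\<bar> \<le> \<delta>" for y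
  proof -
    \<comment> \<open>the point on the ray through $x_0$ with the norm of $y$: it is near $x_0$, and $S$ has the same value there\<close>
    define z where "z = (norm y / r) *\<^sub>R x0"
    have "z - x0 = ((norm y - r) / r) *\<^sub>R x0" using r by (simp add: z_def diff_divide_distrib scaleR_diff_left)
    then have "dist z x0 = \<bar>norm y - r\<bar>" using r by (simp add: dist_norm r_def[symmetric])
    then have z: "dist z x0 \<le> \<delta>" using y by simp
    then have zW: "z \<in> W" using \<delta>(2) e(2) by (auto simp: dist_commute subset_iff)
    have nz: "norm y = norm z" using r by (simp add: z_def r_def[symmetric])
    have yW: "y \<in> W" using radially_symmetric_norm[OF n W(2) zW nz] .
    have "S z > 0" using e'(2)[of z] z \<delta>(3) by simp
    then show ?thesis using rad[OF yW zW nz] yW by simp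
  qed
  define \<eta> where "\<eta> x = flat 1 ((norm x)\<^sup>2 - (r - \<delta>)\<^sup>2) * flat 1 ((r + \<delta>)\<^sup>2 - (norm x)\<^sup>2)" for x :: "real^'n"
  define K where "K = cball (0::real^'n) (r + \<delta>) - ball 0 (r - \<delta>)"
  have K: "compact K" unfolding K_def by (intro compact_diff) auto
  have KW: "K \<subseteq> W" using near by (force simp: K_def)
  have lt: "\<eta> x > 0" if "r - \<delta> < norm x" "norm x < r + \<delta>" for x
    using that \<delta> by (auto simp: \<eta>_def flat_1_pos intro!: mult_pos_pos power_strict_mono)
  have ge: "\<eta> x \<ge> 0" for x by (simp add: \<eta>_def flat_1_pos)
  have v: "vanishes_outside K \<eta>"
    unfolding vanishes_outside_def
  proof (intro allI impI)
    fix x assume "x \<notin> K"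
    then consider "norm x > r + \<delta>" | "norm x < r - \<delta>" by (force simp: K_def)
    then show "\<eta> x = 0"
    proof cases
      case 1
      then have "(r + \<delta>)\<^sup>2 - (norm x)\<^sup>2 \<le> 0" using \<delta> r by (simp add: power_mono)
      then show ?thesis by (simp add: \<eta>_def flat_1_pos(3))
    next
      case 2
      then have "(norm x)\<^sup>2 - (r - \<delta>)\<^sup>2 \<le> 0" using \<delta> r by (simp add: power_mono)
      then show ?thesis by (simp add: \<eta>_def flat_1_pos(3))
    qed
  qed
  have C: "C1 \<eta>" "\<exists>\<mu>. grad \<eta> = (\<lambda>x. \<mu> x *\<^sub>R x)"
    unfolding \<eta>_def[abs_def] by (rule radial_bump_C1)+
  from int[OF C K KW v] have i: "integrable lborel (\<lambda>x. \<eta> x * S x)" and z: "(\<integral>x. \<eta> x * S x \<partial>lborel) = 0" by auto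
  have nn: "\<eta> x * S x \<ge> 0" for x
  proof (cases "x \<in> K")
    case True
    then have "S x > 0" using near by (force simp: K_def)
    then show ?thesis using ge[of x] by simp
  qed (use v in \<open>simp add: vanishes_outside_def\<close>)
  have "AE x in lborel. \<eta> x * S x = 0"
    using integral_nonneg_eq_0_iff_AE[OF i] nn z by auto
  then have "AE x in lborel. x \<notin> ball x0 \<delta>"
  proof eventually_elim
    case (elim x)
    show ?case
    proof
      assume "x \<in> ball x0 \<delta>"
      then have "\<bar>norm x - r\<bar> < \<delta>"
        using norm_triangle_ineq3[of x x0] by (simp add: r_def dist_norm norm_minus_commute)
      moreover from this have "\<eta> x > 0" by (intro lt) linarith+
      ultimately show False using near[of x] elim by auto
    qed
  qed
  then have "emeasure lborel (ball x0 \<delta>) = 0"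
    by (subst (asm) AE_iff_measurable[OF _ refl]) (auto simp: ball_def)
  then show False using \<delta>(1) by (simp add: emeasure_ball unit_ball_vol_pos[THEN less_imp_neq, THEN not_sym])
qed

text \<open>In dimension at least four this is linear algebra. In dimension three the flux density is continuous, constant on spheres, and
orthogonal to all radial test functions; the same holds for its negative.\<close>

lemma mollified_curl_zero:
  fixes A F :: "real^'n \<Rightarrow> real^'n"
  assumes n: "CARD('n) \<ge> 3"
    and \<epsilon>: "\<epsilon> > 0" and \<Omega>: "open \<Omega>" "radially_symmetric \<Omega>" and A: "A \<in> L2_loc \<Omega>" and F: "borel_version \<Omega> A F"
    and B: "dist_eq \<Omega> B (dist_curl \<Omega> A)"
    and eq: "\<And>g. rotation_matrix g \<Longrightarrow> dist_eq \<Omega> (dist_comp B g) (dist_conj g B)"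
    and x: "x \<in> shrink \<Omega> \<epsilon>"
  shows "mollified_curl \<epsilon> F x = 0"
proof (cases "CARD('n) \<ge> 4")
  case True
  show ?thesis
    by (rule equivariant_skew_zero[OF True radially_symmetric_shrink[OF \<Omega>(2)] 
        mollified_curl_equivariant[OF \<epsilon> \<Omega> A F B eq] _ x]) (simp_all add: mollified_curl_def)
next
  case False
  let ?W = "shrink \<Omega> \<epsilon>" and ?C = "mollified_curl \<epsilon> F"
  note W = open_shrink[of \<Omega> \<epsilon>] radially_symmetric_shrink[OF \<Omega>(2), of \<epsilon>]
  have "card (UNIV :: 'n set) = 3" using n False by simp
  then obtain a b c :: 'n where U: "UNIV = {a, b, c}" and d: "a \<noteq> b" "a \<noteq> c" "b \<noteq> c"
    by (auto simp: card_3_iff)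
  have Fm: "F \<in> borel_measurable borel" using F by (simp add: borel_version_def)
  have L2: "locally_L2 \<Omega> F" by (rule borel_version_L2[OF \<Omega>(1) A F])
  have equi: "?C (g *v x) = g ** ?C x ** transpose g" if "rotation_matrix g" "x \<in> ?W" for g x
    by (rule mollified_curl_equivariant[OF \<epsilon> \<Omega> A F B eq that])
  have fl1: "flux a b c ?C x = norm x * ?C (norm x *\<^sub>R axis a 1) $ b $ c" if "x \<in> ?W" for x
    by (rule equivariant_skew_flux(1)[OF U d W(2) _ _ that]) (erule (1) equi, rule mollified_curl_skew)
  have fl2: "?C x = 0" if "x \<in> ?W" "flux a b c ?C x = 0" for x
    by (rule equivariant_skew_flux(2)[OF U d W(2) _ _ that]) (erule (1) equi, rule mollified_curl_skew)
  have rad: "flux a b c ?C x = flux a b c ?C y" if "x \<in> ?W" "y \<in> ?W" "norm x = norm y" for x y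
    using fl1[OF that(1)] fl1[OF that(2)] that(3) by simp
  have cont: "continuous_on ?W (flux a b c ?C)"
  proof -
    have "isCont (\<lambda>x. ?C x $ j $ k) x" if xW: "x \<in> ?W" for j k x
    proof -
      obtain e where e: "e > 0" "cball x e \<subseteq> ?W" using W(1) xW by (meson open_contains_cball)
      have v0: "vanishes_outside (cball x e) (\<lambda>x. 0::real)" by (simp add: vanishes_outside_def)
      have c0: "C1 (\<lambda>x::real^'n. 0)" by (rule C1I(1)[of _ "\<lambda>x. 0"]) auto
      have "continuous_on (cball x e) (\<lambda>x. ?C x $ j $ k)"
        by (rule integral_mollified_curl(3)[OF \<epsilon> Fm L2 c0 compact_cball e(2) v0])
      then have "continuous_on (ball x e) (\<lambda>x. ?C x $ j $ k)" by (rule continuous_on_subset) auto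
      then show ?thesis using e(1) by (simp add: continuous_on_eq_continuous_at)
    qed
    then have cc: "continuous_on ?W (\<lambda>x. ?C x $ j $ k)" for j k by (simp add: continuous_at_imp_continuous_on)
    show ?thesis unfolding flux_def
      by (intro continuous_on_add continuous_on_mult cc continuous_on_component[OF continuous_on_id])
  qed
  have "flux a b c ?C x = 0"
  proof (cases "x = 0")
    case True
    then show ?thesis by (simp add: flux_def)
  next
    case False
    have int: "integrable lborel (\<lambda>x. \<eta> x * flux a b c ?C x) \<and> (\<integral>x. \<eta> x * flux a b c ?C x \<partial>lborel) = 0"
      if \<eta>: "C1 \<eta>" "\<exists>\<mu>. grad \<eta> = (\<lambda>x. \<mu> x *\<^sub>R x)" and K: "compact K" "K \<subseteq> ?W" "vanishes_outside K \<eta>" for \<eta> K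
    proof -
      obtain \<mu> where \<mu>: "grad \<eta> = (\<lambda>x. \<mu> x *\<^sub>R x)" using \<eta>(2) by (elim exE)
      show ?thesis using mollified_flux_integral_zero[OF \<epsilon> Fm L2 d \<eta>(1) \<mu> K] by (intro conjI)
    qed
    have "flux a b c ?C x \<le> 0"
      by (rule radial_continuous_zero[OF n W cont _ _ x False]) (rule rad, assumption+, rule int)
    moreover have "- flux a b c ?C x \<le> 0"
    proof (rule radial_continuous_zero[OF n W continuous_on_minus[OF cont] _ _ x False])
      fix \<eta> K assume a: "C1 \<eta>" "\<exists>\<mu>. grad \<eta> = (\<lambda>x. \<mu> x *\<^sub>R x)" "compact K" "K \<subseteq> ?W" "vanishes_outside K \<eta>"
      show "integrable lborel (\<lambda>x. \<eta> x * - flux a b c ?C x) \<and> (\<integral>x. \<eta> x * - flux a b c ?C x \<partial>lborel) = 0"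
        using int[OF a] by simp
    next
      fix x y assume "x \<in> ?W" "y \<in> ?W" "norm x = norm y"
      from rad[OF this] show "- flux a b c ?C x = - flux a b c ?C y" by simp
    qed
    ultimately show ?thesis by simp
  qed
  then show ?thesis by (rule fl2[OF x])
qed

lemma real_zeroI: "t = 0" if "\<And>e. e > 0 \<Longrightarrow> \<bar>t\<bar> \<le> e" for t :: real
  using that[of "\<bar>t\<bar> / 2"] by (cases "t = 0") auto

text \<open>The mollified curl vanishes on the support of the test function for all small $\epsilon$; its pairing with the test function converges to $B(\psi)$.\<close>

theorem equivariant_curl_zero:
  fixes A :: "real^'n \<Rightarrow> real^'n"
  assumes n: "CARD('n) \<ge> 3" and \<Omega>: "open \<Omega>" "radially_symmetric \<Omega>" and A: "A \<in> L2_loc \<Omega>"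
    and B: "dist_eq \<Omega> B (dist_curl \<Omega> A)"
    and eq: "\<And>g. rotation_matrix g \<Longrightarrow> dist_eq \<Omega> (dist_comp B g) (dist_conj g B)"
  shows "dist_eq \<Omega> B (\<lambda>\<psi>. 0)"
  unfolding dist_eq_def
proof
  fix \<psi> assume \<psi>t: "\<psi> \<in> test_functions \<Omega>"
  then obtain K where K: "compact K" "K \<subseteq> \<Omega>" "vanishes_outside K \<psi>" and \<psi>: "C1 \<psi>" by (rule test_function_C1)
  obtain F where F: "borel_version \<Omega> A F" using borel_version_exists[OF \<Omega>(1)] A by (auto simp: L2_loc_def)
  have Fm: "F \<in> borel_measurable borel" using F by (simp add: borel_version_def)
  have Fi: "(\<lambda>x. F x $ i) \<in> borel_measurable borel" for i using Fm by measurable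
  have L2: "locally_L2 \<Omega> F" by (rule borel_version_L2[OF \<Omega>(1) A F])
  obtain \<epsilon>0 where \<epsilon>0: "\<epsilon>0 > 0" "\<And>\<epsilon>. \<epsilon> < \<epsilon>0 \<Longrightarrow> K \<subseteq> shrink \<Omega> \<epsilon>" using compact_subset_shrink[OF \<Omega>(1) K(1,2)] by blast
  define \<epsilon>1 where "\<epsilon>1 = \<epsilon>0 / 2"
  have \<epsilon>1: "\<epsilon>1 > 0" "K \<subseteq> shrink \<Omega> \<epsilon>1" using \<epsilon>0 by (auto simp: \<epsilon>1_def)
  have Fl: "integrable lborel (\<lambda>x. indicator (thick K \<epsilon>1) x * F x $ i)" for i
    by (rule locally_L2_imp_L1(2)[OF L2 Fm compact_thick[OF K(1)] shrink_thick[OF \<epsilon>1(2)]])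
  have gv: "vanishes_outside K (\<lambda>x. grad \<psi> x $ j)" for j
    using grad_vanishes_outside[OF \<psi> compact_imp_closed[OF K(1)] K(3)] by (simp add: vanishes_outside_def)
  have "B \<psi> $ j $ k = 0" for j k
  proof -
    let ?L = "\<lambda>j k. (\<integral>x. grad \<psi> x $ k * F x $ j \<partial>lborel)"
    have B1: "B \<psi> $ j $ k = ?L j k - ?L k j"
      using B \<psi>t dist_curl_borel_version[OF \<Omega>(1) A F \<psi>] by (simp add: dist_eq_def)
    have small: "\<bar>?L j k - ?L k j\<bar> \<le> e" if e: "e > 0" for e
    proof -
      have e2: "e / 2 > 0" using e by simp
      obtain \<delta>1 where \<delta>1: "\<delta>1 > 0" "\<forall>\<epsilon>. 0 < \<epsilon> \<longrightarrow> \<epsilon> < \<delta>1 \<longrightarrow>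
          \<bar>(\<integral>y. conv (mollifier \<epsilon>) (\<lambda>x. grad \<psi> x $ k) y * F y $ j \<partial>lborel) - ?L j k\<bar> \<le> e / 2"
        using mollified_pairing_limit[OF C1_grad_continuous[OF \<psi>, of k] K(1) gv[of k] \<epsilon>1(1) Fl[of j] Fi[of j] e2] by (elim exE conjE)
      obtain \<delta>2 where \<delta>2: "\<delta>2 > 0" "\<forall>\<epsilon>. 0 < \<epsilon> \<longrightarrow> \<epsilon> < \<delta>2 \<longrightarrow>
          \<bar>(\<integral>y. conv (mollifier \<epsilon>) (\<lambda>x. grad \<psi> x $ j) y * F y $ k \<partial>lborel) - ?L k j\<bar> \<le> e / 2"
        using mollified_pairing_limit[OF C1_grad_continuous[OF \<psi>, of j] K(1) gv[of j] \<epsilon>1(1) Fl[of k] Fi[of k] e2] by (elim exE conjE)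
      define \<epsilon> where "\<epsilon> = min \<epsilon>1 (min \<delta>1 \<delta>2) / 2"
      have \<epsilon>: "0 < \<epsilon>" "\<epsilon> < \<epsilon>1" "\<epsilon> < \<delta>1" "\<epsilon> < \<delta>2" using \<epsilon>1(1) \<delta>1(1) \<delta>2(1) by (auto simp: \<epsilon>_def)
      have KS: "K \<subseteq> shrink \<Omega> \<epsilon>" using \<epsilon>0 \<epsilon>(2) by (auto simp: \<epsilon>1_def)
      have "\<psi> x * mollified_curl \<epsilon> F x $ j $ k = 0" for x
      proof (cases "x \<in> K")
        case True
        then have "mollified_curl \<epsilon> F x = 0" using KS by (intro mollified_curl_zero[OF n \<epsilon>(1) \<Omega> A F B eq]) auto
        then show ?thesis by simp
      qed (use K(3) in \<open>simp add: vanishes_outside_def\<close>)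
      then have "(\<integral>x. \<psi> x * mollified_curl \<epsilon> F x $ j $ k \<partial>lborel) = (\<integral>(x::real^'n). 0 \<partial>lborel)"
        by (intro Bochner_Integration.integral_cong refl)
      then have "(\<integral>x. \<psi> x * mollified_curl \<epsilon> F x $ j $ k \<partial>lborel) = 0" by (simp only: Bochner_Integration.integral_zero)
      then show ?thesis
        using integral_mollified_curl(2)[OF \<epsilon>(1) Fm L2 \<psi> K(1) KS K(3), of j k] \<delta>1(2)[rule_format, OF \<epsilon>(1,3)] \<delta>2(2)[rule_format, OF \<epsilon>(1,4)]
        by linarith
    qed
    have "?L j k - ?L k j = 0" by (rule real_zeroI) (rule small)
    then show ?thesis unfolding B1 .
  qed
  then show "B \<psi> = 0" by (simp add: vec_eq_iff)
qed

section \<open>The radial potential\<close>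

definition primitive_from :: "real \<Rightarrow> (real \<Rightarrow> real) \<Rightarrow> real \<Rightarrow> real" where
  "primitive_from a f r = (\<integral>s. indicator {a..r} s * f s \<partial>lborel)"

lemma primitive_from_measurable:
  assumes [measurable]: "f \<in> borel_measurable borel"
  shows "primitive_from a f \<in> borel_measurable borel"
proof -
  have "(\<lambda>(r, s). (if a \<le> s \<and> s \<le> r then f s else 0)) \<in> borel_measurable (lborel \<Otimes>\<^sub>M (lborel :: real measure))"
    by measurable
  then have "(\<lambda>r. \<integral>s. (if a \<le> s \<and> s \<le> r then f s else 0) \<partial>lborel) \<in> borel_measurable lborel"
    by (rule lborel.borel_measurable_lebesgue_integral)
  moreover have "(if a \<le> s \<and> s \<le> r then f s else 0) = indicator {a..r} s * f s" for r s
    by (auto split: split_indicator)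
  ultimately show ?thesis by (simp add: primitive_from_def[abs_def])
qed

lemma primitive_from_integrable: "integrable lborel f \<Longrightarrow> integrable lborel (\<lambda>s. indicator {a..r} s * f s)" for f :: "real \<Rightarrow> real"
  using integrable_mult_indicator[of "{a..r}" lborel f] by simp

lemma primitive_from_bound:
  assumes f: "integrable lborel f"
  shows "\<bar>primitive_from a f r\<bar> \<le> (\<integral>s. \<bar>f s\<bar> \<partial>lborel)"
  unfolding primitive_from_def
  by (rule order_trans[OF integral_abs_bound integral_mono]) 
    (use f primitive_from_integrable[OF f] in \<open>auto split: split_indicator\<close>)

text \<open>For continuous $f$ the primitive, as a function of $|x|$, differs on the support of $\psi$ by a constant from a globally $C^1$ function $u$ with gradient
$f(|x|) x / |x|$, and constants integrate to zero against partial derivatives.\<close>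

lemma continuous_radial_integration_by_parts:
  fixes \<psi> :: "real^'n \<Rightarrow> real"
  assumes a: "0 < a" and f: "continuous_on UNIV f"
    and \<psi>: "C1 \<psi>" and K: "compact K" and v: "vanishes_outside K \<psi>" and Ka: "\<And>x. x \<in> K \<Longrightarrow> a \<le> norm x"
  shows "(\<integral>x. primitive_from a f (norm x) * grad \<psi> x $ j \<partial>lborel) = - (\<integral>x. f (norm x) / norm x * x $ j * \<psi> x \<partial>lborel)"
proof -
  \<comment> \<open>substituting $t = s^2$ in the primitive; the maximum with $a^2$ keeps the integrand continuous on all of $\mathbb{R}$ and changes nothing on the support of $\psi$\<close>
  define m where "m t = sqrt (max t (a\<^sup>2))" for t
  define g where "g t = f (m t) / (2 * m t)" for t
  have m: "m t > 0" for t using a by (simp add: m_def less_max_iff_disj)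
  have mc: "continuous_on UNIV m" unfolding m_def by (intro continuous_intros)
  have gc: "continuous_on UNIV g" unfolding g_def
    using m by (intro continuous_on_divide continuous_on_compose2[OF f mc] continuous_on_mult mc continuous_on_const) 
      (auto simp: less_imp_neq[THEN not_sym])
  have "isCont g t" for t using gc by (simp add: continuous_on_eq_continuous_at)
  then obtain Q where Q: "\<And>t. (Q has_vector_derivative g t) (at t)"
    using einterval_antiderivative[of "-\<infinity>" "\<infinity>" g] by auto
  then have Qd: "(Q has_real_derivative g t) (at t)" for t
    by (simp add: has_real_derivative_iff_has_vector_derivative)
  have m2: "m (s\<^sup>2) = s" if "a \<le> s" for s
    using that a by (simp add: m_def max_absorb1 power_mono)
  define u where "u x = Q ((norm x)\<^sup>2)" for x :: "real^'n"
  have u: "C1 u" "grad u = (\<lambda>x. (2 * g ((norm x)\<^sup>2)) *\<^sub>R x)"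
    unfolding u_def[abs_def] by (rule C1_radial[OF Qd gc])+
  have P: "primitive_from a f r = Q (r\<^sup>2) - Q (a\<^sup>2)" if "a \<le> r" for r
  proof -
    have "integral\<^sup>L lborel (\<lambda>s. indicator {a..r} s *\<^sub>R f s) = Q (r\<^sup>2) - Q (a\<^sup>2)"
    proof (rule integral_FTC_atLeastAtMost[OF that])
      fix s assume s: "a \<le> s" "s \<le> r"
      have "((\<lambda>s. s\<^sup>2) has_real_derivative 2 * s) (at s within {a..r})" by (auto intro!: derivative_eq_intros)
      from DERIV_chain2[OF Qd this] have "((\<lambda>s. Q (s\<^sup>2)) has_real_derivative g (s\<^sup>2) * (2 * s)) (at s within {a..r})" .
      moreover have "g (s\<^sup>2) * (2 * s) = f s" using m2[OF s(1)] a s by (simp add: g_def)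
      ultimately show "((\<lambda>s. Q (s\<^sup>2)) has_vector_derivative f s) (at s within {a..r})"
        by (simp add: has_real_derivative_iff_has_vector_derivative)
    qed (use f continuous_on_subset in blast)
    then show ?thesis by (simp add: primitive_from_def)
  qed
  have gv: "vanishes_outside K (grad \<psi>)" by (rule grad_vanishes_outside[OF \<psi> compact_imp_closed[OF K] v])
  have i1: "integrable lborel (\<lambda>x. grad \<psi> x $ j)"
    by (rule cont_supported_integrable[OF C1_grad_continuous[OF \<psi>] K]) (use gv in \<open>simp add: vanishes_outside_def\<close>)
  have i2: "integrable lborel (\<lambda>x. u x * grad \<psi> x $ j)"
    by (rule cont_supported_integrable[OF continuous_on_mult[OF C1_continuous[OF u(1)] C1_grad_continuous[OF \<psi>]] K]) 
      (use gv in \<open>simp add: vanishes_outside_def\<close>)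
  have "primitive_from a f (norm x) * grad \<psi> x $ j = u x * grad \<psi> x $ j - Q (a\<^sup>2) * grad \<psi> x $ j" for x
  proof (cases "x \<in> K")
    case True
    then show ?thesis using P[OF Ka] by (simp add: u_def left_diff_distrib)
  qed (use gv in \<open>simp add: vanishes_outside_def\<close>)
  then have "(\<integral>x. primitive_from a f (norm x) * grad \<psi> x $ j \<partial>lborel) = (\<integral>x. u x * grad \<psi> x $ j - Q (a\<^sup>2) * grad \<psi> x $ j \<partial>lborel)"
    by (simp only:)
  also have "\<dots> = (\<integral>x. u x * grad \<psi> x $ j \<partial>lborel) - Q (a\<^sup>2) * (\<integral>x. grad \<psi> x $ j \<partial>lborel)"
    using i1 i2 by (simp add: Bochner_Integration.integral_diff)
  also have "\<dots> = - (\<integral>x. grad u x $ j * \<psi> x \<partial>lborel)"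
    by (simp add: integral_grad_eq_0[OF \<psi> K v] integration_by_parts[OF u(1) \<psi> K v])
  also have "(\<integral>x. grad u x $ j * \<psi> x \<partial>lborel) = (\<integral>x. f (norm x) / norm x * x $ j * \<psi> x \<partial>lborel)"
  proof (rule Bochner_Integration.integral_cong[OF refl])
    fix x
    show "grad u x $ j * \<psi> x = f (norm x) / norm x * x $ j * \<psi> x"
    proof (cases "x \<in> K")
      case True
      then show ?thesis using m2[OF Ka] by (simp add: u(2) g_def)
    qed (use v in \<open>simp add: vanishes_outside_def\<close>)
  qed
  finally show ?thesis .
qed

text \<open>Both sides are bounded by a constant times $\int |f|$: the left because the primitive is bounded by $\int |f|$, the right because
the support of $\psi$ lies in an annulus, on which the density $r^{N-1}$ is bounded. As continuous functions are dense in $L^1$, the identity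
carries over from them.\<close>

lemma radial_integration_by_parts:
  fixes \<psi> :: "real^'n \<Rightarrow> real"
  assumes ab: "0 < a" "a \<le> b" and f: "integrable lborel f"
    and \<psi>: "C1 \<psi>" and K: "compact K" and v: "vanishes_outside K \<psi>" and Kab: "\<And>x. x \<in> K \<Longrightarrow> a \<le> norm x \<and> norm x \<le> b"
  shows "(\<integral>x. primitive_from a f (norm x) * grad \<psi> x $ j \<partial>lborel) = - (\<integral>x. f (norm x) / norm x * x $ j * \<psi> x \<partial>lborel)"
proof -
  let ?w = "sphere_weight CARD('n)"
  have gv: "vanishes_outside K (\<lambda>x. grad \<psi> x $ j)" 
    using grad_vanishes_outside[OF \<psi> compact_imp_closed[OF K] v] by (simp add: vanishes_outside_def)
  have gi: "integrable lborel (\<lambda>x. grad \<psi> x $ j)"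
    by (rule cont_supported_integrable[OF C1_grad_continuous[OF \<psi>] K gv])
  have [measurable]: "(\<lambda>x. grad \<psi> x $ j) \<in> borel_measurable borel" using gi by auto
  have [measurable]: "\<psi> \<in> borel_measurable borel" by (rule borel_measurable_continuous_onI[OF C1_continuous[OF \<psi>]])
  obtain M where M: "M > 0" "\<And>x. \<bar>\<psi> x\<bar> \<le> M" using cont_supported_bounded[OF C1_continuous[OF \<psi>] K v] by blast
  define G where "G = (\<integral>x. \<bar>grad \<psi> x $ j\<bar> \<partial>lborel)"
  define L where "L h x = primitive_from a h (norm x) * grad \<psi> x $ j" for h and x :: "real^'n"
  define R where "R h x = h (norm x) / norm x * x $ j * \<psi> x" for h and x :: "real^'n"
  have Li: "integrable lborel (L h)" "\<bar>\<integral>x. L h x \<partial>lborel\<bar> \<le> G * (\<integral>s. \<bar>h s\<bar> \<partial>lborel)" if h: "integrable lborel h" for h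
  proof -
    have [measurable]: "h \<in> borel_measurable borel" using h by auto
    have [measurable]: "primitive_from a h \<in> borel_measurable borel" by (rule primitive_from_measurable) simp
    have b: "integrable lborel (\<lambda>x. (\<integral>s. \<bar>h s\<bar> \<partial>lborel) * \<bar>grad \<psi> x $ j\<bar>)" using gi by simp
    have le: "\<bar>L h x\<bar> \<le> (\<integral>s. \<bar>h s\<bar> \<partial>lborel) * \<bar>grad \<psi> x $ j\<bar>" for x
      using primitive_from_bound[OF h, of a "norm x"] by (simp add: L_def abs_mult mult_right_mono)
    show i: "integrable lborel (L h)"
    proof (rule Bochner_Integration.integrable_bound[OF b])
      show "L h \<in> borel_measurable lborel" unfolding L_def[abs_def] by measurable
      show "AE x in lborel. norm (L h x) \<le> norm ((\<integral>s. \<bar>h s\<bar> \<partial>lborel) * \<bar>grad \<psi> x $ j\<bar>)"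
        using le by (intro AE_I2) (simp only: real_norm_def order_trans[OF _ abs_ge_self])
    qed
    have "\<bar>\<integral>x. L h x \<partial>lborel\<bar> \<le> (\<integral>x. (\<integral>s. \<bar>h s\<bar> \<partial>lborel) * \<bar>grad \<psi> x $ j\<bar> \<partial>lborel)"
      by (rule order_trans[OF integral_abs_bound integral_mono]) (use i b le in auto)
    then show "\<bar>\<integral>x. L h x \<partial>lborel\<bar> \<le> G * (\<integral>s. \<bar>h s\<bar> \<partial>lborel)" by (simp add: G_def mult.commute)
  qed
  have Ri: "integrable lborel (R h)" "\<bar>\<integral>x. R h x \<partial>lborel\<bar> \<le> M * ?w b * (\<integral>s. \<bar>h s\<bar> \<partial>lborel)" if h: "integrable lborel h" for h
  proof -
    have [measurable]: "h \<in> borel_measurable borel" using h by auto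
    have m: "(\<lambda>r. indicator {a..b} r * \<bar>h r\<bar>) \<in> borel_measurable borel" by measurable
    have wle: "?w r * (indicator {a..b} r * \<bar>h r\<bar>) \<le> ?w b * \<bar>h r\<bar>" for r
      using sphere_weight_mono[of r b "CARD('n)"] sphere_weight_nonneg[of "CARD('n)" b] by (auto intro!: mult_right_mono split: split_indicator)
    have wi: "integrable lborel (\<lambda>r. ?w r * (indicator {a..b} r * \<bar>h r\<bar>))"
    proof (rule Bochner_Integration.integrable_bound)
      show "integrable lborel (\<lambda>r. ?w b * \<bar>h r\<bar>)" using h by simp
      show "AE r in lborel. norm (?w r * (indicator {a..b} r * \<bar>h r\<bar>)) \<le> norm (?w b * \<bar>h r\<bar>)"
        using wle sphere_weight_nonneg by (intro AE_I2) (simp add: abs_mult)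
    qed measurable
    have b: "integrable lborel (\<lambda>x::real^'n. M * (indicator {a..b} (norm x) * \<bar>h (norm x)\<bar>))"
      using radial_integration(1)[OF m, where 'n='n] wi by simp
    have le: "\<bar>R h x\<bar> \<le> M * (indicator {a..b} (norm x) * \<bar>h (norm x)\<bar>)" for x
    proof (cases "x \<in> K")
      case True
      have nx: "norm x > 0" using Kab[OF True] ab by linarith
      have "\<bar>R h x\<bar> = \<bar>h (norm x)\<bar> * (\<bar>x $ j\<bar> / norm x) * \<bar>\<psi> x\<bar>" by (simp add: R_def abs_mult)
      also have "\<dots> \<le> \<bar>h (norm x)\<bar> * 1 * M"
        using nx component_le_norm_cart[of x j] M by (intro mult_mono) (auto simp: divide_le_eq)
      finally show ?thesis using Kab[OF True] by (simp add: mult.commute)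
    next
      case False
      then show ?thesis using v M(1) by (simp add: R_def vanishes_outside_def)
    qed
    show i: "integrable lborel (R h)"
    proof (rule Bochner_Integration.integrable_bound[OF b])
      show "R h \<in> borel_measurable lborel" unfolding R_def[abs_def] by measurable
      show "AE x in lborel. norm (R h x) \<le> norm (M * (indicator {a..b} (norm x) * \<bar>h (norm x)\<bar>))"
        using le by (intro AE_I2) (simp only: real_norm_def order_trans[OF _ abs_ge_self])
    qed
    have "\<bar>\<integral>x. R h x \<partial>lborel\<bar> \<le> (\<integral>(x::real^'n). M * (indicator {a..b} (norm x) * \<bar>h (norm x)\<bar>) \<partial>lborel)"
      by (rule order_trans[OF integral_abs_bound integral_mono]) (use i b le in auto)
    also have "\<dots> = M * (\<integral>r. ?w r * (indicator {a..b} r * \<bar>h r\<bar>) \<partial>lborel)"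
      using radial_integration(2)[OF m, where 'n='n] by simp
    also have "\<dots> \<le> M * (\<integral>r. ?w b * \<bar>h r\<bar> \<partial>lborel)"
      using M(1) wi h wle by (intro mult_left_mono integral_mono) auto
    finally show "\<bar>\<integral>x. R h x \<partial>lborel\<bar> \<le> M * ?w b * (\<integral>s. \<bar>h s\<bar> \<partial>lborel)" by simp
  qed
  define C where "C = G + M * ?w b"
  have C: "C \<ge> 0" using M(1) sphere_weight_nonneg[of "CARD('n)" b] by (simp add: C_def G_def)
  have "(\<integral>x. L f x \<partial>lborel) + (\<integral>x. R f x \<partial>lborel) = 0"
  proof (rule ccontr)
    let ?t = "(\<integral>x. L f x \<partial>lborel) + (\<integral>x. R f x \<partial>lborel)"
    assume t: "?t \<noteq> 0"
    \<comment> \<open>close enough that the error $C e$ stays below the supposed value\<close>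
    define e where "e = \<bar>?t\<bar> / (C + 1)"
    have e: "e > 0" using t C by (simp add: e_def)
    obtain g where g: "continuous_on UNIV g" "integrable lborel g" "(\<integral>x. \<bar>f x - g x\<bar> \<partial>lborel) < e"
      using integrable_approx_continuous[OF f e] by blast
    let ?h = "\<lambda>s. f s - g s"
    have h: "integrable lborel ?h" using f g(2) by simp
    have Pd: "primitive_from a ?h r = primitive_from a f r - primitive_from a g r" for r
      using primitive_from_integrable[OF f, of a r] primitive_from_integrable[OF g(2), of a r]
      by (simp add: primitive_from_def right_diff_distrib Bochner_Integration.integral_diff)
    have Ld: "L ?h x = L f x - L g x" for x by (simp add: L_def Pd left_diff_distrib)
    have Rd: "R ?h x = R f x - R g x" for x by (simp add: R_def left_diff_distrib diff_divide_distrib)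
    have "(\<integral>x. L g x \<partial>lborel) + (\<integral>x. R g x \<partial>lborel) = 0"
      using continuous_radial_integration_by_parts[OF ab(1) g(1) \<psi> K v, of j] Kab by (simp add: L_def R_def)
    then have "?t = (\<integral>x. L ?h x \<partial>lborel) + (\<integral>x. R ?h x \<partial>lborel)"
      unfolding Ld Rd using Li(1)[OF f] Li(1)[OF g(2)] Ri(1)[OF f] Ri(1)[OF g(2)] by (simp add: Bochner_Integration.integral_diff)
    then have "\<bar>?t\<bar> \<le> G * (\<integral>s. \<bar>?h s\<bar> \<partial>lborel) + M * ?w b * (\<integral>s. \<bar>?h s\<bar> \<partial>lborel)"
      using Li(2)[OF h] Ri(2)[OF h] by linarith
    also have "\<dots> = C * (\<integral>s. \<bar>?h s\<bar> \<partial>lborel)" by (simp add: C_def algebra_simps)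
    also have "\<dots> \<le> C * e" using g(3) C by (intro mult_left_mono) auto
    also have "\<dots> < (C + 1) * e" using e by simp
    also have "\<dots> = \<bar>?t\<bar>" using C by (simp add: e_def)
    finally show False by simp
  qed
  then show ?thesis by (simp add: L_def R_def)
qed

text \<open>A field that is almost everywhere radial on $\Omega$, with Borel profile $\nu$. The radius $c$ of some sphere inside $\Omega$ serves
as the base point of the potential.\<close>

locale radial_field =
  fixes \<Omega> :: "(real^'n) set" and F :: "real^'n \<Rightarrow> real^'n" and \<nu> :: "real \<Rightarrow> real" and c :: real
  assumes n: "CARD('n) \<ge> 3" and \<Omega>: "open \<Omega>" "connected \<Omega>" "radially_symmetric \<Omega>"
    and Fm[measurable]: "F \<in> borel_measurable borel" and L2: "locally_L2 \<Omega> F"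
    and \<nu>m[measurable]: "\<nu> \<in> borel_measurable borel"
    and prof: "AE x in lborel. x \<in> \<Omega> \<longrightarrow> F x = \<nu> (norm x) *\<^sub>R x"
    and c: "c > 0" "\<And>x. norm x = c \<Longrightarrow> x \<in> \<Omega>"
begin

definition radii :: "real set" where "radii = {r. r > 0 \<and> (\<forall>x::real^'n. norm x = r \<longrightarrow> x \<in> \<Omega>)}"

lemma N_pos: "CARD('n) > 0" using n by simp

lemma mem_radii: "x \<noteq> 0 \<Longrightarrow> norm x \<in> radii \<longleftrightarrow> x \<in> \<Omega>"
  using radially_symmetric_norm[OF n \<Omega>(3)] by (auto simp: radii_def)

lemma radii_pos: "r \<in> radii \<Longrightarrow> r > 0" by (simp add: radii_def)

lemma radii_mem: "norm x \<in> radii \<Longrightarrow> x \<in> \<Omega>" by (simp add: radii_def)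

lemma c_radii: "c \<in> radii" using c by (simp add: radii_def)

text \<open>The norm maps the punctured domain onto the set of admissible radii, and an open connected set of dimension at least two remains connected when a point is removed.\<close>

lemma radii_between: 
  assumes "a \<in> radii" "b \<in> radii" "a \<le> r" "r \<le> b"
  shows "r \<in> radii"
proof -
  have "2 \<le> DIM(real^'n)" using n by simp
  then have "connected (\<Omega> - {0})" using \<Omega> by (intro connected_open_delete)
  then have "connected (norm ` (\<Omega> - {0}))" by (intro connected_continuous_image continuous_intros)
  moreover have "norm ` (\<Omega> - {0}) = radii"
  proof
    show "norm ` (\<Omega> - {0}) \<subseteq> radii" using mem_radii by auto
    show "radii \<subseteq> norm ` (\<Omega> - {0})"
    proof
      fix r assume r: "r \<in> radii"
      obtain x :: "real^'n" where x: "norm x = r" using radii_pos[OF r] by (metis less_imp_le vector_choose_size)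
      have "x \<in> \<Omega>" "x \<noteq> 0" using r x radii_pos[OF r] by (auto simp: radii_def)
      then show "r \<in> norm ` (\<Omega> - {0})" using x by auto
    qed
  qed
  ultimately have "connected radii" by simp
  then show ?thesis using assms by (meson connectedD_interval)
qed

definition speed :: "real \<Rightarrow> real" where "speed s = \<nu> s * s"

lemma speed_measurable [measurable]: "speed \<in> borel_measurable borel"
  unfolding speed_def[abs_def] by measurable

lemma annulus:
  assumes "a \<in> radii" "b \<in> radii"
  shows "compact (cball (0::real^'n) b - ball 0 a)" "cball (0::real^'n) b - ball 0 a \<subseteq> \<Omega>"
  using radii_between[OF assms] radii_mem by (auto intro!: compact_diff)

lemma radial_part:
  assumes K: "K \<subseteq> \<Omega>" and h0: "h 0 = 0"
  shows "AE x in lborel. indicator K x * h (norm (F x)) = (indicator K x * h \<bar>speed (norm x)\<bar> :: real)"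
  using prof
proof eventually_elim
  case (elim x)
  show ?case
    using elim K by (auto simp: speed_def abs_mult split: split_indicator)
qed

lemma speed_integrable:
  assumes ab: "a \<in> radii" "b \<in> radii"
  shows "integrable lborel (\<lambda>s. indicator {a..b} s * speed s)"
proof -
  let ?K = "cball (0::real^'n) b - ball 0 a"
  have [measurable]: "?K \<in> sets borel" by (rule borel_compact[OF annulus(1)[OF ab]])
  have m: "(\<lambda>s. indicator {a..b} s * \<bar>speed s\<bar>) \<in> borel_measurable borel" by measurable
  have "integrable lborel (\<lambda>x. indicator ?K x * norm (F x))"
    by (rule locally_L2_imp_L1(1)[OF L2 Fm annulus[OF ab]])
  then have "integrable lborel (\<lambda>x. indicator ?K x * \<bar>speed (norm x)\<bar>)"
    by (rule integrable_cong_AE_imp) (measurable, rule radial_part[OF annulus(2)[OF ab], of "\<lambda>t. t"], simp)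
  moreover have "indicator ?K x * \<bar>speed (norm x)\<bar> = indicator {a..b} (norm x) * \<bar>speed (norm x)\<bar>" for x
    by (auto split: split_indicator)
  ultimately have "integrable lborel (\<lambda>x::real^'n. indicator {a..b} (norm x) * \<bar>speed (norm x)\<bar>)" by simp
  then have i: "integrable lborel (\<lambda>s. sphere_weight CARD('n) s * (indicator {a..b} s * \<bar>speed s\<bar>))"
    using radial_integration(1)[OF m, where 'n='n] by simp
  have wa: "sphere_weight CARD('n) a > 0" using radii_pos[OF ab(1)] N_pos by (rule sphere_weight_pos[rotated])
  show ?thesis
  proof (rule Bochner_Integration.integrable_bound)
    show "integrable lborel (\<lambda>s. 1 / sphere_weight CARD('n) a * (sphere_weight CARD('n) s * (indicator {a..b} s * \<bar>speed s\<bar>)))" using i by simp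
    show "AE s in lborel. norm (indicator {a..b} s * speed s) \<le> norm (1 / sphere_weight CARD('n) a * (sphere_weight CARD('n) s * (indicator {a..b} s * \<bar>speed s\<bar>)))"
    proof (rule AE_I2)
      fix s
      show "norm (indicator {a..b} s * speed s) \<le> norm (1 / sphere_weight CARD('n) a * (sphere_weight CARD('n) s * (indicator {a..b} s * \<bar>speed s\<bar>)))"
      proof (cases "s \<in> {a..b}")
        case True
        then have "sphere_weight CARD('n) a \<le> sphere_weight CARD('n) s" by (intro sphere_weight_mono) simp
        then have "1 \<le> sphere_weight CARD('n) s / sphere_weight CARD('n) a" using wa by simp
        then have "1 * \<bar>speed s\<bar> \<le> sphere_weight CARD('n) s / sphere_weight CARD('n) a * \<bar>speed s\<bar>" by (intro mult_right_mono) auto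
        then show ?thesis using True wa sphere_weight_nonneg[of "CARD('n)" s] by (simp add: abs_mult)
      qed simp
    qed
  qed measurable
qed

text \<open>The oriented integral of the speed from $c$ to $r$, written as one integral over $\mathbb{R}$ so that its measurability in $r$ is part of
Fubini's theorem.\<close>

definition \<Phi> :: "real \<Rightarrow> real" where
  "\<Phi> r = (\<integral>s. (if c < s \<and> s \<le> r then speed s else if r < s \<and> s \<le> c then - speed s else 0) \<partial>lborel)"

lemma \<Phi>_measurable [measurable]: "\<Phi> \<in> borel_measurable borel"
proof -
  have "(\<lambda>(r, s). (if c < s \<and> s \<le> r then speed s else if r < s \<and> s \<le> c then - speed s else 0)) 
      \<in> borel_measurable (lborel \<Otimes>\<^sub>M (lborel :: real measure))"
    by measurable
  then have "(\<lambda>r. \<integral>s. (if c < s \<and> s \<le> r then speed s else if r < s \<and> s \<le> c then - speed s else 0) \<partial>lborel) \<in> borel_measurable lborel"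
    by (rule lborel.borel_measurable_lebesgue_integral)
  then show ?thesis by (simp add: \<Phi>_def[abs_def])
qed

lemma \<Phi>_primitive:
  assumes ab: "a \<in> radii" "b \<in> radii" and "a \<le> c" "c \<le> b" and r: "a \<le> r" "r \<le> b"
  shows "\<Phi> r = primitive_from a (\<lambda>s. indicator {a..b} s * speed s) r - primitive_from a (\<lambda>s. indicator {a..b} s * speed s) c"
proof -
  let ?f = "\<lambda>s. indicator {a..b} s * speed s"
  have i: "integrable lborel (\<lambda>s. indicator {a..t} s * ?f s)" for t
    by (rule primitive_from_integrable[OF speed_integrable[OF ab]])
  have "\<Phi> r = (\<integral>s. indicator {a..r} s * ?f s - indicator {a..c} s * ?f s \<partial>lborel)"
    unfolding \<Phi>_def by (rule Bochner_Integration.integral_cong[OF refl]) (use assms in \<open>auto split: split_indicator\<close>)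
  then show ?thesis unfolding primitive_from_def by (subst (asm) Bochner_Integration.integral_diff[OF i i])
qed

lemma \<Phi>_bounded:
  assumes ab: "a \<in> radii" "b \<in> radii" and "a \<le> c" "c \<le> b"
  shows "\<exists>M\<ge>0. \<forall>r. a \<le> r \<longrightarrow> r \<le> b \<longrightarrow> \<bar>\<Phi> r\<bar> \<le> M"
proof (intro exI conjI allI impI)
  let ?f = "\<lambda>s. indicator {a..b} s * speed s"
  show "2 * (\<integral>s. \<bar>?f s\<bar> \<partial>lborel) \<ge> 0" by simp
  show "\<bar>\<Phi> r\<bar> \<le> 2 * (\<integral>s. \<bar>?f s\<bar> \<partial>lborel)" if "a \<le> r" "r \<le> b" for r
    using \<Phi>_primitive[OF assms that] primitive_from_bound[OF speed_integrable[OF ab], of a r] 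
      primitive_from_bound[OF speed_integrable[OF ab], of a c] by linarith
qed

text \<open>A compact subset of the punctured domain lies in an annulus with radii in \<open>radii\<close>. On it the potential differs by a constant from
the primitive starting at the inner radius.\<close>

lemma weak_gradient_off_origin:
  assumes \<psi>: "C1 \<psi>" and K: "compact K" "K \<subseteq> \<Omega>" "0 \<notin> K" and v: "vanishes_outside K \<psi>"
  shows "(\<integral>x. \<Phi> (norm x) * grad \<psi> x $ j \<partial>lborel) = - (\<integral>x. F x $ j * \<psi> x \<partial>lborel)"
proof -
  have "\<exists>a b. a \<in> radii \<and> b \<in> radii \<and> a \<le> c \<and> c \<le> b \<and> (\<forall>x\<in>K. a \<le> norm x \<and> norm x \<le> b)"
  proof (cases "K = {}")
    case True
    then show ?thesis using c_radii by auto
  next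
    case False
    have co: "continuous_on K norm" by (intro continuous_intros)
    obtain p where p: "p \<in> K" "\<And>x. x \<in> K \<Longrightarrow> norm p \<le> norm x" using continuous_attains_inf[OF K(1) False co] by blast
    obtain q where q: "q \<in> K" "\<And>x. x \<in> K \<Longrightarrow> norm x \<le> norm q" using continuous_attains_sup[OF K(1) False co] by blast
    have pq: "norm p \<in> radii" "norm q \<in> radii" using mem_radii[of p] mem_radii[of q] p(1) q(1) K by auto
    show ?thesis
    proof (intro exI conjI ballI)
      show "min c (norm p) \<in> radii" "max c (norm q) \<in> radii" using pq c_radii by (simp_all add: min_def max_def)
      fix x assume "x \<in> K"
      then show "min c (norm p) \<le> norm x" "norm x \<le> max c (norm q)" using p(2) q(2) by (auto simp: min_le_iff_disj le_max_iff_disj)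
    qed auto
  qed
  then obtain a b where ab: "a \<in> radii" "b \<in> radii" and abc: "a \<le> c" "c \<le> b" and Kab: "\<And>x. x \<in> K \<Longrightarrow> a \<le> norm x \<and> norm x \<le> b" by blast
  let ?f = "\<lambda>s. indicator {a..b} s * speed s"
  let ?P = "primitive_from a ?f"
  have fi: "integrable lborel ?f" by (rule speed_integrable[OF ab])
  have [measurable]: "?P \<in> borel_measurable borel" by (rule primitive_from_measurable) measurable
  have gv: "vanishes_outside K (\<lambda>x. grad \<psi> x $ j)" 
    using grad_vanishes_outside[OF \<psi> compact_imp_closed[OF K(1)] v] by (simp add: vanishes_outside_def)
  have gi: "integrable lborel (\<lambda>x. grad \<psi> x $ j)"
    by (rule cont_supported_integrable[OF C1_grad_continuous[OF \<psi>] K(1) gv])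
  have [measurable]: "(\<lambda>x. grad \<psi> x $ j) \<in> borel_measurable borel" using gi by auto
  have Pi: "integrable lborel (\<lambda>x. ?P (norm x) * grad \<psi> x $ j)"
  proof (rule Bochner_Integration.integrable_bound)
    show "integrable lborel (\<lambda>x. (\<integral>s. \<bar>?f s\<bar> \<partial>lborel) * \<bar>grad \<psi> x $ j\<bar>)" using gi by simp
    have "norm (?P (norm x) * grad \<psi> x $ j) \<le> (\<integral>s. \<bar>?f s\<bar> \<partial>lborel) * \<bar>grad \<psi> x $ j\<bar>" for x
      using mult_right_mono[OF primitive_from_bound[OF fi, of a "norm x"] abs_ge_zero[of "grad \<psi> x $ j"]] by (simp only: real_norm_def abs_mult)
    then show "AE x in lborel. norm (?P (norm x) * grad \<psi> x $ j) \<le> norm ((\<integral>s. \<bar>?f s\<bar> \<partial>lborel) * \<bar>grad \<psi> x $ j\<bar>)"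
      by (intro AE_I2) (simp only: real_norm_def order_trans[OF _ abs_ge_self])
  qed measurable
  have "\<Phi> (norm x) * grad \<psi> x $ j = ?P (norm x) * grad \<psi> x $ j - ?P c * grad \<psi> x $ j" for x
  proof (cases "x \<in> K")
    case True
    then show ?thesis using \<Phi>_primitive[OF ab abc] Kab by (simp add: left_diff_distrib)
  qed (use gv in \<open>simp add: vanishes_outside_def\<close>)
  then have "(\<integral>x. \<Phi> (norm x) * grad \<psi> x $ j \<partial>lborel) = (\<integral>x. ?P (norm x) * grad \<psi> x $ j - ?P c * grad \<psi> x $ j \<partial>lborel)"
    by (simp only:)
  also have "\<dots> = (\<integral>x. ?P (norm x) * grad \<psi> x $ j \<partial>lborel) - ?P c * (\<integral>x. grad \<psi> x $ j \<partial>lborel)"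
    using gi Pi by (subst Bochner_Integration.integral_diff) auto
  also have "\<dots> = (\<integral>x. ?P (norm x) * grad \<psi> x $ j \<partial>lborel)" by (simp add: integral_grad_eq_0[OF \<psi> K(1) v])
  also have "\<dots> = - (\<integral>x. ?f (norm x) / norm x * x $ j * \<psi> x \<partial>lborel)"
    by (rule radial_integration_by_parts[OF radii_pos[OF ab(1)] order_trans[OF abc] fi \<psi> K(1) v Kab])
  also have "(\<integral>x. ?f (norm x) / norm x * x $ j * \<psi> x \<partial>lborel) = (\<integral>x. F x $ j * \<psi> x \<partial>lborel)"
  proof (rule integral_cong_AE)
    have [measurable]: "\<psi> \<in> borel_measurable borel" by (rule borel_measurable_continuous_onI[OF C1_continuous[OF \<psi>]])
    show "(\<lambda>x. ?f (norm x) / norm x * x $ j * \<psi> x) \<in> borel_measurable lborel" "(\<lambda>x. F x $ j * \<psi> x) \<in> borel_measurable lborel"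
      by measurable
    show "AE x in lborel. ?f (norm x) / norm x * x $ j * \<psi> x = F x $ j * \<psi> x"
      using prof
    proof eventually_elim
      case (elim x)
      show ?case
      proof (cases "x \<in> K")
        case True
        then have "x \<in> \<Omega>" "x \<noteq> 0" using K by auto
        then show ?thesis using elim Kab[OF True] by (simp add: speed_def)
      qed (use v in \<open>simp add: vanishes_outside_def\<close>)
    qed
  qed
  finally show ?thesis .
qed

lemma ball_in_\<Omega>:
  assumes "0 \<in> \<Omega>" "r \<in> radii"
  shows "cball 0 r \<subseteq> \<Omega>"
proof
  fix x :: "real^'n" assume x: "x \<in> cball 0 r"
  show "x \<in> \<Omega>"
  proof (cases "x = 0")
    case False
    obtain e where e: "e > 0" "ball 0 e \<subseteq> \<Omega>" using \<Omega>(1) assms(1) openE by blast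
    define t where "t = min (norm x) (e / 2)"
    have t: "t > 0" "t < e" "t \<le> norm x" using e False by (auto simp: t_def)
    have "t \<in> radii" unfolding radii_def using t e(2) by auto
    then have "norm x \<in> radii" using radii_between[OF _ assms(2), of t] t x by simp
    then show ?thesis by (rule radii_mem)
  qed (use assms in simp)
qed

text \<open>With $q^2$ the spherical weight at $r$, the weight at every $s \ge r$ is at least $q^2$, so $2 q |v| \le w(s) v^2 + 1$ for the speed $v$ at $s$. Integrating over
$r < s \le c$ gives $q |\Phi(r)| \le (E + c)/2$, where $E$ is the weighted energy of the speed, finite because the
field is square integrable on the ball of radius $c$.\<close>

lemma \<Phi>_near_origin:
  assumes 0: "0 \<in> \<Omega>"
  shows "\<exists>D. \<forall>r. 0 < r \<longrightarrow> r \<le> c \<longrightarrow> sphere_weight CARD('n) r * (\<Phi> r)\<^sup>2 \<le> D"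
proof -
  let ?K = "cball (0::real^'n) c" and ?h = "\<lambda>s. indicator {..c} s * (speed s)\<^sup>2"
  have m: "?h \<in> borel_measurable borel" by measurable
  have [measurable]: "?K \<in> sets borel" by (rule borel_closed) simp
  have "integrable lborel (\<lambda>x. indicator ?K x * (norm (F x))\<^sup>2)"
    using L2 ball_in_\<Omega>[OF 0 c_radii] by (auto simp: locally_L2_def)
  then have "integrable lborel (\<lambda>x. indicator ?K x * \<bar>speed (norm x)\<bar>\<^sup>2)"
    by (rule integrable_cong_AE_imp) (measurable, rule radial_part[OF ball_in_\<Omega>[OF 0 c_radii], of "\<lambda>t. t\<^sup>2"], simp)
  moreover have "(\<lambda>x. indicator ?K x * \<bar>speed (norm x)\<bar>\<^sup>2) = (\<lambda>x. ?h (norm x))"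
    by (auto simp: fun_eq_iff split: split_indicator)
  ultimately have "integrable lborel (\<lambda>x::real^'n. ?h (norm x))" by (simp only:)
  then have hi: "integrable lborel (\<lambda>s. sphere_weight CARD('n) s * ?h s)"
    by (rule radial_integration(1)[OF m, where 'n='n, THEN iffD1])
  define E where "E = (\<integral>s. sphere_weight CARD('n) s * ?h s \<partial>lborel)"
  have "sphere_weight CARD('n) r * (\<Phi> r)\<^sup>2 \<le> ((E + c) / 2)\<^sup>2" if r: "0 < r" "r \<le> c" for r
  proof -
    define q where "q = sqrt (sphere_weight CARD('n) r)"
    have wr: "sphere_weight CARD('n) r > 0" using r(1) N_pos by (rule sphere_weight_pos[rotated])
    have q: "q > 0" "q * q = sphere_weight CARD('n) r" using wr by (simp_all add: q_def)
    have r_radii: "r \<in> radii"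
    proof -
      have "x \<in> \<Omega>" if "norm x = r" for x using that r ball_in_\<Omega>[OF 0 c_radii] by auto
      then show ?thesis using r by (simp add: radii_def)
    qed
    have bi: "integrable lborel (\<lambda>s. 1 / (2 * q) * (sphere_weight CARD('n) s * ?h s) + 1 / (2 * q) * indicator {0..c} s)"
      using hi integrable_indicator_bounded[of "{0..c}"] by (intro Bochner_Integration.integrable_add integrable_mult_right) auto
    have pt: "indicator {r<..c} s * \<bar>speed s\<bar> \<le> 1 / (2 * q) * (sphere_weight CARD('n) s * ?h s) + 1 / (2 * q) * indicator {0..c} s" for s
    proof (cases "s \<in> {r<..c}")
      case True
      have ws: "sphere_weight CARD('n) r \<le> sphere_weight CARD('n) s" using True by (intro sphere_weight_mono) simp
      have "2 * (q * \<bar>speed s\<bar>) \<le> (q * \<bar>speed s\<bar>)\<^sup>2 + 1" using sum_squares_bound[of "q * \<bar>speed s\<bar>" 1] by simp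
      also have "(q * \<bar>speed s\<bar>)\<^sup>2 = sphere_weight CARD('n) r * (speed s)\<^sup>2" by (simp add: power_mult_distrib power2_eq_square[of q] q(2))
      also have "\<dots> \<le> sphere_weight CARD('n) s * (speed s)\<^sup>2" using ws by (intro mult_right_mono) auto
      finally show ?thesis using True r q(1) by (simp add: field_simps)
    next
      case False
      then show ?thesis using q(1) sphere_weight_nonneg[of "CARD('n)" s] by (auto split: split_indicator)
    qed
    have li: "integrable lborel (\<lambda>s. indicator {r<..c} s * \<bar>speed s\<bar>)"
    proof (rule Bochner_Integration.integrable_bound[OF bi])
      show "AE s in lborel. norm (indicator {r<..c} s * \<bar>speed s\<bar>) \<le> norm (1 / (2 * q) * (sphere_weight CARD('n) s * ?h s) + 1 / (2 * q) * indicator {0..c} s)"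
      proof (rule AE_I2)
        fix s
        have n: "norm (indicator {r<..c} s * \<bar>speed s\<bar>) = indicator {r<..c} s * \<bar>speed s\<bar>" by (simp add: abs_mult)
        show "norm (indicator {r<..c} s * \<bar>speed s\<bar>) \<le> norm (1 / (2 * q) * (sphere_weight CARD('n) s * ?h s) + 1 / (2 * q) * indicator {0..c} s)"
          by (subst n, subst real_norm_def) (rule order_trans[OF pt abs_ge_self])
      qed
    qed measurable
    have "\<Phi> r = (\<integral>s. - (indicator {r<..c} s * speed s) \<partial>lborel)"
      unfolding \<Phi>_def by (rule Bochner_Integration.integral_cong[OF refl]) (use r in \<open>auto split: split_indicator\<close>)
    then have "\<bar>\<Phi> r\<bar> \<le> (\<integral>s. \<bar>- (indicator {r<..c} s * speed s)\<bar> \<partial>lborel)" by (simp only: integral_abs_bound)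
    also have "\<dots> = (\<integral>s. indicator {r<..c} s * \<bar>speed s\<bar> \<partial>lborel)" by (simp add: abs_mult)
    also have "\<dots> \<le> (\<integral>s. 1 / (2 * q) * (sphere_weight CARD('n) s * ?h s) + 1 / (2 * q) * indicator {0..c} s \<partial>lborel)"
      by (rule integral_mono[OF li bi pt])
    also have "\<dots> = 1 / (2 * q) * E + 1 / (2 * q) * c"
      using hi c by (subst Bochner_Integration.integral_add) (use integrable_indicator_bounded[of "{0..c}"] in \<open>auto simp: E_def intro!: integrable_mult_right\<close>)
    also have "\<dots> = ((E + c) / 2) / q" using q(1) by (simp add: field_simps)
    finally have le: "q * \<bar>\<Phi> r\<bar> \<le> (E + c) / 2" using q(1) by (simp add: le_divide_eq mult_ac)
    have "sphere_weight CARD('n) r * (\<Phi> r)\<^sup>2 = (q * \<bar>\<Phi> r\<bar>)\<^sup>2" by (simp add: power_mult_distrib power2_eq_square[of q] q(2))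
    also have "\<dots> \<le> ((E + c) / 2)\<^sup>2" by (rule power_mono[OF le]) (use q in simp)
    finally show ?thesis .
  qed
  then show ?thesis by blast
qed

lemma compact_radius:
  assumes K: "compact K" "K \<subseteq> \<Omega>"
  obtains b where "b \<in> radii" "c \<le> b" "K \<subseteq> cball 0 b"
proof (cases "K = {}")
  case True
  then show thesis using that[of c] c_radii by simp
next
  case False
  have co: "continuous_on K norm" by (intro continuous_intros)
  obtain q where q: "q \<in> K" "\<And>x. x \<in> K \<Longrightarrow> norm x \<le> norm q" using continuous_attains_sup[OF K(1) False co] by blast
  have "max c (norm q) \<in> radii"
  proof (cases "norm q \<le> c")
    case True then show ?thesis using c_radii by (simp add: max_absorb1)
  next
    case False
    then have "q \<noteq> 0" using c by auto
    then show ?thesis using mem_radii[of q] q(1) K(2) False by (auto simp: max_def)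
  qed
  moreover have "K \<subseteq> cball 0 (max c (norm q))" using q(2) by (auto simp: le_max_iff_disj)
  ultimately show thesis by (intro that[of "max c (norm q)"]) simp_all
qed

text \<open>Away from the origin the potential is bounded. Near the origin, if that belongs to $\Omega$, the square of the potential times the spherical weight is bounded,
so the square is integrable in polar coordinates.\<close>

lemma potential_L2:
  assumes K: "compact K" "K \<subseteq> \<Omega>"
  shows "integrable lborel (\<lambda>x. indicator K x * (\<Phi> (norm x))\<^sup>2)"
proof -
  have [measurable]: "K \<in> sets borel" by (rule borel_compact[OF K(1)])
  obtain b where b: "b \<in> radii" "c \<le> b" "K \<subseteq> cball 0 b" by (rule compact_radius[OF K])
  show ?thesis
  proof (cases "0 \<in> \<Omega>")
    case True
    obtain D where D: "\<forall>r. 0 < r \<longrightarrow> r \<le> c \<longrightarrow> sphere_weight CARD('n) r * (\<Phi> r)\<^sup>2 \<le> D" 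
      using \<Phi>_near_origin[OF True] by (elim exE)
    obtain M where M: "M \<ge> 0" "\<forall>r. c \<le> r \<longrightarrow> r \<le> b \<longrightarrow> \<bar>\<Phi> r\<bar> \<le> M" 
      using \<Phi>_bounded[OF c_radii b(1) order_refl b(2)] by (elim exE conjE)
    have m: "(\<lambda>r. indicator {0<..c} r * (\<Phi> r)\<^sup>2) \<in> borel_measurable borel" by measurable
    have "integrable lborel (\<lambda>r. sphere_weight CARD('n) r * (indicator {0<..c} r * (\<Phi> r)\<^sup>2))"
    proof (rule Bochner_Integration.integrable_bound)
      show "integrable lborel (\<lambda>r. D * indicator {0<..c} r)" by (intro integrable_mult_right integrable_indicator_bounded) auto
      show "AE r in lborel. norm (sphere_weight CARD('n) r * (indicator {0<..c} r * (\<Phi> r)\<^sup>2)) \<le> norm (D * indicator {0<..c} r)"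
        using D sphere_weight_nonneg[of "CARD('n)"] by (intro AE_I2) (auto simp: abs_mult split: split_indicator intro: order_trans[OF _ abs_ge_self])
    qed measurable
    then have i: "integrable lborel (\<lambda>x::real^'n. indicator {0<..c} (norm x) * (\<Phi> (norm x))\<^sup>2)"
      using radial_integration(1)[OF m, where 'n='n] by simp
    show ?thesis
    proof (rule Bochner_Integration.integrable_bound)
      show "integrable lborel (\<lambda>x. indicator {0<..c} (norm x) * (\<Phi> (norm x))\<^sup>2 + M\<^sup>2 * indicator K x)"
        using i integrable_indicator_compact[OF K(1)] by simp
      show "AE x in lborel. norm (indicator K x * (\<Phi> (norm x))\<^sup>2) \<le> norm (indicator {0<..c} (norm x) * (\<Phi> (norm x))\<^sup>2 + M\<^sup>2 * indicator K x)"
        using AE_lborel_singleton[of 0]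
      proof eventually_elim
        case (elim x)
        show ?case
        proof (cases "x \<in> K \<and> c < norm x")
          case True
          then have "\<bar>\<Phi> (norm x)\<bar> \<le> M" using b(3) by (intro M(2)[rule_format]) auto
          then have "(\<Phi> (norm x))\<^sup>2 \<le> M\<^sup>2" using power_mono[of "\<bar>\<Phi> (norm x)\<bar>" M 2] by simp
          then show ?thesis using True by simp
        next
          case False
          then show ?thesis using elim by (auto split: split_indicator)
        qed
      qed
    qed measurable
  next
    case False
    have "\<exists>a. a \<in> radii \<and> a \<le> c \<and> (\<forall>x\<in>K. a \<le> norm x)"
    proof (cases "K = {}")
      case True then show ?thesis using c_radii by auto
    next
      case Kne: False
      have co: "continuous_on K norm" by (intro continuous_intros)
      obtain p where p: "p \<in> K" "\<And>x. x \<in> K \<Longrightarrow> norm p \<le> norm x" using continuous_attains_inf[OF K(1) Kne co] by blast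
      have "norm p \<in> radii" using mem_radii[of p] p(1) K False by auto
      then have "min c (norm p) \<in> radii" using c_radii by (simp add: min_def)
      then show ?thesis using p(2) by (intro exI[of _ "min c (norm p)"]) (auto simp: min_le_iff_disj)
    qed
    then obtain a where a: "a \<in> radii" "a \<le> c" "\<And>x. x \<in> K \<Longrightarrow> a \<le> norm x" by blast
    obtain M where M: "M \<ge> 0" "\<forall>r. a \<le> r \<longrightarrow> r \<le> b \<longrightarrow> \<bar>\<Phi> r\<bar> \<le> M" 
      using \<Phi>_bounded[OF a(1) b(1) a(2) b(2)] by (elim exE conjE)
    show ?thesis
    proof (rule Bochner_Integration.integrable_bound)
      show "integrable lborel (\<lambda>x. M\<^sup>2 * indicator K x)" using integrable_indicator_compact[OF K(1)] by simp
      show "AE x in lborel. norm (indicator K x * (\<Phi> (norm x))\<^sup>2) \<le> norm (M\<^sup>2 * indicator K x)"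
      proof (rule AE_I2)
        fix x
        show "norm (indicator K x * (\<Phi> (norm x))\<^sup>2) \<le> norm (M\<^sup>2 * indicator K x)"
        proof (cases "x \<in> K")
          case True
          then have "\<bar>\<Phi> (norm x)\<bar> \<le> M" using b(3) a(3) by (intro M(2)[rule_format]) auto
          then have "(\<Phi> (norm x))\<^sup>2 \<le> M\<^sup>2" using power_mono[of "\<bar>\<Phi> (norm x)\<bar>" M 2] by simp
          then show ?thesis using True by simp
        qed simp
      qed
    qed measurable
  qed
qed

text \<open>In polar coordinates the integrand is a multiple of $r^{N-3}$, and $N \ge 3$.\<close>

lemma inverse_square_integrable: "integrable lborel (\<lambda>x::real^'n. indicator {0<..b} (norm x) * (1 / (norm x)\<^sup>2))"
proof -
  have m: "(\<lambda>r::real. indicator {0<..b} r * (1 / r\<^sup>2)) \<in> borel_measurable borel" by measurable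
  define \<kappa> where "\<kappa> = real CARD('n) * unit_ball_vol (real CARD('n))"
  have \<kappa>: "\<kappa> \<ge> 0" by (simp add: \<kappa>_def)
  have "integrable lborel (\<lambda>r. sphere_weight CARD('n) r * (indicator {0<..b} r * (1 / r\<^sup>2)))"
  proof (rule Bochner_Integration.integrable_bound)
    show "integrable lborel (\<lambda>r. \<kappa> * b ^ (CARD('n) - 3) * indicator {0<..b} r)"
      by (intro integrable_mult_right integrable_indicator_bounded) auto
    show "AE r in lborel. norm (sphere_weight CARD('n) r * (indicator {0<..b} r * (1 / r\<^sup>2))) \<le> norm (\<kappa> * b ^ (CARD('n) - 3) * indicator {0<..b} r)"
    proof (rule AE_I2)
      fix r
      show "norm (sphere_weight CARD('n) r * (indicator {0<..b} r * (1 / r\<^sup>2))) \<le> norm (\<kappa> * b ^ (CARD('n) - 3) * indicator {0<..b} r)"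
      proof (cases "r \<in> {0<..b}")
        case True
        have "CARD('n) - 1 = (CARD('n) - 3) + 2" using n by simp
        from arg_cong[OF this, of "\<lambda>m. r ^ m"] have pw: "r ^ (CARD('n) - 1) = r ^ (CARD('n) - 3) * r\<^sup>2"
          by (simp only: power_add)
        have wr: "sphere_weight CARD('n) r = \<kappa> * r ^ (CARD('n) - 1)" using True by (simp add: sphere_weight_def \<kappa>_def)
        have "sphere_weight CARD('n) r * (1 / r\<^sup>2) = \<kappa> * r ^ (CARD('n) - 3)"
          unfolding wr pw using True by simp
        moreover have "\<kappa> * r ^ (CARD('n) - 3) \<le> \<kappa> * b ^ (CARD('n) - 3)"
          using True \<kappa> by (intro mult_left_mono power_mono) auto
        moreover have "\<kappa> * r ^ (CARD('n) - 3) \<ge> 0" using True \<kappa> by simp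
        ultimately show ?thesis using True by simp
      qed simp
    qed
  qed measurable
  then show ?thesis using radial_integration(1)[OF m, where 'n='n] by simp
qed

text \<open>The cut-off is $e^{-s}$ with $1/s = k^2 |x|^2 - 1$, extended by zero. Its partial derivatives are at most
$2 (s + s^2) e^{-s} / |x|$ in absolute value. The bound $6/|x|$ is uniform in $k$ and serves as a majorant; the sharper bound tends to
zero as $k$ grows, since then $s \to 0$.\<close>

lemma cutoff:
  fixes k :: real
  assumes k: "k > 0"
  defines "\<eta> \<equiv> \<lambda>x::real^'n. flat 1 (k\<^sup>2 * (norm x)\<^sup>2 - 1)"
  shows "C1 \<eta>" "0 \<le> \<eta> x" "\<eta> x \<le> 1" "norm x \<le> 1 / k \<Longrightarrow> \<eta> x = 0"
    "x \<noteq> 0 \<Longrightarrow> \<bar>grad \<eta> x $ j\<bar> \<le> 6 / norm x"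
    "k * norm x > 1 \<Longrightarrow> \<bar>grad \<eta> x $ j\<bar> \<le> 2 * (1 / (k\<^sup>2 * (norm x)\<^sup>2 - 1) + (1 / (k\<^sup>2 * (norm x)\<^sup>2 - 1))\<^sup>2) / norm x"
proof -
  let ?f' = "flat ([:0, 0, 1:] * (1 - pderiv 1))"
  have d: "((\<lambda>t. flat 1 (k\<^sup>2 * t - 1)) has_real_derivative ?f' (k\<^sup>2 * t - 1) * k\<^sup>2) (at t)" for t
  proof -
    have "((\<lambda>t. k\<^sup>2 * t - 1) has_real_derivative k\<^sup>2) (at t)" by (auto intro!: derivative_eq_intros)
    from DERIV_chain2[OF flat_has_derivative this, of 1] show ?thesis .
  qed
  have co: "continuous_on UNIV (\<lambda>t. ?f' (k\<^sup>2 * t - 1) * k\<^sup>2)"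
    by (intro continuous_on_mult continuous_on_compose2[OF flat_continuous] continuous_on_diff continuous_on_id continuous_on_const subset_UNIV)
  show "C1 \<eta>" unfolding \<eta>_def by (rule C1_radial(1)[OF d co])
  have g: "grad \<eta> x = (2 * (?f' (k\<^sup>2 * (norm x)\<^sup>2 - 1) * k\<^sup>2)) *\<^sub>R x"
    unfolding \<eta>_def by (subst C1_radial(2)[OF d co]) simp
  show "0 \<le> \<eta> x" "\<eta> x \<le> 1" by (auto simp: \<eta>_def flat_def)
  show "\<eta> x = 0" if "norm x \<le> 1 / k"
  proof -
    have "k * norm x \<le> 1" using that k by (simp add: field_simps)
    then have "(k * norm x)\<^sup>2 \<le> 1\<^sup>2" using k by (intro power_mono) auto
    then show ?thesis by (simp add: \<eta>_def flat_def power_mult_distrib)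
  qed
  define t where "t = k\<^sup>2 * (norm x)\<^sup>2 - 1"
  define s where "s = 1 / t"
  have e1: "\<bar>grad \<eta> x $ j\<bar> \<le> (2 * (s + s\<^sup>2) * exp (- s)) / norm x" if t: "t > 0" and x: "x \<noteq> 0"
  proof -
    have s: "s > 0" "t * s = 1" using t by (simp_all add: s_def)
    have f: "?f' t = s\<^sup>2 * exp (- s)" using t by (simp add: flat_def s_def power2_eq_square)
    have "\<bar>grad \<eta> x $ j\<bar> = 2 * (s\<^sup>2 * exp (- s)) * k\<^sup>2 * \<bar>x $ j\<bar>"
      unfolding g t_def[symmetric] f by (simp add: abs_mult)
    also have "\<dots> \<le> 2 * (s\<^sup>2 * exp (- s)) * k\<^sup>2 * norm x"
      by (intro mult_left_mono component_le_norm_cart) simp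
    also have "\<dots> = 2 * (s\<^sup>2 * exp (- s)) * (t + 1) / norm x" using x by (simp add: t_def power2_eq_square)
    also have "2 * (s\<^sup>2 * exp (- s)) * (t + 1) = 2 * (s + s\<^sup>2) * exp (- s)"
    proof -
      have "s\<^sup>2 * (t + 1) = s * (t * s) + s\<^sup>2" by (simp add: power2_eq_square algebra_simps)
      also have "\<dots> = s + s\<^sup>2" by (simp only: s(2) mult_1_right)
      finally show ?thesis by (metis mult.assoc mult.commute)
    qed
    finally show ?thesis .
  qed
  have e0: "grad \<eta> x $ j = 0" if "t \<le> 0"
    using that unfolding g t_def[symmetric] by (simp add: flat_def)
  show "\<bar>grad \<eta> x $ j\<bar> \<le> 6 / norm x" if x: "x \<noteq> 0"
  proof (cases "t > 0")
    case True
    then have s: "s > 0" by (simp add: s_def)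
    have ex: "1 + s + s\<^sup>2 / 2 \<le> exp s" using exp_lower_Taylor_quadratic[of s] s by simp
    have "s + s\<^sup>2 \<le> 3 * exp s" using ex s zero_le_power2[of s] by linarith
    then have "(s + s\<^sup>2) * exp (- s) \<le> 3" by (simp add: exp_minus field_simps)
    then have "2 * (s + s\<^sup>2) * exp (- s) \<le> 6" unfolding mult.assoc by linarith
    then have "(2 * (s + s\<^sup>2) * exp (- s)) / norm x \<le> 6 / norm x" by (rule divide_right_mono) simp
    then show ?thesis using e1[OF True x] by linarith
  next
    case False
    then show ?thesis using e0 by simp
  qed
  show "\<bar>grad \<eta> x $ j\<bar> \<le> 2 * (1 / (k\<^sup>2 * (norm x)\<^sup>2 - 1) + (1 / (k\<^sup>2 * (norm x)\<^sup>2 - 1))\<^sup>2) / norm x" if "k * norm x > 1"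
  proof -
    have "1\<^sup>2 < (k * norm x)\<^sup>2" using that by (intro power_strict_mono) auto
    then have t: "t > 0" by (simp add: t_def power_mult_distrib)
    have x: "x \<noteq> 0" using that by auto
    have s: "s > 0" using t by (simp add: s_def)
    have "2 * (s + s\<^sup>2) * exp (- s) \<le> 2 * (s + s\<^sup>2) * 1" using s by (intro mult_left_mono) auto
    then have "(2 * (s + s\<^sup>2) * exp (- s)) / norm x \<le> 2 * (s + s\<^sup>2) / norm x" by (intro divide_right_mono) auto
    then have "\<bar>grad \<eta> x $ j\<bar> \<le> 2 * (s + s\<^sup>2) / norm x" using e1[OF t x] by linarith
    then show ?thesis by (simp only: s_def t_def)
  qed
qed

text \<open>Apply \<open>weak_gradient_off_origin\<close> to $\eta_k \psi$ with the cut-offs $\eta_k$, and let $k$ tend to infinity. The only delicate term is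
$\varphi \psi \partial_j \eta_k$: it tends to zero pointwise and is dominated by $|\varphi| / |x| \le \varphi^2 + |x|^{-2}$, up to a constant.\<close>

lemma weak_gradient:
  assumes \<psi>: "C1 \<psi>" and K: "compact K" "K \<subseteq> \<Omega>" and v: "vanishes_outside K \<psi>"
  shows "(\<integral>x. \<Phi> (norm x) * grad \<psi> x $ j \<partial>lborel) = - (\<integral>x. F x $ j * \<psi> x \<partial>lborel)"
proof -
  define k where "k i = real (Suc i)" for i
  have k: "k i > 0" for i by (simp add: k_def)
  define \<eta> where "\<eta> i x = flat 1 ((k i)\<^sup>2 * (norm x)\<^sup>2 - 1)" for i and x :: "real^'n"
  note cut = cutoff[OF k, folded \<eta>_def]
  define \<rho> where "\<rho> i x = \<eta> i x * \<psi> x" for i x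
  have [measurable]: "K \<in> sets borel" by (rule borel_compact[OF K(1)])
  have \<eta>C: "C1 (\<eta> i)" for i using cut(1) by (simp add: \<eta>_def[abs_def])
  have \<rho>C: "C1 (\<rho> i)" and \<rho>g: "grad (\<rho> i) = (\<lambda>x. \<eta> i x *\<^sub>R grad \<psi> x + \<psi> x *\<^sub>R grad (\<eta> i) x)" for i
    unfolding \<rho>_def[abs_def] by (rule C1_mult[OF \<eta>C \<psi>])+
  have gv: "vanishes_outside K (\<lambda>x. grad \<psi> x $ j)" 
    using grad_vanishes_outside[OF \<psi> compact_imp_closed[OF K(1)] v] by (simp add: vanishes_outside_def)
  obtain M1 where M1: "M1 > 0" "\<And>x. \<bar>grad \<psi> x $ j\<bar> \<le> M1" using cont_supported_bounded[OF C1_grad_continuous[OF \<psi>] K(1) gv] by blast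
  obtain M2 where M2: "M2 > 0" "\<And>x. \<bar>\<psi> x\<bar> \<le> M2" using cont_supported_bounded[OF C1_continuous[OF \<psi>] K(1) v] by blast
  have [measurable]: "\<psi> \<in> borel_measurable borel" "(\<lambda>x. grad \<psi> x $ j) \<in> borel_measurable borel" 
    "\<eta> i \<in> borel_measurable borel" "(\<lambda>x. grad (\<eta> i) x $ j) \<in> borel_measurable borel" 
    "(\<lambda>x. grad (\<rho> i) x $ j) \<in> borel_measurable borel" "\<rho> i \<in> borel_measurable borel" for i
    by (rule borel_measurable_continuous_onI, rule C1_continuous C1_grad_continuous, rule \<psi> \<eta>C \<rho>C)+
  have step: "(\<integral>x. \<Phi> (norm x) * grad (\<rho> i) x $ j \<partial>lborel) = - (\<integral>x. F x $ j * \<rho> i x \<partial>lborel)" for i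
  proof (rule weak_gradient_off_origin[OF \<rho>C, where K = "K - ball 0 (1 / k i)"])
    show "compact (K - ball 0 (1 / k i))" using K(1) by (intro compact_diff) auto
    show "0 \<notin> K - ball 0 (1 / k i)" using k by simp
    show "vanishes_outside (K - ball 0 (1 / k i)) (\<rho> i)"
      using v cut(4)[of _ i] by (auto simp: vanishes_outside_def \<rho>_def)
  qed (use K in auto)
  obtain b where b: "b \<in> radii" "c \<le> b" "K \<subseteq> cball 0 b" by (rule compact_radius[OF K])
  have lim: "(\<lambda>i. 1 / ((k i)\<^sup>2 * (norm x)\<^sup>2 - 1)) \<longlonglongrightarrow> 0" if "x \<noteq> 0" for x :: "real^'n"
  proof -
    have "filterlim k at_top sequentially" unfolding k_def
      by (rule filterlim_compose[OF filterlim_real_sequentially filterlim_Suc])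
    then have "filterlim (\<lambda>i. (k i)\<^sup>2) at_top sequentially" by (intro filterlim_pow_at_top) auto
    then have "filterlim (\<lambda>i. (norm x)\<^sup>2 * (k i)\<^sup>2) at_top sequentially"
      using that by (intro filterlim_tendsto_pos_mult_at_top[OF tendsto_const]) auto
    then have "filterlim (\<lambda>i. -1 + (norm x)\<^sup>2 * (k i)\<^sup>2) at_top sequentially"
      by (rule filterlim_tendsto_add_at_top[OF tendsto_const])
    then have "((\<lambda>i. 1 / (-1 + (norm x)\<^sup>2 * (k i)\<^sup>2)) \<longlonglongrightarrow> 0)"
      by (intro tendsto_divide_0[OF tendsto_const] filterlim_at_top_imp_at_infinity)
    then show ?thesis by (simp add: mult.commute)
  qed
  have large: "eventually (\<lambda>i. k i * norm x > 1) sequentially" if "x \<noteq> 0" for x :: "real^'n"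
  proof -
    obtain m :: nat where m: "1 / norm x < real m" using reals_Archimedean2 by blast
    show ?thesis
    proof (rule eventually_sequentiallyI[of m])
      fix i assume "m \<le> i"
      then have "1 / norm x < k i" using m by (simp add: k_def)
      then show "k i * norm x > 1" using that by (simp add: field_simps)
    qed
  qed
  have \<eta>lim: "(\<lambda>i. \<eta> i x) \<longlonglongrightarrow> 1" if x: "x \<noteq> 0" for x
  proof (rule Lim_transform_eventually)
    show "(\<lambda>i. exp (- (1 / ((k i)\<^sup>2 * (norm x)\<^sup>2 - 1)))) \<longlonglongrightarrow> 1"
      using tendsto_exp[OF tendsto_minus[OF lim[OF x]]] by simp
    show "\<forall>\<^sub>F i in sequentially. exp (- (1 / ((k i)\<^sup>2 * (norm x)\<^sup>2 - 1))) = \<eta> i x"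
      using large[OF x]
    proof eventually_elim
      case (elim i)
      then have "1\<^sup>2 < (k i * norm x)\<^sup>2" by (intro power_strict_mono) auto
      then show ?case by (simp add: \<eta>_def flat_def power_mult_distrib)
    qed
  qed
  have g\<eta>lim: "(\<lambda>i. grad (\<eta> i) x $ j) \<longlonglongrightarrow> 0" if x: "x \<noteq> 0" for x
  proof (rule Lim_null_comparison)
    let ?u = "\<lambda>i. 1 / ((k i)\<^sup>2 * (norm x)\<^sup>2 - 1)"
    show "\<forall>\<^sub>F i in sequentially. norm (grad (\<eta> i) x $ j) \<le> 2 * (?u i + (?u i)\<^sup>2) / norm x"
      using large[OF x]
    proof eventually_elim
      case (elim i)
      then show ?case using cut(6)[of i x j] by (simp only: real_norm_def)
    qed
    have "(\<lambda>i. 2 * (?u i + (?u i)\<^sup>2) / norm x) \<longlonglongrightarrow> 2 * (0 + 0\<^sup>2) / norm x"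
      using x by (intro tendsto_divide tendsto_mult tendsto_add tendsto_power tendsto_const lim) auto
    then show "(\<lambda>i. 2 * (?u i + (?u i)\<^sup>2) / norm x) \<longlonglongrightarrow> 0" by simp
  qed
  have Pi: "integrable lborel (\<lambda>x. indicator K x * (\<Phi> (norm x))\<^sup>2)" by (rule potential_L2[OF K])
  have Fi: "integrable lborel (\<lambda>x. indicator K x * norm (F x))" by (rule locally_L2_imp_L1(1)[OF L2 Fm K])
  \<comment> \<open>the majorant: both products $|\varphi| \cdot 1$ and $|\varphi| \cdot |x|^{-1}$ are estimated by $|st| \le s^2 + t^2$\<close>
  define W where "W x = M1 * (indicator K x * (\<Phi> (norm x))\<^sup>2 + indicator K x) + 
     6 * M2 * (indicator K x * (\<Phi> (norm x))\<^sup>2 + indicator {0<..b} (norm x) * (1 / (norm x)\<^sup>2))" for x :: "real^'n"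
  have Wi: "integrable lborel W" unfolding W_def[abs_def]
    using Pi integrable_indicator_compact[OF K(1)] inverse_square_integrable[of b] by (intro Bochner_Integration.integrable_add integrable_mult_right) auto
  have am: "\<bar>s\<bar> * \<bar>t\<bar> \<le> s\<^sup>2 + t\<^sup>2" for s t :: real
  proof -
    have "2 * \<bar>s\<bar> * \<bar>t\<bar> \<le> s\<^sup>2 + t\<^sup>2" using sum_squares_bound[of "\<bar>s\<bar>" "\<bar>t\<bar>"] by simp
    moreover have "0 \<le> \<bar>s\<bar> * \<bar>t\<bar>" by simp
    ultimately show ?thesis unfolding mult.assoc by linarith
  qed
  have "(\<lambda>i. \<integral>x. \<Phi> (norm x) * grad (\<rho> i) x $ j \<partial>lborel) \<longlonglongrightarrow> (\<integral>x. \<Phi> (norm x) * grad \<psi> x $ j \<partial>lborel)"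
  proof (rule integral_dominated_convergence[OF _ _ Wi])
    show "AE x in lborel. (\<lambda>i. \<Phi> (norm x) * grad (\<rho> i) x $ j) \<longlonglongrightarrow> \<Phi> (norm x) * grad \<psi> x $ j"
      using AE_lborel_singleton[of 0]
    proof eventually_elim
      case (elim x)
      have "(\<lambda>i. \<Phi> (norm x) * (\<eta> i x * grad \<psi> x $ j + \<psi> x * grad (\<eta> i) x $ j)) \<longlonglongrightarrow> \<Phi> (norm x) * (1 * grad \<psi> x $ j + \<psi> x * 0)"
        by (intro tendsto_mult tendsto_add tendsto_const \<eta>lim[OF elim] g\<eta>lim[OF elim])
      then show ?case by (simp add: \<rho>g)
    qed
    show "AE x in lborel. norm (\<Phi> (norm x) * grad (\<rho> i) x $ j) \<le> W x" for i
      using AE_lborel_singleton[of 0]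
    proof eventually_elim
      case (elim x)
      show ?case
      proof (cases "x \<in> K")
        case True
        have nx: "norm x \<in> {0<..b}" using True b(3) elim by auto
        let ?p = "\<bar>\<Phi> (norm x)\<bar>"
        have g: "\<bar>grad (\<rho> i) x $ j\<bar> \<le> M1 + M2 * (6 / norm x)"
        proof -
          have "\<bar>grad (\<rho> i) x $ j\<bar> \<le> \<bar>\<eta> i x\<bar> * \<bar>grad \<psi> x $ j\<bar> + \<bar>\<psi> x\<bar> * \<bar>grad (\<eta> i) x $ j\<bar>"
            unfolding \<rho>g by (simp add: abs_mult[symmetric])
          also have "\<dots> \<le> 1 * M1 + M2 * (6 / norm x)"
            using cut(2,3)[of i x] cut(5)[OF elim, of i j] M1 M2 by (intro add_mono mult_mono) auto
          finally show ?thesis by simp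
        qed
        have "norm (\<Phi> (norm x) * grad (\<rho> i) x $ j) \<le> ?p * (M1 + M2 * (6 / norm x))"
          unfolding real_norm_def abs_mult by (intro mult_left_mono g) simp
        also have "\<dots> = M1 * (?p * \<bar>1\<bar>) + 6 * M2 * (?p * \<bar>1 / norm x\<bar>)" by (simp add: algebra_simps)
        also have "\<dots> \<le> M1 * ((\<Phi> (norm x))\<^sup>2 + 1\<^sup>2) + 6 * M2 * ((\<Phi> (norm x))\<^sup>2 + (1 / norm x)\<^sup>2)"
          using M1(1) M2(1) by (intro add_mono mult_left_mono am) auto
        also have "\<dots> = W x" using True nx by (simp add: W_def power_divide)
        finally show ?thesis .
      next
        case False
        have "grad (\<rho> i) x $ j = 0" using False v gv by (simp add: \<rho>g vanishes_outside_def)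
        moreover have "W x \<ge> 0" using M1(1) M2(1) by (simp add: W_def)
        ultimately show ?thesis by simp
      qed
    qed
  qed measurable
  moreover have "(\<lambda>i. \<integral>x. F x $ j * \<rho> i x \<partial>lborel) \<longlonglongrightarrow> (\<integral>x. F x $ j * \<psi> x \<partial>lborel)"
  proof (rule integral_dominated_convergence[where w="\<lambda>x. M2 * (indicator K x * norm (F x))"])
    show "integrable lborel (\<lambda>x. M2 * (indicator K x * norm (F x)))" using Fi by simp
    show "AE x in lborel. (\<lambda>i. F x $ j * \<rho> i x) \<longlonglongrightarrow> F x $ j * \<psi> x"
      using AE_lborel_singleton[of 0]
    proof eventually_elim
      case (elim x)
      have "(\<lambda>i. F x $ j * (\<eta> i x * \<psi> x)) \<longlonglongrightarrow> F x $ j * (1 * \<psi> x)"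
        by (intro tendsto_mult tendsto_const \<eta>lim[OF elim])
      then show ?case by (simp add: \<rho>_def)
    qed
    show "AE x in lborel. norm (F x $ j * \<rho> i x) \<le> M2 * (indicator K x * norm (F x))" for i
    proof (rule AE_I2)
      fix x
      show "norm (F x $ j * \<rho> i x) \<le> M2 * (indicator K x * norm (F x))"
      proof (cases "x \<in> K")
        case True
        have "\<bar>\<eta> i x\<bar> * \<bar>\<psi> x\<bar> \<le> 1 * M2" using cut(2,3)[of i x] M2 by (intro mult_mono) auto
        then have "\<bar>F x $ j\<bar> * (\<bar>\<eta> i x\<bar> * \<bar>\<psi> x\<bar>) \<le> norm (F x) * M2"
          using component_le_norm_cart[of "F x" j] by (intro mult_mono) auto
        then show ?thesis using True by (simp add: \<rho>_def abs_mult mult.commute)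
      qed (use v in \<open>simp add: \<rho>_def vanishes_outside_def\<close>)
    qed
  qed measurable
  then have "(\<lambda>i. - (\<integral>x. F x $ j * \<rho> i x \<partial>lborel)) \<longlonglongrightarrow> - (\<integral>x. F x $ j * \<psi> x \<partial>lborel)" by (rule tendsto_minus)
  then have "(\<lambda>i. \<integral>x. \<Phi> (norm x) * grad (\<rho> i) x $ j \<partial>lborel) \<longlonglongrightarrow> - (\<integral>x. F x $ j * \<psi> x \<partial>lborel)" by (simp only: step)
  ultimately show ?thesis by (rule LIMSEQ_unique)
qed

end

section \<open>Equivariant fields are gradients\<close>

lemma (in radial_field) potential_in_W12:
  assumes A: "A \<in> L2_loc \<Omega>" and F: "borel_version \<Omega> A F"
  shows "has_weak_gradient \<Omega> (\<lambda>x. \<Phi> (norm x)) A" "(\<lambda>x. \<Phi> (norm x)) \<in> W12_loc \<Omega>"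
proof -
  let ?\<phi> = "\<lambda>x::real^'n. \<Phi> (norm x)"
  have \<phi>m: "?\<phi> \<in> borel_measurable borel" by measurable
  show g: "has_weak_gradient \<Omega> ?\<phi> A"
    unfolding has_weak_gradient_def dist_eq_def
  proof
    fix \<psi> assume "\<psi> \<in> test_functions \<Omega>"
    then obtain K where K: "compact K" "K \<subseteq> \<Omega>" "vanishes_outside K \<psi>" and \<psi>: "C1 \<psi>" by (rule test_function_C1)
    have "dist_grad \<Omega> ?\<phi> \<psi> $ j = regular_dist \<Omega> A \<psi> $ j" for j
    proof -
      have gv: "vanishes_outside \<Omega> (\<lambda>x. grad \<psi> x $ j)"
        using grad_vanishes_outside[OF \<psi> compact_imp_closed[OF K(1)] K(3)] K(2) by (auto simp: vanishes_outside_def)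
      have gm: "(\<lambda>x. grad \<psi> x $ j) \<in> borel_measurable borel"
        by (rule borel_measurable_continuous_onI[OF C1_grad_continuous[OF \<psi>]])
      have "dist_grad \<Omega> ?\<phi> \<psi> $ j = - regular_dist \<Omega> ?\<phi> (\<lambda>x. grad \<psi> x $ j)"
        by (simp add: dist_grad_def dist_partial_def partial_deriv_grad)
      also have "\<dots> = - (\<integral>x. \<Phi> (norm x) * grad \<psi> x $ j \<partial>lborel)"
        by (simp only: regular_dist_borel[OF \<Omega>(1) \<phi>m gm gv])
      also have "\<dots> = (\<integral>x. F x $ j * \<psi> x \<partial>lborel)" by (simp only: weak_gradient[OF \<psi> K] minus_minus)
      also have "\<dots> = regular_dist \<Omega> A \<psi> $ j"
        by (rule regular_dist_component[OF \<Omega>(1) A F C1_continuous[OF \<psi>] K, symmetric])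
      finally show ?thesis .
    qed
    then show "dist_grad \<Omega> ?\<phi> \<psi> = regular_dist \<Omega> A \<psi>" by (simp add: vec_eq_iff)
  qed
  have "?\<phi> \<in> L2_loc \<Omega>"
    unfolding L2_loc_def
  proof (intro CollectI conjI allI impI)
    show "?\<phi> \<in> borel_measurable (lebesgue_on \<Omega>)"
      by (rule measurable_restrict_space1[OF measurable_completion]) (use \<phi>m in simp)
    fix K assume K: "compact K \<and> K \<subseteq> \<Omega>"
    have [measurable]: "K \<in> sets borel" using K borel_compact by blast
    have "integrable lborel (\<lambda>x. indicator K x * (\<Phi> (norm x))\<^sup>2)" using K by (intro potential_L2) auto
    then have "integrable lebesgue (\<lambda>x. indicator K x * (\<Phi> (norm x))\<^sup>2)" by (subst integrable_completion) auto
    then show "integrable (lebesgue_on K) (\<lambda>x. (norm (\<Phi> (norm x)))\<^sup>2)" by (subst integrable_restrict_space) auto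
  qed
  then show "?\<phi> \<in> W12_loc \<Omega>" using g A by (auto simp: W12_loc_def)
qed

lemma SO_invariant_radial: "SO_invariant \<Omega> (\<lambda>x. f (norm x))"
  by (simp add: SO_invariant_def rotation_norm)

theorem equivariant_field_is_gradient:
  fixes A :: "real^'n \<Rightarrow> real^'n"
  assumes n: "CARD('n) \<ge> 3" and \<Omega>: "open \<Omega>" "connected \<Omega>" "\<Omega> \<noteq> {}" "radially_symmetric \<Omega>"
    and A: "A \<in> L2_loc \<Omega>" and eq: "\<And>g. rotation_matrix g \<Longrightarrow> AE x in lebesgue_on \<Omega>. A (g *v x) = g *v A x"
  shows "\<exists>\<nu> :: real \<Rightarrow> real. AE x in lebesgue_on \<Omega>. A x = \<nu> (norm x) *\<^sub>R x"
    "\<exists>\<phi>\<in>W12_loc \<Omega>. SO_invariant \<Omega> \<phi> \<and> has_weak_gradient \<Omega> \<phi> A"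
proof -
  obtain F where F: "borel_version \<Omega> A F" using borel_version_exists[OF \<Omega>(1)] A by (auto simp: L2_loc_def)
  have Fm: "F \<in> borel_measurable borel" and ae: "AE x in lborel. x \<in> \<Omega> \<longrightarrow> A x = F x" using F by (auto simp: borel_version_def)
  have L2: "locally_L2 \<Omega> F" by (rule borel_version_L2[OF \<Omega>(1) A F])
  obtain \<nu> where \<nu>: "\<nu> \<in> borel_measurable borel" "AE x in lborel. x \<in> \<Omega> \<longrightarrow> F x = \<nu> (norm x) *\<^sub>R x"
    using radial_profile[OF n \<Omega>(1,4) Fm L2 borel_version_equivariant[OF \<Omega>(1,4) F eq]] by blast
  have "AE x in lborel. x \<in> \<Omega> \<longrightarrow> A x = \<nu> (norm x) *\<^sub>R x" using ae \<nu>(2) by eventually_elim simp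
  then show "\<exists>\<nu> :: real \<Rightarrow> real. AE x in lebesgue_on \<Omega>. A x = \<nu> (norm x) *\<^sub>R x"
    by (auto simp: AE_lebesgue_on_iff[OF \<Omega>(1)])
  have "\<not> \<Omega> \<subseteq> {0}"
  proof
    assume "\<Omega> \<subseteq> {0}"
    then have "\<Omega> = {0}" using \<Omega>(3) by blast
    then show False using \<Omega>(1) not_open_singleton by metis
  qed
  then obtain x0 where x0: "x0 \<in> \<Omega>" "x0 \<noteq> 0" by blast
  interpret radial_field \<Omega> F \<nu> "norm x0"
  proof
    show "x \<in> \<Omega>" if "norm x = norm x0" for x by (rule radially_symmetric_norm[OF n \<Omega>(4) x0(1) that])
  qed (use n \<Omega> Fm L2 \<nu> x0 in auto)
  show "\<exists>\<phi>\<in>W12_loc \<Omega>. SO_invariant \<Omega> \<phi> \<and> has_weak_gradient \<Omega> \<phi> A"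
    using potential_in_W12[OF A F] SO_invariant_radial by blast
qed

theorem theorem1p3:
  fixes \<Omega> :: "(real^'n) set"
  assumes "CARD('n) \<ge> 3"
    and "open \<Omega>" and "connected \<Omega>" and "\<Omega> \<noteq> {}"
    and "radially_symmetric \<Omega>"
  shows
    "(\<forall>A :: real^'n \<Rightarrow> real^'n. A \<in> L2_loc \<Omega> \<longrightarrow>
        ((\<forall>g. rotation_matrix g \<longrightarrow> (AE x in lebesgue_on \<Omega>. A (g *v x) = g *v A x)) \<longrightarrow>
          (\<exists>\<nu> :: real \<Rightarrow> real. AE x in lebesgue_on \<Omega>. A x = \<nu> (norm x) *\<^sub>R x) \<and>
          (\<exists>\<phi>\<in>W12_loc \<Omega>. SO_invariant \<Omega> \<phi> \<and> has_weak_gradient \<Omega> \<phi> A)) \<and>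
        ((\<forall>g. rotation_matrix g \<longrightarrow> (\<forall>x\<in>\<Omega>. A (g *v x) = g *v A x)) \<longrightarrow>
          (\<exists>\<nu> :: real \<Rightarrow> real. \<forall>x\<in>\<Omega>. A x = \<nu> (norm x) *\<^sub>R x))) \<and>
     (\<forall>B :: ('n, real^'n^'n) distribution.
        (\<exists>A\<in>L2_loc \<Omega>. dist_eq \<Omega> B (dist_curl \<Omega> A)) \<longrightarrow>
        (\<forall>g. rotation_matrix g \<longrightarrow> dist_eq \<Omega> (dist_comp B g) (dist_conj g B)) \<longrightarrow>
        dist_eq \<Omega> B (\<lambda>\<psi>. 0))"
proof (intro conjI allI impI)
  fix A :: "real^'n \<Rightarrow> real^'n"
  assume A: "A \<in> L2_loc \<Omega>" and eq: "\<forall>g. rotation_matrix g \<longrightarrow> (AE x in lebesgue_on \<Omega>. A (g *v x) = g *v A x)"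
  show "\<exists>\<nu> :: real \<Rightarrow> real. AE x in lebesgue_on \<Omega>. A x = \<nu> (norm x) *\<^sub>R x"
    "\<exists>\<phi>\<in>W12_loc \<Omega>. SO_invariant \<Omega> \<phi> \<and> has_weak_gradient \<Omega> \<phi> A"
    by (rule equivariant_field_is_gradient[OF assms A eq[rule_format]]; assumption)+
next
  fix A :: "real^'n \<Rightarrow> real^'n" and a :: 'n
  assume eq: "\<forall>g. rotation_matrix g \<longrightarrow> (\<forall>x\<in>\<Omega>. A (g *v x) = g *v A x)"
  have "A x = (A (norm x *\<^sub>R axis a 1) $ a / norm x) *\<^sub>R x" if "x \<in> \<Omega>" for x
    by (rule equivariant_field_radial[OF assms(1,5) _ that]) (use eq in blast)
  then show "\<exists>\<nu> :: real \<Rightarrow> real. \<forall>x\<in>\<Omega>. A x = \<nu> (norm x) *\<^sub>R x"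
    by (intro exI[of _ "\<lambda>s. A (s *\<^sub>R axis a 1) $ a / s"] ballI)
next
  fix B :: "('n, real^'n^'n) distribution"
  assume "\<exists>A\<in>L2_loc \<Omega>. dist_eq \<Omega> B (dist_curl \<Omega> A)"
    and eq: "\<forall>g. rotation_matrix g \<longrightarrow> dist_eq \<Omega> (dist_comp B g) (dist_conj g B)"
  then obtain A where A: "A \<in> L2_loc \<Omega>" "dist_eq \<Omega> B (dist_curl \<Omega> A)" by blast
  show "dist_eq \<Omega> B (\<lambda>\<psi>. 0)"
    by (rule equivariant_curl_zero[OF assms(1,2,5) A eq[rule_format]])
qed

end
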